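(* Let $X_1,X_2,\dots$ be free copies of a centered self-adjoint random variable with variance $1$ in a tracial noncommutative probability space $(\mathcal{A},\tau)$. Then, as $n\to\infty$, $$Q_n=\frac1{2n}\sum_{1\le k<l\le n}\big(X_kX_l+X_lX_k+i(X_kX_l-X_lX_k)\big)$$ converges in distribution to a random variable $Y$ with $R$-transform $$R_Y(z)=\tfrac12\big(\tan(z)+\sec(z)-1\big).$$
   Context: A tracial noncommutative probability space $(\mathcal{A},\tau)$ is a von Neumann algebra with a normal faithful tracial state. Free cumulants $K_n:\mathcal{A}^n\to\mathbb{C}$ are defined implicitly by $\tau(X_1\cdots X_n)=\sum_{\pi\in NC(n)}\prod_{B\in\pi}K_{|B|}(X_i: i\in B)$, where $NC(n)$ is the set of noncrossing partitions of $\{1,\dots,n\}$; $K_n(X)=K_n(X,\dots,X)$. The $R$-transform is $R_X(z)=\sum_{n\ge0}K_{n+1}(X)z^n$. Convergence in distribution $X_n\to X$ means $\tau(X_n^m)\to\tau(X^m)$ for all $m\in\mathbb{N}$, equivalently $K_m(X_n)\to K_m(X)$ for all $m$. Centered means $\tau(X)=0$; variance is $\tau(X^2)-\tau(X)^2$. *)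

theory Defs
  imports "HOL-Analysis.Analysis"
begin

section \<open>Complex Hilbert spaces\<close>

class scaleC = scaleR +
  fixes scaleC :: "complex \<Rightarrow> 'a \<Rightarrow> 'a"  (infixr \<open>*\<^sub>C\<close> 75)
  assumes scaleR_scaleC: "r *\<^sub>R x = complex_of_real r *\<^sub>C x"

class complex_vector = scaleC + ab_group_add +
  assumes scaleC_add_right: "a *\<^sub>C (x + y) = a *\<^sub>C x + a *\<^sub>C y"
    and scaleC_add_left: "(a + b) *\<^sub>C x = a *\<^sub>C x + b *\<^sub>C x"
    and scaleC_scaleC: "a *\<^sub>C b *\<^sub>C x = (a * b) *\<^sub>C x"
    and scaleC_one: "1 *\<^sub>C x = x"

text \<open>
  The norm, the metric and completeness come from the underlying real inner product
  \<open>Re \<langle>x, y\<rangle>\<close>; the complex inner product is linear in its second argument.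
\<close>

class chilbert_space = complex_vector + real_inner + complete_space +
  fixes cinner :: "'a \<Rightarrow> 'a \<Rightarrow> complex"
  assumes cinner_commute: "cinner x y = cnj (cinner y x)"
    and cinner_add_right: "cinner x (y + z) = cinner x y + cinner x z"
    and cinner_scaleC_right: "cinner x (a *\<^sub>C y) = a * cinner x y"
    and inner_eq_Re_cinner: "inner x y = Re (cinner x y)"

section \<open>The algebra of bounded operators on a Hilbert space\<close>

typedef (overloaded) 'h bop =
  "{T :: 'h::chilbert_space \<Rightarrow> 'h. bounded_linear T \<and> (\<forall>a x. T (a *\<^sub>C x) = a *\<^sub>C T x)}"
  morphisms bop_apply Bop
  by (rule exI[of _ "\<lambda>x. x"]) (simp add: bounded_linear_ident)

setup_lifting type_definition_bop

lemma scaleC_minus_right: "a *\<^sub>C (- x) = - (a *\<^sub>C x)" for x :: "'a::complex_vector"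
  by (metis add.right_inverse add_cancel_right_right add_eq_0_iff scaleC_add_right)

lemma scaleC_zero_right: "a *\<^sub>C (0 :: 'a::complex_vector) = 0"
  by (metis add_cancel_right_right scaleC_add_right)

lemma scaleC_zero_left: "0 *\<^sub>C x = (0 :: 'a::complex_vector)"
  by (metis add_cancel_right_right scaleC_add_left add_0)

lemma scaleC_diff_right: "a *\<^sub>C (x - y) = a *\<^sub>C x - a *\<^sub>C y" for x :: "'a::complex_vector"
  by (metis scaleC_add_right scaleC_minus_right diff_conv_add_uminus)

lemma cinner_zero_right: "cinner x 0 = 0" for x :: "'h::chilbert_space"
  using cinner_add_right[of x 0 0] by simp

lemma cinner_same_real: "cinner x x = complex_of_real ((norm x)\<^sup>2)" for x :: "'h::chilbert_space"
proof (rule complex_eqI)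
  show "Re (cinner x x) = Re (complex_of_real ((norm x)\<^sup>2))"
    by (simp add: power2_norm_eq_inner inner_eq_Re_cinner)
  have "Im (cinner x x) = - Im (cinner x x)"
    using arg_cong[OF cinner_commute[of x x], of Im] by simp
  then show "Im (cinner x x) = Im (complex_of_real ((norm x)\<^sup>2))"
    by simp
qed

lemma norm_scaleC: "norm (a *\<^sub>C x) = cmod a * norm x" for x :: "'h::chilbert_space"
proof -
  have "cinner (a *\<^sub>C x) (a *\<^sub>C x) = a * cnj a * cinner x x"
    by (metis cinner_commute cinner_scaleC_right complex_cnj_mult mult.assoc)
  then have "complex_of_real ((norm (a *\<^sub>C x))\<^sup>2) = complex_of_real ((cmod a * norm x)\<^sup>2)"
    by (simp only: cinner_same_real complex_norm_square of_real_mult power_mult_distrib)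
  then have "(norm (a *\<^sub>C x))\<^sup>2 = (cmod a * norm x)\<^sup>2"
    by (simp only: of_real_eq_iff)
  then show ?thesis
    by (simp add: power2_eq_iff_nonneg)
qed

lemma bounded_linear_scaleC: "bounded_linear (\<lambda>x :: 'h::chilbert_space. a *\<^sub>C x)"
proof (rule bounded_linear_intro[where K = "cmod a"])
  show "a *\<^sub>C (r *\<^sub>R x) = r *\<^sub>R (a *\<^sub>C x)" for r and x :: 'h
    by (simp add: scaleR_scaleC scaleC_scaleC mult.commute)
qed (simp_all add: scaleC_add_right norm_scaleC mult.commute)

instantiation bop :: (chilbert_space) "{complex_vector, ring, monoid_mult}"
begin

lift_definition zero_bop :: "'a bop" is "\<lambda>x. 0"
  by (simp add: scaleC_zero_right)

lift_definition one_bop :: "'a bop" is "\<lambda>x. x"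
  by (simp add: bounded_linear_ident)

lift_definition plus_bop :: "'a bop \<Rightarrow> 'a bop \<Rightarrow> 'a bop" is "\<lambda>S T x. S x + T x"
  by (auto simp: bounded_linear_add scaleC_add_right)

lift_definition uminus_bop :: "'a bop \<Rightarrow> 'a bop" is "\<lambda>T x. - T x"
  by (auto simp: bounded_linear_minus scaleC_minus_right)

lift_definition minus_bop :: "'a bop \<Rightarrow> 'a bop \<Rightarrow> 'a bop" is "\<lambda>S T x. S x - T x"
  by (auto simp: bounded_linear_sub scaleC_diff_right)

lift_definition times_bop :: "'a bop \<Rightarrow> 'a bop \<Rightarrow> 'a bop" is "\<lambda>S T x. S (T x)"
  by (auto intro: bounded_linear_compose)

lift_definition scaleC_bop :: "complex \<Rightarrow> 'a bop \<Rightarrow> 'a bop" is "\<lambda>a T x. a *\<^sub>C T x"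
  by (auto intro: bounded_linear_compose[OF bounded_linear_scaleC] simp: scaleC_scaleC mult.commute)

definition scaleR_bop :: "real \<Rightarrow> 'a bop \<Rightarrow> 'a bop" where
  "scaleR_bop r T = complex_of_real r *\<^sub>C T"

instance
proof
  fix S T U :: "'a bop" and a b :: complex and r :: real
  show "r *\<^sub>R T = complex_of_real r *\<^sub>C T" by (simp add: scaleR_bop_def)
  show "a *\<^sub>C (S + T) = a *\<^sub>C S + a *\<^sub>C T" by transfer (simp add: scaleC_add_right)
  show "(a + b) *\<^sub>C T = a *\<^sub>C T + b *\<^sub>C T" by transfer (simp add: scaleC_add_left)
  show "a *\<^sub>C b *\<^sub>C T = (a * b) *\<^sub>C T" by transfer (simp add: scaleC_scaleC)
  show "1 *\<^sub>C T = T" by transfer (simp add: scaleC_one)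
  show "S + T + U = S + (T + U)" by transfer (simp add: add.assoc)
  show "S + T = T + S" by transfer (simp add: add.commute)
  show "0 + T = T" by transfer simp
  show "- T + T = 0" by transfer simp
  show "S - T = S + - T" by transfer simp
  show "S * T * U = S * (T * U)" by transfer simp
  show "(S + T) * U = S * U + T * U" by transfer simp
  show "S * (T + U) = S * T + S * U"
    by transfer (auto simp: linear_add[OF bounded_linear.linear])
  show "1 * T = T" by transfer simp
  show "T * 1 = T" by transfer simp
qed

end

definition is_adjoint :: "'h::chilbert_space bop \<Rightarrow> 'h bop \<Rightarrow> bool" where
  "is_adjoint S T \<longleftrightarrow> (\<forall>x y. cinner (bop_apply S x) y = cinner x (bop_apply T y))"

definition selfadjoint :: "'h::chilbert_space bop \<Rightarrow> bool" where
  "selfadjoint T \<longleftrightarrow> is_adjoint T T"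

section \<open>Tracial noncommutative probability spaces\<close>

text \<open>
  The weak operator topology is the coarsest topology making all maps
  \<open>T \<mapsto> \<langle>x, T y\<rangle>\<close> continuous; the ultraweak (or sigma-weak) topology is the coarsest one
  making all maps \<open>T \<mapsto> \<Sum>n. \<langle>\<xi> n, T (\<eta> n)\<rangle>\<close> with square-summable \<open>\<xi>\<close> and \<open>\<eta>\<close> continuous.
\<close>

definition weak_operator_topology :: "'h::chilbert_space bop topology" where
  "weak_operator_topology =
     topology_generated_by {{T. cinner x (bop_apply T y) \<in> U} | x y U. open U}"

definition ultraweak_topology :: "'h::chilbert_space bop topology" where
  "ultraweak_topology =
     topology_generated_by {{T. (\<Sum>n. cinner (\<xi> n) (bop_apply T (\<eta> n))) \<in> U} | \<xi> \<eta> U.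
       summable (\<lambda>n::nat. (norm (\<xi> n))\<^sup>2) \<and> summable (\<lambda>n::nat. (norm (\<eta> n))\<^sup>2) \<and> open U}"

definition von_neumann_algebra :: "'h::chilbert_space bop set \<Rightarrow> bool" where
  "von_neumann_algebra M \<longleftrightarrow>
     1 \<in> M \<and>
     (\<forall>S\<in>M. \<forall>T\<in>M. S + T \<in> M \<and> S * T \<in> M) \<and>
     (\<forall>a. \<forall>T\<in>M. a *\<^sub>C T \<in> M) \<and>
     (\<forall>T\<in>M. \<exists>S\<in>M. is_adjoint S T) \<and>
     closedin weak_operator_topology M"

text \<open>
  A functional on \<open>M\<close> is represented by a function on all operators; its values outside \<open>M\<close>
  are never used. Normality is continuity for the ultraweak topology.
\<close>

definition state_on :: "'h::chilbert_space bop set \<Rightarrow> ('h bop \<Rightarrow> complex) \<Rightarrow> bool" where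
  "state_on M \<tau> \<longleftrightarrow>
     (\<forall>S\<in>M. \<forall>T\<in>M. \<tau> (S + T) = \<tau> S + \<tau> T) \<and>
     (\<forall>a. \<forall>T\<in>M. \<tau> (a *\<^sub>C T) = a * \<tau> T) \<and>
     (\<forall>S\<in>M. \<forall>T\<in>M. is_adjoint S T \<longrightarrow> \<tau> (S * T) \<in> \<real>\<^sub>\<ge>\<^sub>0) \<and>
     \<tau> 1 = 1"

definition normal_on :: "'h::chilbert_space bop set \<Rightarrow> ('h bop \<Rightarrow> complex) \<Rightarrow> bool" where
  "normal_on M \<tau> \<longleftrightarrow> continuous_map (subtopology ultraweak_topology M) euclidean \<tau>"

definition faithful_on :: "'h::chilbert_space bop set \<Rightarrow> ('h bop \<Rightarrow> complex) \<Rightarrow> bool" where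
  "faithful_on M \<tau> \<longleftrightarrow> (\<forall>S\<in>M. \<forall>T\<in>M. is_adjoint S T \<and> \<tau> (S * T) = 0 \<longrightarrow> T = 0)"

definition tracial_on :: "'h::chilbert_space bop set \<Rightarrow> ('h bop \<Rightarrow> complex) \<Rightarrow> bool" where
  "tracial_on M \<tau> \<longleftrightarrow> (\<forall>S\<in>M. \<forall>T\<in>M. \<tau> (S * T) = \<tau> (T * S))"

definition tracial_ncps :: "'h::chilbert_space bop set \<Rightarrow> ('h bop \<Rightarrow> complex) \<Rightarrow> bool" where
  "tracial_ncps M \<tau> \<longleftrightarrow>
     von_neumann_algebra M \<and> state_on M \<tau> \<and> normal_on M \<tau> \<and> faithful_on M \<tau> \<and> tracial_on M \<tau>"

lemma topspace_weak_operator_topology [simp]: "topspace weak_operator_topology = UNIV"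
  unfolding weak_operator_topology_def topology_generated_by_topspace
  by (rule set_eqI) (use open_UNIV in blast)

lemma topspace_ultraweak_topology [simp]: "topspace ultraweak_topology = UNIV"
  unfolding ultraweak_topology_def topology_generated_by_topspace
proof (intro equalityI subset_UNIV Union_upper CollectI)
  show "\<exists>\<xi> \<eta> U. UNIV = {T. (\<Sum>n. cinner (\<xi> n) (bop_apply T (\<eta> n))) \<in> U} \<and>
      summable (\<lambda>n::nat. (norm (\<xi> n))\<^sup>2) \<and> summable (\<lambda>n::nat. (norm (\<eta> n))\<^sup>2) \<and> open U"
    by (rule exI[of _ "\<lambda>_. 0"], rule exI[of _ "\<lambda>_. 0"], rule exI[of _ UNIV]) simp
qed

section \<open>Distributions, freeness, free cumulants\<close>

definition variance :: "('h::chilbert_space bop \<Rightarrow> complex) \<Rightarrow> 'h bop \<Rightarrow> complex" where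
  "variance \<tau> X = \<tau> (X ^ 2) - (\<tau> X)\<^sup>2"

definition identically_distributed ::
  "('h::chilbert_space bop \<Rightarrow> complex) \<Rightarrow> 'h bop \<Rightarrow> 'h bop \<Rightarrow> bool" where
  "identically_distributed \<tau> X Y \<longleftrightarrow> (\<forall>m. \<tau> (X ^ m) = \<tau> (Y ^ m))"

text \<open>The limit may live in a different probability space \<open>(_, \<phi>)\<close>.\<close>

definition converges_in_distribution ::
  "('h::chilbert_space bop \<Rightarrow> complex) \<Rightarrow> (nat \<Rightarrow> 'h bop) \<Rightarrow>
   ('k::chilbert_space bop \<Rightarrow> complex) \<Rightarrow> 'k bop \<Rightarrow> bool" where
  "converges_in_distribution \<tau> Q \<phi> Y \<longleftrightarrow> (\<forall>m. (\<lambda>n. \<tau> (Q n ^ m)) \<longlonglongrightarrow> \<phi> (Y ^ m))"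

definition polynomial_algebra :: "'h::chilbert_space bop \<Rightarrow> 'h bop set" where
  "polynomial_algebra X = {\<Sum>k\<le>d. c k *\<^sub>C X ^ k | (c :: nat \<Rightarrow> complex) d. True}"

text \<open>Alternating products of centered elements of the algebras are centered.\<close>

definition free_family ::
  "('h::chilbert_space bop \<Rightarrow> complex) \<Rightarrow> 'i set \<Rightarrow> ('i \<Rightarrow> 'h bop set) \<Rightarrow> bool" where
  "free_family \<tau> I A \<longleftrightarrow>
     (\<forall>ps. ps \<noteq> [] \<and> (\<forall>(i, a) \<in> set ps. i \<in> I \<and> a \<in> A i \<and> \<tau> a = 0) \<and> distinct_adj (map fst ps)
        \<longrightarrow> \<tau> (prod_list (map snd ps)) = 0)"

text \<open>
  Freeness of self-adjoint elements: the unital *-algebra generated by a self-adjoint element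
  consists of the polynomials in it.
\<close>

definition free_variables ::
  "('h::chilbert_space bop \<Rightarrow> complex) \<Rightarrow> 'i set \<Rightarrow> ('i \<Rightarrow> 'h bop) \<Rightarrow> bool" where
  "free_variables \<tau> I X \<longleftrightarrow> free_family \<tau> I (\<lambda>i. polynomial_algebra (X i))"

text \<open>Partitions of \<open>{0, \<dots>, n - 1}\<close>, matching the positions in a list of length \<open>n\<close>.\<close>

definition noncrossing_partitions :: "nat \<Rightarrow> nat set set set" where
  "noncrossing_partitions n =
     {\<pi>. partition_on {..<n} \<pi> \<and>
         \<not> (\<exists>B\<in>\<pi>. \<exists>C\<in>\<pi>. B \<noteq> C \<and>
              (\<exists>i j k l. i < j \<and> j < k \<and> k < l \<and> i \<in> B \<and> k \<in> B \<and> j \<in> C \<and> l \<in> C))}"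

lemma finite_noncrossing_partitions: "finite (noncrossing_partitions n)"
  by (rule finite_subset[of _ "Pow (Pow {..<n})"])
     (auto simp: noncrossing_partitions_def partition_on_def)

lemma length_nths_noncrossing:
  assumes "\<pi> \<in> noncrossing_partitions (length xs)" "\<pi> \<noteq> {{..<length xs}}" "B \<in> \<pi>"
  shows "length (nths xs B) < length xs"
proof -
  have p: "partition_on {..<length xs} \<pi>"
    using assms(1) by (simp add: noncrossing_partitions_def)
  have B: "B \<subseteq> {..<length xs}"
    using p assms(3) by (auto simp: partition_on_def)
  moreover have "B \<noteq> {..<length xs}"
  proof
    assume eq: "B = {..<length xs}"
    have "C = B" if "C \<in> \<pi>" for C
    proof (rule ccontr)
      assume "C \<noteq> B"
      then have "C \<inter> B = {}"
        using p that assms(3) by (auto simp: partition_on_def disjoint_def)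
      moreover have "C \<subseteq> B" "C \<noteq> {}"
        using p that eq by (auto simp: partition_on_def)
      ultimately show False by blast
    qed
    then have "\<pi> = {B}" using assms(3) by blast
    then show False using assms(2) eq by simp
  qed
  ultimately have "card B < length xs"
    by (metis psubset_card_mono finite_lessThan card_lessThan psubsetI)
  moreover have "{i. i < length xs \<and> i \<in> B} = B"
    using B by auto
  ultimately show ?thesis
    by (simp add: length_nths)
qed

text \<open>
  \<open>free_cumulant \<tau> [X\<^sub>1, \<dots>, X\<^sub>n]\<close> is \<open>K\<^sub>n(X\<^sub>1, \<dots>, X\<^sub>n)\<close>: the moment-cumulant formula (lemma
  \<open>moment_cumulant\<close> below) solved for the term of the one-block partition.
\<close>

function free_cumulant :: "('a::monoid_mult \<Rightarrow> complex) \<Rightarrow> 'a list \<Rightarrow> complex" where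
  "free_cumulant \<tau> xs =
     \<tau> (prod_list xs) -
     (\<Sum>\<pi> \<in> noncrossing_partitions (length xs) - {{{..<length xs}}}.
        \<Prod>B\<in>\<pi>. free_cumulant \<tau> (nths xs B))"
  by auto
termination
  by (relation "Wellfounded.measure (\<lambda>(\<tau>, xs). length xs)") (simp, simp, blast intro: length_nths_noncrossing)

declare free_cumulant.simps [simp del]

lemma moment_cumulant:
  assumes "xs \<noteq> []"
  shows "\<tau> (prod_list xs) =
    (\<Sum>\<pi> \<in> noncrossing_partitions (length xs). \<Prod>B\<in>\<pi>. free_cumulant \<tau> (nths xs B))"
proof -
  have "{{..<length xs}} \<in> noncrossing_partitions (length xs)"
    using assms by (auto simp: noncrossing_partitions_def partition_on_def)
  moreover have "nths xs {..<length xs} = xs"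
    by (simp add: nths_all)
  ultimately show ?thesis
    by (subst sum.remove[OF finite_noncrossing_partitions])
       (auto simp: free_cumulant.simps[of \<tau> xs])
qed

text \<open>
  The coefficient of \<open>z\<^sup>n\<close> is \<open>K\<^sub>n\<^sub>+\<^sub>1(X)\<close>; as a function near 0 the R-transform is the sum of this
  series (\<open>has_fps_expansion\<close>).
\<close>

definition R_transform :: "('h::chilbert_space bop \<Rightarrow> complex) \<Rightarrow> 'h bop \<Rightarrow> complex fps" where
  "R_transform \<tau> X = Abs_fps (\<lambda>n. free_cumulant \<tau> (replicate (n + 1) X))"

section \<open>The Hilbert space of square-summable sequences\<close>

text \<open>
  HOL cannot quantify existentially over types, so an assertion that some probability space
  exists has to name the Hilbert space it acts on; every infinite-dimensional separable Hilbert
  space is isomorphic to this one.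
\<close>

typedef ell2 = "{f :: nat \<Rightarrow> complex. summable (\<lambda>n. (cmod (f n))\<^sup>2)}"
  morphisms ell2_nth Ell2
  by (rule exI[of _ "\<lambda>_. 0"]) simp

setup_lifting type_definition_ell2

lemma ell2_summable_norm_mult:
  assumes "summable (\<lambda>n. (cmod (f n))\<^sup>2)" "summable (\<lambda>n. (cmod (g n))\<^sup>2)"
  shows "summable (\<lambda>n. cmod (cnj (f n) * g n))"
proof (rule summable_comparison_test')
  show "summable (\<lambda>n. (cmod (f n))\<^sup>2 + (cmod (g n))\<^sup>2)"
    by (intro summable_add assms)
  fix n
  have "cmod (f n) * cmod (g n) \<le> (cmod (f n))\<^sup>2 + (cmod (g n))\<^sup>2"
  proof -
    have "0 \<le> (cmod (f n) - cmod (g n))\<^sup>2" "0 \<le> (cmod (f n))\<^sup>2" "0 \<le> (cmod (g n))\<^sup>2"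
      by simp_all
    then show ?thesis
      unfolding power2_diff by linarith
  qed
  then show "norm (cmod (cnj (f n) * g n)) \<le> (cmod (f n))\<^sup>2 + (cmod (g n))\<^sup>2"
    by (simp add: norm_mult)
qed

lemma ell2_summable_mult:
  assumes "summable (\<lambda>n. (cmod (f n))\<^sup>2)" "summable (\<lambda>n. (cmod (g n))\<^sup>2)"
  shows "summable (\<lambda>n. cnj (f n) * g n)"
  using ell2_summable_norm_mult[OF assms] by (rule summable_norm_cancel)

lemma ell2_summable_add:
  assumes "summable (\<lambda>n. (cmod (f n))\<^sup>2)" "summable (\<lambda>n. (cmod (g n))\<^sup>2)"
  shows "summable (\<lambda>n. (cmod (f n + g n))\<^sup>2)"
proof (rule summable_comparison_test')
  show "summable (\<lambda>n. 2 * (cmod (f n))\<^sup>2 + 2 * (cmod (g n))\<^sup>2)"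
    by (intro summable_add summable_mult assms)
  fix n
  have "(cmod (f n + g n))\<^sup>2 \<le> (cmod (f n) + cmod (g n))\<^sup>2"
    by (intro power_mono norm_triangle_ineq) simp
  moreover have "0 \<le> (cmod (f n) - cmod (g n))\<^sup>2"
    by simp
  ultimately show "norm ((cmod (f n + g n))\<^sup>2) \<le> 2 * (cmod (f n))\<^sup>2 + 2 * (cmod (g n))\<^sup>2"
    unfolding power2_diff power2_sum by simp
qed

lemma ell2_summable_scale:
  assumes "summable (\<lambda>n. (cmod (f n))\<^sup>2)"
  shows "summable (\<lambda>n. (cmod (a * f n))\<^sup>2)"
  by (simp add: norm_mult power_mult_distrib summable_mult assms)

instantiation ell2 :: complex_vector
begin

lift_definition zero_ell2 :: ell2 is "\<lambda>_. 0"
  by simp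

lift_definition plus_ell2 :: "ell2 \<Rightarrow> ell2 \<Rightarrow> ell2" is "\<lambda>f g n. f n + g n"
  by (rule ell2_summable_add)

lift_definition uminus_ell2 :: "ell2 \<Rightarrow> ell2" is "\<lambda>f n. - f n"
  by simp

lift_definition minus_ell2 :: "ell2 \<Rightarrow> ell2 \<Rightarrow> ell2" is "\<lambda>f g n. f n - g n"
  subgoal for f g
    using ell2_summable_add[of f "\<lambda>n. - g n"] by simp
  done

lift_definition scaleC_ell2 :: "complex \<Rightarrow> ell2 \<Rightarrow> ell2" is "\<lambda>a f n. a * f n"
  by (rule ell2_summable_scale)

definition scaleR_ell2 :: "real \<Rightarrow> ell2 \<Rightarrow> ell2" where
  "scaleR_ell2 r f = complex_of_real r *\<^sub>C f"

instance
  by standard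
    (simp add: scaleR_ell2_def | (transfer, simp add: algebra_simps))+

end

lift_definition ell2_cinner :: "ell2 \<Rightarrow> ell2 \<Rightarrow> complex" is "\<lambda>f g. \<Sum>n. cnj (f n) * g n" .

lemma ell2_cinner_commute: "ell2_cinner f g = cnj (ell2_cinner g f)"
proof transfer
  fix f g :: "nat \<Rightarrow> complex"
  assume "summable (\<lambda>n. (cmod (f n))\<^sup>2)" "summable (\<lambda>n. (cmod (g n))\<^sup>2)"
  then have "(\<lambda>n. cnj (g n) * f n) sums (\<Sum>n. cnj (g n) * f n)"
    by (intro summable_sums ell2_summable_mult)
  then have "(\<lambda>n. cnj (cnj (g n) * f n)) sums cnj (\<Sum>n. cnj (g n) * f n)"
    by (simp only: sums_cnj)
  then show "(\<Sum>n. cnj (f n) * g n) = cnj (\<Sum>n. cnj (g n) * f n)"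
    by (simp add: sums_iff mult.commute)
qed

lemma ell2_cinner_add_right: "ell2_cinner f (g + h) = ell2_cinner f g + ell2_cinner f h"
  by transfer (simp add: distrib_left suminf_add ell2_summable_mult)

lemma ell2_cinner_scaleC_right: "ell2_cinner f (a *\<^sub>C g) = a * ell2_cinner f g"
proof transfer
  fix f g :: "nat \<Rightarrow> complex" and a :: complex
  assume "summable (\<lambda>n. (cmod (f n))\<^sup>2)" "summable (\<lambda>n. (cmod (g n))\<^sup>2)"
  then show "(\<Sum>n. cnj (f n) * (a * g n)) = a * (\<Sum>n. cnj (f n) * g n)"
    by (subst suminf_mult[OF ell2_summable_mult, symmetric]) (simp_all add: mult_ac)
qed

lemma ell2_cinner_same: "Re (ell2_cinner f f) = (\<Sum>n. (cmod (ell2_nth f n))\<^sup>2)"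
proof transfer
  fix f :: "nat \<Rightarrow> complex"
  assume "summable (\<lambda>n. (cmod (f n))\<^sup>2)"
  then have "Re (\<Sum>n. cnj (f n) * f n) = (\<Sum>n. Re (cnj (f n) * f n))"
    by (intro Re_suminf ell2_summable_mult)
  then show "Re (\<Sum>n. cnj (f n) * f n) = (\<Sum>n. (cmod (f n))\<^sup>2)"
    by (simp only: complex_cnj complex.sel cmod_power2) (simp add: power2_eq_square)
qed

instantiation ell2 :: real_inner
begin

definition inner_ell2 :: "ell2 \<Rightarrow> ell2 \<Rightarrow> real" where
  "inner_ell2 f g = Re (ell2_cinner f g)"

definition norm_ell2 :: "ell2 \<Rightarrow> real" where
  "norm_ell2 f = sqrt (inner f f)"

definition sgn_ell2 :: "ell2 \<Rightarrow> ell2" where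
  "sgn_ell2 f = f /\<^sub>R norm f"

definition dist_ell2 :: "ell2 \<Rightarrow> ell2 \<Rightarrow> real" where
  "dist_ell2 f g = norm (f - g)"

definition uniformity_ell2 :: "(ell2 \<times> ell2) filter" where
  "uniformity_ell2 = (INF e\<in>{0<..}. principal {(f, g). dist f g < e})"

definition open_ell2 :: "ell2 set \<Rightarrow> bool" where
  "open_ell2 U \<longleftrightarrow> (\<forall>f\<in>U. \<forall>\<^sub>F (f', g) in uniformity. f' = f \<longrightarrow> g \<in> U)"

instance
proof
  fix f g h :: ell2 and r s :: real and U :: "ell2 set"
  show "r *\<^sub>R (f + g) = r *\<^sub>R f + r *\<^sub>R g"
    by (simp add: scaleR_scaleC scaleC_add_right)
  show "(r + s) *\<^sub>R f = r *\<^sub>R f + s *\<^sub>R f"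
    by (simp add: scaleR_scaleC scaleC_add_left)
  show "r *\<^sub>R s *\<^sub>R f = (r * s) *\<^sub>R f"
    by (simp add: scaleR_scaleC scaleC_scaleC)
  show "1 *\<^sub>R f = f"
    by (simp add: scaleR_scaleC scaleC_one)
  show "dist f g = norm (f - g)"
    by (rule dist_ell2_def)
  show "sgn f = inverse (norm f) *\<^sub>R f"
    by (rule sgn_ell2_def)
  show "(uniformity :: (ell2 \<times> ell2) filter) = (INF e\<in>{0<..}. principal {(f, g). dist f g < e})"
    by (rule uniformity_ell2_def)
  show "open U \<longleftrightarrow> (\<forall>f\<in>U. \<forall>\<^sub>F (f', g) in uniformity. f' = f \<longrightarrow> g \<in> U)"
    by (rule open_ell2_def)
  show comm: "inner f g = inner g f"
    unfolding inner_ell2_def by (subst ell2_cinner_commute) simp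
  show "inner (f + g) h = inner f h + inner g h"
    unfolding inner_ell2_def
    by (subst (1 2 3) ell2_cinner_commute) (simp add: ell2_cinner_add_right)
  show "inner (r *\<^sub>R f) g = r * inner f g"
    unfolding inner_ell2_def
    by (subst (1 2) ell2_cinner_commute) (simp add: scaleR_scaleC ell2_cinner_scaleC_right)
  have sm: "summable (\<lambda>n. (cmod (ell2_nth f n))\<^sup>2)"
    using ell2_nth[of f] by simp
  show "0 \<le> inner f f"
    unfolding inner_ell2_def ell2_cinner_same by (intro suminf_nonneg sm) simp
  have "inner f f = 0 \<longleftrightarrow> (\<forall>n. (cmod (ell2_nth f n))\<^sup>2 = 0)"
    unfolding inner_ell2_def ell2_cinner_same by (intro suminf_eq_zero_iff sm) simp
  also have "\<dots> \<longleftrightarrow> f = 0"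
    by (simp, transfer) auto
  finally show "inner f f = 0 \<longleftrightarrow> f = 0" .
  show "norm f = sqrt (inner f f)"
    by (rule norm_ell2_def)
qed

end

lemma ell2_norm_sq: "(norm f)\<^sup>2 = (\<Sum>n. (cmod (ell2_nth f n))\<^sup>2)"
  by (simp add: power2_norm_eq_inner inner_ell2_def ell2_cinner_same)

lemma ell2_summable: "summable (\<lambda>n. (cmod (ell2_nth f n))\<^sup>2)"
  using ell2_nth[of f] by simp

lemma ell2_partial_sum_le: "(\<Sum>n<N. (cmod (ell2_nth f n))\<^sup>2) \<le> (norm f)\<^sup>2"
  unfolding ell2_norm_sq by (rule sum_le_suminf[OF ell2_summable]) auto

lemma ell2_nth_le_norm: "cmod (ell2_nth f n) \<le> norm f"
proof -
  have "(cmod (ell2_nth f n))\<^sup>2 \<le> (\<Sum>k<Suc n. (cmod (ell2_nth f k))\<^sup>2)"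
    by (simp add: sum_nonneg)
  then have "(cmod (ell2_nth f n))\<^sup>2 \<le> (norm f)\<^sup>2"
    using ell2_partial_sum_le order_trans by blast
  then show ?thesis
    by (simp add: power2_le_iff_abs_le)
qed

instance ell2 :: complete_space
proof
  fix F :: "nat \<Rightarrow> ell2"
  assume C: "Cauchy F"
  have nth_diff: "ell2_nth (f - g) n = ell2_nth f n - ell2_nth g n" for f g n
    by transfer simp
  have "Cauchy (\<lambda>k. ell2_nth (F k) n)" for n
    unfolding Cauchy_def
  proof (intro allI impI)
    fix e :: real assume "e > 0"
    then obtain M where "\<forall>k\<ge>M. \<forall>l\<ge>M. dist (F k) (F l) < e"
      using C unfolding Cauchy_def by blast
    moreover have "dist (ell2_nth (F k) n) (ell2_nth (F l) n) \<le> dist (F k) (F l)" for k l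
      unfolding dist_norm nth_diff[symmetric] by (rule ell2_nth_le_norm)
    ultimately show "\<exists>M. \<forall>k\<ge>M. \<forall>l\<ge>M. dist (ell2_nth (F k) n) (ell2_nth (F l) n) < e"
      using order_le_less_trans by blast
  qed
  then have "\<exists>x. (\<lambda>k. ell2_nth (F k) n) \<longlonglongrightarrow> x" for n
    by (simp add: Cauchy_convergent convergent_def[symmetric])
  then obtain g where g: "\<And>n. (\<lambda>k. ell2_nth (F k) n) \<longlonglongrightarrow> g n"
    by metis
  have part: "(\<Sum>n<N. (cmod (ell2_nth (F k) n - g n))\<^sup>2) \<le> e\<^sup>2"
    if "\<forall>l\<ge>M. dist (F k) (F l) < e" for k M N e
  proof (rule tendsto_upperbound)
    show "(\<lambda>l. \<Sum>n<N. (cmod (ell2_nth (F k) n - ell2_nth (F l) n))\<^sup>2)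
        \<longlonglongrightarrow> (\<Sum>n<N. (cmod (ell2_nth (F k) n - g n))\<^sup>2)"
      by (intro tendsto_intros g)
    show "\<forall>\<^sub>F l in sequentially. (\<Sum>n<N. (cmod (ell2_nth (F k) n - ell2_nth (F l) n))\<^sup>2) \<le> e\<^sup>2"
      using eventually_ge_at_top[of M]
    proof eventually_elim
      case (elim l)
      have "(\<Sum>n<N. (cmod (ell2_nth (F k - F l) n))\<^sup>2) \<le> (norm (F k - F l))\<^sup>2"
        by (rule ell2_partial_sum_le)
      also have "\<dots> \<le> e\<^sup>2"
        using that elim by (intro power_mono) (auto simp: dist_norm less_imp_le)
      finally show ?case by (simp add: nth_diff)
    qed
  qed simp
  have diff: "summable (\<lambda>n. (cmod (ell2_nth (F k) n - g n))\<^sup>2) \<and>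
      (\<Sum>n. (cmod (ell2_nth (F k) n - g n))\<^sup>2) \<le> e\<^sup>2"
    if "\<forall>l\<ge>M. dist (F k) (F l) < e" for k M e
  proof
    show s: "summable (\<lambda>n. (cmod (ell2_nth (F k) n - g n))\<^sup>2)"
      by (rule bounded_imp_summable[where B = "e\<^sup>2"])
         (use part[OF that, of "Suc _"] in \<open>auto simp: lessThan_Suc_atMost\<close>)
    show "(\<Sum>n. (cmod (ell2_nth (F k) n - g n))\<^sup>2) \<le> e\<^sup>2"
      by (rule suminf_le_const[OF s part[OF that]])
  qed
  obtain M0 where "\<forall>l\<ge>M0. dist (F M0) (F l) < 1"
    using C unfolding Cauchy_def by (metis order_refl zero_less_one)
  then have "summable (\<lambda>n. (cmod (ell2_nth (F M0) n - g n))\<^sup>2)"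
    using diff by blast
  then have "summable (\<lambda>n. (cmod (- (ell2_nth (F M0) n - g n)))\<^sup>2)"
    by (simp only: norm_minus_cancel)
  from ell2_summable_add[OF this ell2_summable[of "F M0"]]
  have gs: "summable (\<lambda>n. (cmod (g n))\<^sup>2)"
    by simp
  then have nth_g: "ell2_nth (Ell2 g) = g"
    by (simp add: Ell2_inverse)
  have "F \<longlonglongrightarrow> Ell2 g"
  proof (rule metric_LIMSEQ_I)
    fix e :: real assume e: "e > 0"
    then obtain M where M: "\<forall>k\<ge>M. \<forall>l\<ge>M. dist (F k) (F l) < e / 2"
      using C unfolding Cauchy_def by (meson half_gt_zero)
    have "dist (F k) (Ell2 g) < e" if "k \<ge> M" for k
    proof -
      have "(norm (F k - Ell2 g))\<^sup>2 \<le> (e / 2)\<^sup>2"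
        unfolding ell2_norm_sq nth_diff nth_g using diff[of M k "e / 2"] M that by blast
      then have "norm (F k - Ell2 g) \<le> e / 2"
        using e by (simp add: power2_le_iff_abs_le)
      then show ?thesis
        using e by (simp add: dist_norm)
    qed
    then show "\<exists>M. \<forall>k\<ge>M. dist (F k) (Ell2 g) < e"
      by blast
  qed
  then show "convergent F"
    by (rule convergentI)
qed

instantiation ell2 :: chilbert_space
begin

definition cinner_ell2 :: "ell2 \<Rightarrow> ell2 \<Rightarrow> complex" where
  "cinner_ell2 = ell2_cinner"

instance
proof
  fix f g h :: ell2 and a :: complex
  show "cinner f g = cnj (cinner g f)"
    unfolding cinner_ell2_def by (rule ell2_cinner_commute)
  show "cinner f (g + h) = cinner f g + cinner f h"
    unfolding cinner_ell2_def by (rule ell2_cinner_add_right)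
  show "cinner f (a *\<^sub>C g) = a * cinner f g"
    unfolding cinner_ell2_def by (rule ell2_cinner_scaleC_right)
  show "inner f g = Re (cinner f g)"
    unfolding cinner_ell2_def by (rule inner_ell2_def)
qed

end

end

theory Submission
  imports Defs
begin

text \<open>
  With \<open>\<alpha> = (1 + \<i>) / 2\<close> and \<open>\<beta> = (1 - \<i>) / 2\<close>, \<open>Q\<^sub>n\<close> is the quadratic form \<open>1/n \<Sum> A k l X\<^sub>k X\<^sub>l\<close>
  of the matrix \<open>A\<close> with entries \<open>\<alpha>\<close> above, \<open>\<beta>\<close> below and \<open>0\<close> on the diagonal. Expanding
  \<open>\<tau> (Q\<^sub>n\<^sup>m)\<close> into words of length \<open>2m\<close>, freeness kills every word with a letter occurring once and
  evaluates a word in which every letter occurs twice as \<open>1\<close> or \<open>0\<close> according to whether this pairing is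
  noncrossing; the other words have fewer than \<open>m\<close> different letters and are too few to matter. Summing
  along the cycles of a noncrossing pairing yields traces of powers of \<open>A\<close>, and the sum obeys the
  moment-cumulant recursion with the cumulants \<open>tr (A\<^sup>k) / n\<^sup>k\<close>. As \<open>A\<close> is Toeplitz up to a twist, its
  resolvent is explicit, and the generating function of these cumulants converges to
  \<open>\<alpha>\<beta> (e\<^bsup>\<alpha>z\<^esup> - e\<^bsup>\<beta>z\<^esup>) / (\<alpha> e\<^bsup>\<beta>z\<^esup> - \<beta> e\<^bsup>\<alpha>z\<^esup>) = (tan z + sec z - 1) / 2\<close>.

  The limit moments are exponentially bounded and strictly positive definite, so the orthogonal
  polynomials give a bounded Jacobi operator \<open>Y\<close> with these moments in the vector state of the first
  basis vector. On the commutant of \<open>Y\<close> this state is faithful and tracial.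
\<close>

section \<open>Words and noncrossing pairings\<close>

text \<open>Pairings and noncrossing partitions are never put in bijection. Both sums are scanned
  from the left, at the partner of the first letter or at the next element of the first block, and
  both obey the recursion of \<open>nc_moment\<close>, which thereby links traces with free
  cumulants. The main obstacle is that the conclusion asks for an actual \<open>Y\<close> in a von
  Neumann algebra with a normal faithful trace, whereas the combinatorics yields only numbers. For a
  commutant, weak closedness is immediate; the state is faithful and tracial on all of it because
  \<open>ket 0\<close> is cyclic, that is, because no off-diagonal Jacobi coefficient vanishes. This
  is why the limit moments must be strictly positive definite. Boundedness comes from the bound 2 *
  4^k on the moments, which rests on cumulants of modulus at most 1. Negligible words still need a
  bound independent of n; one of length 2m is bounded by the 2m-th moment of a single variable.
  Finally, tan and sec arise because \<open>\<alpha>\<close> z = z/2 + i z/2: the common factor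
  exp(z/2) cancels and a half-angle quotient remains.\<close>

definition words :: "nat \<Rightarrow> nat \<Rightarrow> nat list set" where
  "words n k = {w. set w \<subseteq> {1..n} \<and> length w = k}"

lemma finite_words [simp]: "finite (words n k)"
  unfolding words_def by (rule finite_lists_length_eq) simp

lemma card_words: "card (words n k) = n ^ k"
  unfolding words_def by (subst card_lists_length_eq) simp_all

lemma words_0 [simp]: "words n 0 = {[]}"
  by (auto simp: words_def)

lemma words_Suc: "words n (Suc k) = (\<lambda>(a, w). a # w) ` ({1..n} \<times> words n k)"
  by (auto simp: words_def length_Suc_conv image_iff Bex_def)

lemma sum_words_Suc:
  "(\<Sum>w\<in>words n (Suc k). f w) = (\<Sum>a\<in>{1..n}. \<Sum>w\<in>words n k. f (a # w))"
  unfolding words_Suc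
  by (subst sum.reindex) (auto simp: inj_on_def sum.cartesian_product case_prod_unfold)

text \<open>Such a word is read off from an alphabet of \<open>d\<close> letters by a list of
  \<open>k\<close> positions. The exponent of \<open>n\<close> is what matters: with
  \<open>k = 2 * m\<close> and \<open>d = m - 1\<close> these words are negligible against
  \<open>n ^ m\<close>.\<close>

lemma card_words_few_letters:
  assumes "n \<ge> 1"
  shows "card {w \<in> words n k. card (set w) \<le> d} \<le> d ^ k * n ^ d"
proof -
  let ?F = "{f. set f \<subseteq> {..<d} \<and> length f = k}"
  have F: "finite ?F" "card ?F = d ^ k"
    using finite_lists_length_eq[of "{..<d}" k] card_lists_length_eq[of "{..<d}" k] by auto
  have "{w \<in> words n k. card (set w) \<le> d} \<subseteq> (\<lambda>(f, s). map ((!) s) f) ` (?F \<times> words n d)"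
  proof
    fix w assume w: "w \<in> {w \<in> words n k. card (set w) \<le> d}"
    \<comment> \<open>Padding makes the alphabet exactly \<open>d\<close> long; the letter 1 is
      available because \<open>n \<ge> 1\<close>.\<close>
    define s where "s = sorted_list_of_set (set w) @ replicate (d - card (set w)) 1"
    have s: "s \<in> words n d" "set w \<subseteq> set s"
      using w assms by (auto simp: s_def words_def)
    then have "\<forall>x\<in>set w. \<exists>i. i < d \<and> s ! i = x"
      by (auto simp: words_def in_set_conv_nth subset_iff)
    then obtain h where h: "\<And>x. x \<in> set w \<Longrightarrow> h x < d \<and> s ! h x = x" by metis
    have "w = map ((!) s) (map h w)" using h by (simp add: map_idI)
    moreover have "map h w \<in> ?F" using h w by (auto simp: words_def)
    ultimately show "w \<in> (\<lambda>(f, s). map ((!) s) f) ` (?F \<times> words n d)"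
      using s by (intro image_eqI[where x = "(map h w, s)"]) auto
  qed
  then have "card {w \<in> words n k. card (set w) \<le> d} \<le> card (?F \<times> words n d)"
    using F by (meson card_image_le card_mono finite_SigmaI finite_imageI finite_words le_trans)
  then show ?thesis by (simp add: card_cartesian_product F card_words)
qed

text \<open>Each entry is one occurrence of \<open>a\<close>, that is, one candidate partner for a
  letter \<open>a\<close> standing in front of the list.\<close>

fun splits :: "'a \<Rightarrow> 'a list \<Rightarrow> ('a list \<times> 'a list) list" where
  "splits a [] = []"
| "splits a (b # w) = (if a = b then [([], w)] else []) @ map (\<lambda>(x, y). (b # x, y)) (splits a w)"

lemma splits_eq: "(x, y) \<in> set (splits a w) \<Longrightarrow> w = x @ a # y"
  by (induction w arbitrary: x) (auto split: if_splits)

lemma splits_append: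
  "splits a (p @ q) = map (\<lambda>(x, y). (x, y @ q)) (splits a p) @ map (\<lambda>(x, y). (p @ x, y)) (splits a q)"
  by (induction p) (auto simp: case_prod_unfold)

lemma splits_Nil: "a \<notin> set w \<Longrightarrow> splits a w = []"
  by (induction w) auto

lemma length_splits: "length (splits a w) \<le> length w"
  by (induction w) auto

text \<open>A word with a marked occurrence of \<open>a\<close> is the same as a position
  \<open>p\<close> together with an arbitrary word on either side of it.\<close>

lemma sum_words_splits:
  fixes F :: "nat list \<Rightarrow> nat list \<Rightarrow> complex"
  assumes "a \<in> {1..n}"
  shows "(\<Sum>w\<in>words n k. \<Sum>(x, y)\<leftarrow>splits a w. F x y) =
    (\<Sum>p<k. \<Sum>x\<in>words n p. \<Sum>y\<in>words n (k - 1 - p). F x y)"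
proof (induction k arbitrary: F)
  case (Suc k)
  have "(\<Sum>w\<in>words n (Suc k). \<Sum>(x, y)\<leftarrow>splits a w. F x y) =
      (\<Sum>b\<in>{1..n}. \<Sum>w\<in>words n k. (if a = b then F [] w else 0) + (\<Sum>(x, y)\<leftarrow>splits a w. F (b # x) y))"
    unfolding sum_words_Suc by (intro sum.cong) (auto simp: o_def case_prod_unfold)
  also have "\<dots> = (\<Sum>w\<in>words n k. \<Sum>b\<in>{1..n}. if a = b then F [] w else 0) +
      (\<Sum>b\<in>{1..n}. \<Sum>w\<in>words n k. \<Sum>(x, y)\<leftarrow>splits a w. F (b # x) y)"
    by (simp add: sum.distrib sum.swap[of _ "words n k"])
  also have "\<dots> = (\<Sum>w\<in>words n k. F [] w) +
      (\<Sum>b\<in>{1..n}. \<Sum>p<k. \<Sum>x\<in>words n p. \<Sum>y\<in>words n (k - 1 - p). F (b # x) y)"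
    using assms by (simp only: Suc.IH) (simp add: sum.delta)
  also have "\<dots> = (\<Sum>w\<in>words n k. F [] w) +
      (\<Sum>p<k. \<Sum>x\<in>words n (Suc p). \<Sum>y\<in>words n (k - 1 - p). F x y)"
    by (subst sum.swap) (simp add: sum_words_Suc)
  also have "\<dots> = (\<Sum>p<Suc k. \<Sum>x\<in>words n p. \<Sum>y\<in>words n (Suc k - 1 - p). F x y)"
    by (subst sum.lessThan_Suc_shift) simp
  finally show ?case .
qed simp

text \<open>The number of noncrossing pairings of the positions that pair equal letters only.\<close>

function nc_pairings :: "'a list \<Rightarrow> nat" where
  "nc_pairings [] = 1"
| "nc_pairings (a # w) = (\<Sum>(x, y)\<leftarrow>splits a w. nc_pairings x * nc_pairings y)"
  by pat_completeness auto
termination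
  by (relation "Wellfounded.measure length") (auto dest: splits_eq)

text \<open>Distributes a weight over the possible partners of the first letter, so that it can be
  factored differently for each of them.\<close>

lemma mult_nc_pairings_Cons:
  fixes c :: complex
  assumes "\<And>x y. w = x @ a # y \<Longrightarrow> c = F x y"
  shows "c * of_nat (nc_pairings (a # w)) =
    (\<Sum>(x, y)\<leftarrow>splits a w. F x y * (of_nat (nc_pairings x) * of_nat (nc_pairings y)))"
proof -
  have "c * of_nat (nc_pairings (a # w)) =
      (\<Sum>p\<leftarrow>splits a w. c * (of_nat (nc_pairings (fst p)) * of_nat (nc_pairings (snd p))))"
    by (simp add: sum_list_of_nat[symmetric] o_def case_prod_unfold sum_list_const_mult)
  also have "\<dots> = (\<Sum>(x, y)\<leftarrow>splits a w. F x y * (of_nat (nc_pairings x) * of_nat (nc_pairings y)))"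
    using assms by (intro arg_cong[of _ _ sum_list] map_cong) (auto dest: splits_eq)
  finally show ?thesis .
qed

text \<open>A crude bound suffices: the error estimate uses only that it does not depend on the
  alphabet.\<close>

lemma nc_pairings_le_fact: "nc_pairings w \<le> fact (length w)"
proof (induction w rule: length_induct)
  case (1 w)
  show ?case
  proof (cases w)
    case (Cons a v)
    have "nc_pairings x * nc_pairings y \<le> fact (length v - 1)" if "(x, y) \<in> set (splits a v)" for x y
    proof -
      have v: "v = x @ a # y" using that by (rule splits_eq)
      have "nc_pairings x * nc_pairings y \<le> fact (length x) * fact (length y)"
        using 1 Cons v by (intro mult_le_mono) auto
      also have "\<dots> \<le> fact (length x + length y)"
        by (intro dvd_imp_le fact_fact_dvd_fact) simp
      finally show ?thesis using v by simp
    qed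
    then have "nc_pairings w \<le> (\<Sum>_\<leftarrow>splits a v. fact (length v - 1))"
      unfolding Cons nc_pairings.simps by (intro sum_list_mono) auto
    also have "\<dots> \<le> length v * fact (length v - 1)"
      using length_splits[of a v] by (simp add: sum_list_triv)
    also have "\<dots> \<le> fact (length w)"
      unfolding Cons by (cases v) auto
    finally show ?thesis .
  qed simp
qed

lemma nc_pairings_odd: "odd (length w) \<Longrightarrow> nc_pairings w = 0"
proof (induction w rule: length_induct)
  case (1 w)
  then obtain a v where w: "w = a # v" by (cases w) auto
  have "nc_pairings x * nc_pairings y = 0" if "(x, y) \<in> set (splits a v)" for x y
  proof -
    have v: "v = x @ a # y" using that by (rule splits_eq)
    then have "odd (length x) \<or> odd (length y)" using 1(2) w by auto
    then show ?thesis using 1(1) w v by auto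
  qed
  then show ?case unfolding w by (auto intro!: sum_list_0)
qed

lemma nc_pairings_singleton: "count_list w a = 1 \<Longrightarrow> nc_pairings w = 0"
proof (induction w rule: length_induct)
  case (1 w)
  then obtain b v where w: "w = b # v" by (cases w) auto
  have "nc_pairings x * nc_pairings y = 0" if "(x, y) \<in> set (splits b v)" for x y
  proof -
    have v: "v = x @ b # y" using that by (rule splits_eq)
    then have "count_list x a = 1 \<or> count_list y a = 1"
      using 1(2) w by (auto split: if_splits simp: add_is_1)
    then show ?thesis using 1(1) w v by auto
  qed
  then show ?case unfolding w by (auto intro!: sum_list_0)
qed

text \<open>The two neighbours can only be paired with each other, and an arc joining neighbours
  crosses nothing. As the recursion opens the word at its first letter, the pair lies either beyond
  the partner of that letter or under its arc; both cases lead to shorter words.\<close>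

lemma nc_pairings_adjacent:
  assumes "k \<notin> set u" "k \<notin> set v"
  shows "nc_pairings (u @ k # k # v) = nc_pairings (u @ v)"
  using assms
proof (induction "length u + length v" arbitrary: u v rule: less_induct)
  case less
  show ?case
  proof (cases u)
    case Nil
    then show ?thesis using less.prems by (simp add: splits_Nil)
  next
    case (Cons b u')
    have 1: "nc_pairings (y @ k # k # v) = nc_pairings (y @ v)" if "(x, y) \<in> set (splits b u')" for x y
      using splits_eq[OF that] less.prems Cons by (intro less.hyps) auto
    have 2: "nc_pairings (u' @ k # k # x) = nc_pairings (u' @ x)" if "(x, y) \<in> set (splits b v)" for x y
      using splits_eq[OF that] less.prems Cons by (intro less.hyps) auto
    have b: "b \<noteq> k" using less.prems Cons by auto
    have "nc_pairings (u @ k # k # v) =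
        (\<Sum>(x, y)\<leftarrow>splits b u'. nc_pairings x * nc_pairings (y @ k # k # v)) +
        (\<Sum>(x, y)\<leftarrow>splits b v. nc_pairings (u' @ k # k # x) * nc_pairings y)"
      using b by (simp add: Cons splits_append o_def case_prod_unfold)
    also have "(\<Sum>(x, y)\<leftarrow>splits b u'. nc_pairings x * nc_pairings (y @ k # k # v)) =
        (\<Sum>(x, y)\<leftarrow>splits b u'. nc_pairings x * nc_pairings (y @ v))"
      using 1 by (intro arg_cong[of _ _ sum_list] map_cong) auto
    also have "(\<Sum>(x, y)\<leftarrow>splits b v. nc_pairings (u' @ k # k # x) * nc_pairings y) =
        (\<Sum>(x, y)\<leftarrow>splits b v. nc_pairings (u' @ x) * nc_pairings y)"
      using 2 by (intro arg_cong[of _ _ sum_list] map_cong) auto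
    also have "(\<Sum>(x, y)\<leftarrow>splits b u'. nc_pairings x * nc_pairings (y @ v)) +
        (\<Sum>(x, y)\<leftarrow>splits b v. nc_pairings (u' @ x) * nc_pairings y) = nc_pairings (u @ v)"
      by (simp add: Cons splits_append o_def case_prod_unfold)
    finally show ?thesis .
  qed
qed

text \<open>A noncrossing pairing has an innermost arc, which joins neighbours. In recursive form:
  the stretch under the first arc is nonempty and again without equal neighbours.\<close>

lemma nc_pairings_distinct_adj: "distinct_adj w \<Longrightarrow> w \<noteq> [] \<Longrightarrow> nc_pairings w = 0"
proof (induction w rule: length_induct)
  case (1 w)
  then obtain b v where w: "w = b # v" by (cases w) auto
  have "nc_pairings x = 0" if "(x, y) \<in> set (splits b v)" for x y
  proof -
    have v: "v = x @ b # y" using that by (rule splits_eq)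
    then have "distinct_adj x" "x \<noteq> []"
      using 1(2) w by (auto simp: distinct_adj_append_iff distinct_adj_Cons)
    then show ?thesis using 1(1) w v by auto
  qed
  then show ?case unfolding w by (auto intro!: sum_list_0)
qed

section \<open>Weights of words and traces along the cycles of a pairing\<close>

fun pair_weight :: "('a \<Rightarrow> 'a \<Rightarrow> complex) \<Rightarrow> 'a list \<Rightarrow> complex" where
  "pair_weight A (a # b # w) = A a b * pair_weight A w"
| "pair_weight A _ = 1"

text \<open>The word starts and stops in the middle of a factor: \<open>a\<close> is a row index
  still waiting for its column, and \<open>b\<close> closes the last factor. Only the first factor
  carries \<open>B\<close>, which later absorbs a product of copies of \<open>A\<close>.\<close>

fun chain_weight :: "('a \<Rightarrow> 'a \<Rightarrow> complex) \<Rightarrow> ('a \<Rightarrow> 'a \<Rightarrow> complex) \<Rightarrow> 'a \<Rightarrow> 'a list \<Rightarrow> 'a \<Rightarrow> complex" where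
  "chain_weight A B a (c # d # u) b = B a c * chain_weight A A d u b"
| "chain_weight A B a _ b = B a b"

lemma wt_chain: "even (length u) \<Longrightarrow> pair_weight A (a # u @ b # v) = chain_weight A A a u b * pair_weight A v"
  by (induction A u arbitrary: a rule: pair_weight.induct) auto

lemma chain_append:
  "even (length x) \<Longrightarrow> chain_weight A B a (c # x @ d # y) b = B a c * pair_weight A x * chain_weight A A d y b"
proof (induction A x arbitrary: B a c rule: pair_weight.induct)
  case (1 A e f w)
  then show ?case by (cases w) auto
qed auto

definition mat_mul :: "nat \<Rightarrow> (nat \<Rightarrow> nat \<Rightarrow> complex) \<Rightarrow> (nat \<Rightarrow> nat \<Rightarrow> complex) \<Rightarrow> nat \<Rightarrow> nat \<Rightarrow> complex" where
  "mat_mul n B C a b = (\<Sum>c\<in>{1..n}. B a c * C c b)"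

text \<open>Pairing two letters identifies a column index with a row index; summing over the common
  value multiplies the matrices.\<close>

lemma chain_mm: "(\<Sum>c\<in>{1..n}. B a c * chain_weight A A c y b) = chain_weight A (mat_mul n B A) a y b"
proof (cases "(A, A, a, y, b)" rule: chain_weight.cases)
  case (1 A' B' a' c d u b')
  then show ?thesis by (simp add: mat_mul_def sum_distrib_right mult.assoc)
qed (auto simp: mat_mul_def)

text \<open>Matrices are functions on all naturals, and \<open>n\<close> enters only as summation
  range. Hence \<open>mpow n A 1\<close> agrees with \<open>A\<close> in the rows
  \<open>1..n\<close> only, which is where \<open>arc_sum_cong\<close> compares matrices.\<close>

fun mpow :: "nat \<Rightarrow> (nat \<Rightarrow> nat \<Rightarrow> complex) \<Rightarrow> nat \<Rightarrow> nat \<Rightarrow> nat \<Rightarrow> complex" where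
  "mpow n A 0 a b = of_bool (a = b)"
| "mpow n A (Suc k) a b = mat_mul n (mpow n A k) A a b"

definition mtrace :: "nat \<Rightarrow> (nat \<Rightarrow> nat \<Rightarrow> complex) \<Rightarrow> complex" where
  "mtrace n B = (\<Sum>a\<in>{1..n}. B a a)"

lemma mpow_1: "a \<in> {1..n} \<Longrightarrow> mpow n A 1 a b = A a b"
  unfolding One_nat_def mpow.simps mat_mul_def by (simp add: of_bool_def if_distrib[of "\<lambda>x. x * _"] cong: if_cong)

text \<open>
  In \<open>arc_sum\<close>, the word runs inside a cycle of matrices that is still to be closed, and
  \<open>B\<close> is the product of the matrices of this cycle collected so far.
\<close>

definition open_sum :: "nat \<Rightarrow> (nat \<Rightarrow> nat \<Rightarrow> complex) \<Rightarrow> nat \<Rightarrow> complex" where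
  "open_sum n A m = (\<Sum>w\<in>words n (2 * m). pair_weight A w * of_nat (nc_pairings w))"

definition arc_sum :: "nat \<Rightarrow> (nat \<Rightarrow> nat \<Rightarrow> complex) \<Rightarrow> (nat \<Rightarrow> nat \<Rightarrow> complex) \<Rightarrow> nat \<Rightarrow> complex" where
  "arc_sum n A B j =
     (\<Sum>a\<in>{1..n}. \<Sum>u\<in>words n (2 * j). chain_weight A B a u a * of_nat (nc_pairings u))"

lemma sum_even_terms:
  fixes f :: "nat \<Rightarrow> complex"
  assumes "\<And>p. odd p \<Longrightarrow> f p = 0"
  shows "(\<Sum>p<Suc (2 * m). f p) = (\<Sum>j\<le>m. f (2 * j))"
proof (induction m)
  case (Suc m)
  have "2 * Suc m = Suc (Suc (2 * m))" by simp
  then show ?case using Suc assms[of "Suc (2 * m)"] by simp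
qed simp

lemma open_sum_0 [simp]: "open_sum n A 0 = 1"
  by (simp add: open_sum_def)

lemma arc_sum_0: "arc_sum n A B 0 = mtrace n B"
  by (simp add: arc_sum_def mtrace_def)

text \<open>By parity the arc of the first letter \<open>a\<close> encloses an even number
  \<open>2 * j\<close> of letters. They form a chain from \<open>a\<close> back to \<open>a\<close>,
  while the word after the partner starts a new factor.\<close>

lemma open_sum_Suc: "open_sum n A (Suc m) = (\<Sum>j\<le>m. arc_sum n A A j * open_sum n A (m - j))"
proof -
  let ?g = "\<lambda>w. of_nat (nc_pairings w) :: complex"
  have "open_sum n A (Suc m) = (\<Sum>a\<in>{1..n}. \<Sum>w\<in>words n (Suc (2 * m)). pair_weight A (a # w) * ?g (a # w))"
    unfolding open_sum_def by (simp add: sum_words_Suc)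
  also have "\<dots> = (\<Sum>a\<in>{1..n}. \<Sum>w\<in>words n (Suc (2 * m)).
      \<Sum>(x, y)\<leftarrow>splits a w. pair_weight A (a # x @ a # y) * (?g x * ?g y))"
    by (intro sum.cong refl mult_nc_pairings_Cons) simp
  also have "\<dots> = (\<Sum>a\<in>{1..n}. \<Sum>p<Suc (2 * m). \<Sum>x\<in>words n p. \<Sum>y\<in>words n (2 * m - p).
      pair_weight A (a # x @ a # y) * (?g x * ?g y))"
    by (intro sum.cong refl, subst sum_words_splits) simp_all
  also have "\<dots> = (\<Sum>a\<in>{1..n}. \<Sum>j\<le>m. \<Sum>x\<in>words n (2 * j). \<Sum>y\<in>words n (2 * m - 2 * j).
      pair_weight A (a # x @ a # y) * (?g x * ?g y))"
    by (intro sum.cong refl sum_even_terms sum.neutral ballI) (auto simp: words_def nc_pairings_odd)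
  also have "\<dots> = (\<Sum>a\<in>{1..n}. \<Sum>j\<le>m. \<Sum>x\<in>words n (2 * j). \<Sum>y\<in>words n (2 * (m - j)).
      (chain_weight A A a x a * ?g x) * (pair_weight A y * ?g y))"
    by (intro sum.cong refl) (auto simp: words_def wt_chain right_diff_distrib')
  also have "\<dots> = (\<Sum>j\<le>m. arc_sum n A A j * open_sum n A (m - j))"
    by (subst sum.swap)
       (simp only: sum_product[symmetric] sum_distrib_right[symmetric] arc_sum_def open_sum_def)
  finally show ?thesis .
qed

text \<open>The first letter \<open>c\<close> closes the factor \<open>B a c\<close>, so the stretch
  up to its partner starts a new factor and does not touch the current cycle. After the partner the
  cycle continues with \<open>A\<close> in row \<open>c\<close>, which turns \<open>B\<close> into
  the product of \<open>B\<close> and \<open>A\<close>.\<close>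

lemma arc_sum_Suc:
  "arc_sum n A B (Suc j) = (\<Sum>i\<le>j. open_sum n A i * arc_sum n A (mat_mul n B A) (j - i))"
proof -
  let ?g = "\<lambda>w. of_nat (nc_pairings w) :: complex"
  have "arc_sum n A B (Suc j) =
      (\<Sum>a\<in>{1..n}. \<Sum>c\<in>{1..n}. \<Sum>w\<in>words n (Suc (2 * j)). chain_weight A B a (c # w) a * ?g (c # w))"
    unfolding arc_sum_def by (simp add: sum_words_Suc)
  also have "\<dots> = (\<Sum>a\<in>{1..n}. \<Sum>c\<in>{1..n}. \<Sum>w\<in>words n (Suc (2 * j)).
      \<Sum>(x, y)\<leftarrow>splits c w. chain_weight A B a (c # x @ c # y) a * (?g x * ?g y))"
    by (intro sum.cong refl mult_nc_pairings_Cons) simp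
  also have "\<dots> = (\<Sum>a\<in>{1..n}. \<Sum>c\<in>{1..n}. \<Sum>p<Suc (2 * j). \<Sum>x\<in>words n p. \<Sum>y\<in>words n (2 * j - p).
      chain_weight A B a (c # x @ c # y) a * (?g x * ?g y))"
    by (intro sum.cong refl, subst sum_words_splits) simp_all
  also have "\<dots> = (\<Sum>a\<in>{1..n}. \<Sum>c\<in>{1..n}. \<Sum>i\<le>j. \<Sum>x\<in>words n (2 * i). \<Sum>y\<in>words n (2 * j - 2 * i).
      chain_weight A B a (c # x @ c # y) a * (?g x * ?g y))"
    by (intro sum.cong refl sum_even_terms sum.neutral ballI) (auto simp: words_def nc_pairings_odd)
  also have "\<dots> = (\<Sum>a\<in>{1..n}. \<Sum>c\<in>{1..n}. \<Sum>i\<le>j. \<Sum>x\<in>words n (2 * i). \<Sum>y\<in>words n (2 * (j - i)).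
      (pair_weight A x * ?g x) * (B a c * chain_weight A A c y a * ?g y))"
    by (intro sum.cong refl) (auto simp: words_def chain_append right_diff_distrib')
  also have "\<dots> = (\<Sum>a\<in>{1..n}. \<Sum>c\<in>{1..n}. \<Sum>i\<le>j. open_sum n A i *
      (\<Sum>y\<in>words n (2 * (j - i)). B a c * chain_weight A A c y a * ?g y))"
    by (simp only: sum_product[symmetric] open_sum_def)
  also have "\<dots> = (\<Sum>i\<le>j. \<Sum>a\<in>{1..n}. open_sum n A i *
      (\<Sum>y\<in>words n (2 * (j - i)). (\<Sum>c\<in>{1..n}. B a c * chain_weight A A c y a) * ?g y))"
    by (subst (2) sum.swap, subst sum.swap)
       (simp add: sum_distrib_left[symmetric] sum_distrib_right sum.swap[of _ "words _ _"])
  also have "\<dots> = (\<Sum>i\<le>j. open_sum n A i * arc_sum n A (mat_mul n B A) (j - i))"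
    by (simp only: chain_mm arc_sum_def sum_distrib_left)
  finally show ?thesis .
qed

text \<open>The moment-cumulant formula scanned from the left. In \<open>nc_arc \<kappa> k j\<close>
  a block has \<open>k\<close> elements so far and its last element lies \<open>j\<close> positions
  further on; the recursion jumps over a gap of \<open>i\<close> positions to the next element of
  the block.\<close>

function nc_moment :: "(nat \<Rightarrow> complex) \<Rightarrow> nat \<Rightarrow> complex"
  and nc_arc :: "(nat \<Rightarrow> complex) \<Rightarrow> nat \<Rightarrow> nat \<Rightarrow> complex" where
  "nc_moment \<kappa> 0 = 1"
| "nc_moment \<kappa> (Suc m) = (\<Sum>j\<le>m. nc_arc \<kappa> 1 j * nc_moment \<kappa> (m - j))"
| "nc_arc \<kappa> k 0 = \<kappa> k"
| "nc_arc \<kappa> k (Suc j) = (\<Sum>i\<le>j. nc_moment \<kappa> i * nc_arc \<kappa> (Suc k) (j - i))"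
  by pat_completeness auto
termination
  by (relation "Wellfounded.measure (\<lambda>x. case x of Inl (_, m) \<Rightarrow> m | Inr (_, _, j) \<Rightarrow> j)") auto

lemma arc_sum_cong:
  assumes "\<And>a b. a \<in> {1..n} \<Longrightarrow> B a b = B' a b"
  shows "arc_sum n A B j = arc_sum n A B' j"
proof -
  have "chain_weight A B a u a = chain_weight A B' a u a" if "a \<in> {1..n}" for a u
    using assms that by (cases "(A, B, a, u, a)" rule: chain_weight.cases) auto
  then show ?thesis unfolding arc_sum_def by (intro sum.cong refl) auto
qed

lemma sum_scaled_conv:
  fixes c :: complex
  shows "(\<Sum>i\<le>j. (c ^ (d + i) * a i) * (c ^ (e + (j - i)) * b (j - i))) =
    c ^ (d + e + j) * (\<Sum>i\<le>j. a i * b (j - i))"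
  unfolding sum_distrib_left
proof (intro sum.cong refl)
  fix i assume "i \<in> {..j}"
  then have "d + e + j = (d + i) + (e + (j - i))" by simp
  then have "c ^ (d + e + j) = c ^ (d + i) * c ^ (e + (j - i))" by (simp only: power_add)
  then show "(c ^ (d + i) * a i) * (c ^ (e + (j - i)) * b (j - i)) = c ^ (d + e + j) * (a i * b (j - i))"
    by (simp only: mult_ac)
qed

text \<open>A cycle of length \<open>k\<close> plays the part of a block with \<open>k\<close>
  elements: up to powers of \<open>n\<close>, \<open>open_sum\<close> and \<open>arc_sum\<close>
  obey the recursions of \<open>nc_moment\<close> and \<open>nc_arc\<close>.\<close>

lemma open_sum_eq_mom:
  assumes "n \<ge> 1"
  shows "open_sum n A m = of_nat n ^ m * nc_moment (\<lambda>k. mtrace n (mpow n A k) / of_nat n ^ k) m"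
proof -
  let ?\<kappa> = "\<lambda>k. mtrace n (mpow n A k) / of_nat n ^ k"
  \<comment> \<open>All powers of \<open>A\<close> are treated at once, as
    \<open>arc_sum_Suc\<close> lowers \<open>m\<close> at the price of raising
    \<open>k\<close>.\<close>
  have "open_sum n A m = of_nat n ^ m * nc_moment ?\<kappa> m \<and>
      (\<forall>k. arc_sum n A (mpow n A k) m = of_nat n ^ (k + m) * nc_arc ?\<kappa> k m)" for m
  proof (induction m rule: less_induct)
    case (less m)
    show ?case
    proof (cases m)
      case 0
      then show ?thesis using assms by (simp add: arc_sum_0)
    next
      case (Suc j)
      have 1: "arc_sum n A A i = of_nat n ^ (1 + i) * nc_arc ?\<kappa> 1 i" if "i \<le> j" for i
        using less[of i] that Suc arc_sum_cong[of n "mpow n A 1" A A i] mpow_1 by simp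
      have "open_sum n A m = (\<Sum>i\<le>j. (of_nat n ^ (1 + i) * nc_arc ?\<kappa> 1 i) * (of_nat n ^ (j - i) * nc_moment ?\<kappa> (j - i)))"
        unfolding Suc open_sum_Suc using less Suc by (intro sum.cong refl) (simp add: 1)
      also have "\<dots> = of_nat n ^ m * nc_moment ?\<kappa> m"
        using sum_scaled_conv[of "of_nat n" 1 "nc_arc ?\<kappa> 1" 0 j "nc_moment ?\<kappa>"] by (simp add: Suc)
      finally have opn: "open_sum n A m = of_nat n ^ m * nc_moment ?\<kappa> m" .
      have "arc_sum n A (mpow n A k) m = of_nat n ^ (k + m) * nc_arc ?\<kappa> k m" for k
      proof -
        have "arc_sum n A (mat_mul n (mpow n A k) A) i = of_nat n ^ (Suc k + i) * nc_arc ?\<kappa> (Suc k) i"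
          if "i \<le> j" for i
          using less[of i] that Suc arc_sum_cong[of n "mpow n A (Suc k)" "mat_mul n (mpow n A k) A" A i]
          by simp
        then have "arc_sum n A (mpow n A k) m =
            (\<Sum>i\<le>j. (of_nat n ^ i * nc_moment ?\<kappa> i) * (of_nat n ^ (Suc k + (j - i)) * nc_arc ?\<kappa> (Suc k) (j - i)))"
          unfolding Suc arc_sum_Suc using less Suc by (intro sum.cong refl) simp
        also have "\<dots> = of_nat n ^ (k + m) * nc_arc ?\<kappa> k m"
          using sum_scaled_conv[of "of_nat n" 0 "nc_moment ?\<kappa>" "Suc k" j "nc_arc ?\<kappa> (Suc k)"] by (simp add: Suc)
        finally show ?thesis .
      qed
      with opn show ?thesis by blast
    qed
  qed
  then show ?thesis by blast
qed

lemma tendsto_nc_moment: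
  assumes "\<And>k. k \<ge> 1 \<Longrightarrow> (\<lambda>n. \<kappa>' n k) \<longlonglongrightarrow> \<kappa> k"
  shows "(\<lambda>n. nc_moment (\<kappa>' n) m) \<longlonglongrightarrow> nc_moment \<kappa> m"
proof -
  have "(\<lambda>n. nc_moment (\<kappa>' n) m) \<longlonglongrightarrow> nc_moment \<kappa> m \<and>
      (\<forall>k\<ge>1. (\<lambda>n. nc_arc (\<kappa>' n) k m) \<longlonglongrightarrow> nc_arc \<kappa> k m)"
  proof (induction m rule: less_induct)
    case (less m)
    show ?case
    proof (cases m)
      case (Suc j)
      then show ?thesis using less by (auto intro!: tendsto_intros)
    qed (use assms in simp)
  qed
  then show ?thesis by blast
qed

lemma sum_Cauchy_le:
  fixes a b :: "nat \<Rightarrow> real"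
  assumes "\<And>i. a i \<ge> 0" "\<And>i. b i \<ge> 0"
  shows "(\<Sum>m\<le>N. \<Sum>j\<le>m. a j * b (m - j)) \<le> (\<Sum>i\<le>N. a i) * (\<Sum>i\<le>N. b i)"
proof -
  have "(\<Sum>m\<le>N. \<Sum>j\<le>m. a j * b (m - j)) = (\<Sum>(i, j)\<in>{(i, j). i + j \<le> N}. a i * b j)"
    by (simp add: sum.triangle_reindex_eq)
  also have "\<dots> \<le> (\<Sum>(i, j)\<in>{..N} \<times> {..N}. a i * b j)"
    using assms by (intro sum_mono2) auto
  finally show ?thesis by (simp add: sum_product sum.cartesian_product)
qed

text \<open>
  At \<open>z = 1/4\<close> the majorising system \<open>M = 1 + z T M\<close>, \<open>T = 1 + z M T\<close> has the solution
  \<open>M = T = 2\<close>.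
\<close>

lemma norm_nc_moment_le:
  assumes "\<And>k. k \<ge> 1 \<Longrightarrow> cmod (\<kappa> k) \<le> 1"
  shows "cmod (nc_moment \<kappa> m) \<le> 2 * 4 ^ m"
proof -
  define p where "p m = cmod (nc_moment \<kappa> m) / 4 ^ m" for m
  define q where "q k j = cmod (nc_arc \<kappa> k j) / 4 ^ j" for k j
  have pq: "p m \<ge> 0" "q k m \<ge> 0" for m k by (simp_all add: p_def q_def)
  have conv: "cmod (\<Sum>j\<le>m. x j * y (m - j)) / 4 ^ Suc m \<le>
      1 / 4 * (\<Sum>j\<le>m. cmod (x j) / 4 ^ j * (cmod (y (m - j)) / 4 ^ (m - j)))" for x y m
  proof -
    have "cmod (\<Sum>j\<le>m. x j * y (m - j)) \<le> (\<Sum>j\<le>m. cmod (x j) * cmod (y (m - j)))"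
      by (rule sum_norm_le) (simp add: norm_mult)
    also have "\<dots> = 4 ^ m * (\<Sum>j\<le>m. cmod (x j) / 4 ^ j * (cmod (y (m - j)) / 4 ^ (m - j)))"
      unfolding sum_distrib_left by (intro sum.cong refl) (simp add: power_add[symmetric])
    finally show ?thesis by (simp add: field_simps)
  qed
  have p_Suc: "p (Suc m) \<le> 1 / 4 * (\<Sum>j\<le>m. q 1 j * p (m - j))" for m
    unfolding p_def q_def nc_moment.simps by (rule conv)
  have q_Suc: "q k (Suc m) \<le> 1 / 4 * (\<Sum>j\<le>m. p j * q (Suc k) (m - j))" for k m
    unfolding p_def q_def nc_arc.simps by (rule conv)
  \<comment> \<open>Bounding partial sums avoids any convergence argument: each step reads 1 + 1/4 *
    2 * 2 = 2. It covers all \<open>k\<close> together because \<open>q_Suc\<close> raises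
    \<open>k\<close>.\<close>
  have "(\<Sum>i\<le>N. p i) \<le> 2 \<and> (\<forall>k\<ge>1. (\<Sum>i\<le>N. q k i) \<le> 2)" for N
  proof (induction N)
    case 0
    have "q k 0 \<le> 2" if "k \<ge> 1" for k
      using assms[OF that] by (simp add: q_def)
    then show ?case by (simp add: p_def)
  next
    case (Suc N)
    have "(\<Sum>i\<le>Suc N. p i) \<le> 1 + (\<Sum>m\<le>N. 1 / 4 * (\<Sum>j\<le>m. q 1 j * p (m - j)))"
      unfolding sum.atMost_Suc_shift by (intro add_mono sum_mono p_Suc) (simp add: p_def)
    also have "\<dots> \<le> 1 + 1 / 4 * ((\<Sum>i\<le>N. q 1 i) * (\<Sum>i\<le>N. p i))"
      unfolding sum_distrib_left[symmetric] by (intro add_left_mono mult_left_mono sum_Cauchy_le pq) simp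
    also have "(\<Sum>i\<le>N. q 1 i) * (\<Sum>i\<le>N. p i) \<le> 2 * 2"
      using Suc by (intro mult_mono sum_nonneg pq) auto
    finally have 1: "(\<Sum>i\<le>Suc N. p i) \<le> 2" by simp
    have "(\<Sum>i\<le>Suc N. q k i) \<le> 2" if "k \<ge> 1" for k
    proof -
      have "(\<Sum>i\<le>Suc N. q k i) \<le> 1 + (\<Sum>m\<le>N. 1 / 4 * (\<Sum>j\<le>m. p j * q (Suc k) (m - j)))"
        unfolding sum.atMost_Suc_shift using assms[OF that]
        by (intro add_mono sum_mono q_Suc) (simp add: q_def)
      also have "\<dots> \<le> 1 + 1 / 4 * ((\<Sum>i\<le>N. p i) * (\<Sum>i\<le>N. q (Suc k) i))"
        unfolding sum_distrib_left[symmetric] by (intro add_left_mono mult_left_mono sum_Cauchy_le pq) simp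
      also have "(\<Sum>i\<le>N. p i) * (\<Sum>i\<le>N. q (Suc k) i) \<le> 2 * 2"
        using Suc by (intro mult_mono sum_nonneg pq) auto
      finally show ?thesis by simp
    qed
    with 1 show ?case by blast
  qed
  then have "(\<Sum>i\<le>m. p i) \<le> 2" by blast
  moreover have "p m \<le> (\<Sum>i\<le>m. p i)"
    by (rule member_le_sum) (auto simp: pq)
  ultimately have "p m \<le> 2" by linarith
  then show ?thesis by (simp add: p_def field_simps)
qed

section \<open>Sums over noncrossing partitions\<close>

definition noncrossing :: "nat set set \<Rightarrow> bool" where
  "noncrossing \<pi> \<longleftrightarrow> (\<forall>B\<in>\<pi>. \<forall>C\<in>\<pi>. \<forall>i j k l.
     i < j \<and> j < k \<and> k < l \<and> i \<in> B \<and> k \<in> B \<and> j \<in> C \<and> l \<in> C \<longrightarrow> B = C)"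

definition nc_parts :: "nat set \<Rightarrow> nat set set set" where
  "nc_parts S = {\<pi>. partition_on S \<pi> \<and> noncrossing \<pi>}"

lemma noncrossingD:
  "noncrossing \<pi> \<Longrightarrow> B \<in> \<pi> \<Longrightarrow> C \<in> \<pi> \<Longrightarrow> i < j \<Longrightarrow> j < k \<Longrightarrow> k < l \<Longrightarrow>
    i \<in> B \<Longrightarrow> k \<in> B \<Longrightarrow> j \<in> C \<Longrightarrow> l \<in> C \<Longrightarrow> B = C"
  unfolding noncrossing_def by blast

lemma noncrossing_partitions_eq: "noncrossing_partitions n = nc_parts {..<n}"
  unfolding noncrossing_partitions_def nc_parts_def noncrossing_def by blast

lemma finite_nc_parts: "finite S \<Longrightarrow> finite (nc_parts S)"
  by (rule finite_subset[of _ "Pow (Pow S)"]) (auto simp: nc_parts_def partition_on_def)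

lemma nc_parts_finite: "finite S \<Longrightarrow> \<pi> \<in> nc_parts S \<Longrightarrow> finite \<pi>"
  by (auto simp: nc_parts_def intro: finite_elements)

lemma nc_parts_eqI:
  "\<pi> \<in> nc_parts S \<Longrightarrow> B \<in> \<pi> \<Longrightarrow> C \<in> \<pi> \<Longrightarrow> x \<in> B \<Longrightarrow> x \<in> C \<Longrightarrow> B = C"
  by (auto simp: nc_parts_def partition_on_def disjoint_def)

definition nc_sum :: "(nat \<Rightarrow> complex) \<Rightarrow> nat set \<Rightarrow> complex" where
  "nc_sum f S = (\<Sum>\<pi>\<in>nc_parts S. \<Prod>B\<in>\<pi>. f (card B))"

text \<open>The mark \<open>k\<close> counts the elements already split off from the block of \<open>s\<close>.\<close>

definition marked_prod :: "(nat \<Rightarrow> complex) \<Rightarrow> nat \<Rightarrow> nat \<Rightarrow> nat set set \<Rightarrow> complex" where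
  "marked_prod f k s \<pi> = (\<Prod>B\<in>\<pi>. f (card B + (if s \<in> B then k else 0)))"

definition marked_sum :: "(nat \<Rightarrow> complex) \<Rightarrow> nat \<Rightarrow> nat \<Rightarrow> nat set \<Rightarrow> complex" where
  "marked_sum f k s S = (\<Sum>\<pi>\<in>nc_parts S. marked_prod f k s \<pi>)"

lemma nc_sum_marked: "nc_sum f S = marked_sum f 0 s S"
  by (simp add: nc_sum_def marked_sum_def marked_prod_def)

text \<open>With \<open>s\<close> below all other elements, \<open>t\<close> is the successor of
  \<open>s\<close> within its block; the partitions in which \<open>s\<close> is not alone are
  sorted by this \<open>t\<close>.\<close>

definition second_elem :: "nat \<Rightarrow> nat \<Rightarrow> nat set set \<Rightarrow> bool" where
  "second_elem s t \<pi> \<longleftrightarrow> (\<exists>B\<in>\<pi>. s \<in> B \<and> t \<in> B \<and> (\<forall>x\<in>B. x = s \<or> t \<le> x))"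

text \<open>When \<open>t\<close> is the second element, removing \<open>s\<close> leaves
  independent noncrossing partitions of the elements below \<open>t\<close> and of those from
  \<open>t\<close> on. \<open>glue\<close> inverts this by putting \<open>s\<close> back into the
  block of \<open>t\<close>.\<close>

definition glue :: "nat \<Rightarrow> nat \<Rightarrow> nat set set \<times> nat set set \<Rightarrow> nat set set" where
  "glue s t = (\<lambda>(\<sigma>, \<rho>). \<sigma> \<union> (\<lambda>C. if t \<in> C then insert s C else C) ` \<rho>)"

definition unglue :: "nat \<Rightarrow> nat set \<Rightarrow> nat set set \<Rightarrow> nat set set \<times> nat set set" where
  "unglue s U \<pi> = ({B \<in> \<pi>. B \<subseteq> U}, (\<lambda>B. B - {s}) ` {B \<in> \<pi>. \<not> B \<subseteq> U})"

context
  fixes S U V :: "nat set" and s t :: nat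
  assumes fin: "finite S" and less: "\<And>x. x \<in> S \<Longrightarrow> s < x" and t: "t \<in> S"
    and U: "U = {x \<in> S. x < t}" and V: "V = {x \<in> S. t \<le> x}"
begin

text \<open>A block other than that of \<open>s\<close> with elements on both sides of
  \<open>t\<close> would cross the arc from \<open>s\<close> to \<open>t\<close>.\<close>

lemma second_elem_blocks:
  assumes "\<pi> \<in> nc_parts (insert s S)" "second_elem s t \<pi>"
  obtains D where "D \<in> \<pi>" "s \<in> D" "t \<in> D" "D - {s} \<subseteq> V"
    "\<And>B. B \<in> \<pi> \<Longrightarrow> B \<noteq> D \<Longrightarrow> s \<notin> B \<and> t \<notin> B \<and> (B \<subseteq> U \<or> B \<subseteq> V)"
proof -
  have sub: "B \<subseteq> insert s S" if "B \<in> \<pi>" for B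
    using assms(1) that by (auto simp: nc_parts_def partition_on_def)
  obtain D where D: "D \<in> \<pi>" "s \<in> D" "t \<in> D" "\<And>x. x \<in> D \<Longrightarrow> x = s \<or> t \<le> x"
    using assms(2) unfolding second_elem_def by blast
  have "s \<notin> B \<and> t \<notin> B \<and> (B \<subseteq> U \<or> B \<subseteq> V)" if B: "B \<in> \<pi>" "B \<noteq> D" for B
  proof -
    have cut_point: "s \<notin> B" "t \<notin> B"
      using nc_parts_eqI[OF assms(1) B(1) D(1)] B(2) D by blast+
    have "\<not> (x < t \<and> t \<le> y)" if "x \<in> B" "y \<in> B" for x y
    proof
      assume *: "x < t \<and> t \<le> y"
      have "s < x" using sub[OF B(1)] that(1) cut_point less by blast
      moreover have "t < y" using * that cut_point by (metis le_neq_implies_less)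
      ultimately have "D = B"
        using noncrossingD[of \<pi> D B s x t y] assms(1) D B(1) * that by (auto simp: nc_parts_def)
      then show False using B(2) by simp
    qed
    then have "(\<forall>x\<in>B. x < t) \<or> (\<forall>y\<in>B. t \<le> y)" by (meson leI)
    then show ?thesis using sub[OF B(1)] cut_point unfolding U V by blast
  qed
  moreover have "D - {s} \<subseteq> V" using D sub[OF D(1)] unfolding V by blast
  ultimately show ?thesis using that D by blast
qed

lemma cut_point: "s < t" "s \<notin> U" "s \<notin> V" "t \<notin> U" "t \<in> V" "U \<inter> V = {}" "insert s S = insert s (U \<union> V)"
  using t less unfolding U V by auto

lemma unglue_in:
  assumes "\<pi> \<in> nc_parts (insert s S)" "second_elem s t \<pi>"
  shows "unglue s U \<pi> \<in> nc_parts U \<times> nc_parts V"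
proof -
  obtain D where D: "D \<in> \<pi>" "s \<in> D" "t \<in> D" "D - {s} \<subseteq> V"
    and oth: "\<And>B. B \<in> \<pi> \<Longrightarrow> B \<noteq> D \<Longrightarrow> s \<notin> B \<and> t \<notin> B \<and> (B \<subseteq> U \<or> B \<subseteq> V)"
    using second_elem_blocks[OF assms] by blast
  have part: "\<Union>\<pi> = insert s S" "{} \<notin> \<pi>" and nc: "noncrossing \<pi>"
    and disj: "\<And>B C x. B \<in> \<pi> \<Longrightarrow> C \<in> \<pi> \<Longrightarrow> x \<in> B \<Longrightarrow> x \<in> C \<Longrightarrow> B = C"
    using assms(1) nc_parts_eqI[OF assms(1)] by (auto simp: nc_parts_def partition_on_def)
  have "{B \<in> \<pi>. B \<subseteq> U} \<in> nc_parts U"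
  proof -
    have "x \<in> \<Union>{B \<in> \<pi>. B \<subseteq> U}" if "x \<in> U" for x
    proof -
      obtain B where B: "B \<in> \<pi>" "x \<in> B" using part(1) cut_point(7) \<open>x \<in> U\<close> by blast
      moreover have "B \<noteq> D" using B D(4) cut_point \<open>x \<in> U\<close> by blast
      ultimately show ?thesis using oth[of B] cut_point(6) \<open>x \<in> U\<close> by blast
    qed
    then have "\<Union>{B \<in> \<pi>. B \<subseteq> U} = U" by blast
    moreover have "noncrossing {B \<in> \<pi>. B \<subseteq> U}" using nc unfolding noncrossing_def by blast
    moreover have "disjoint {B \<in> \<pi>. B \<subseteq> U}" using disj unfolding disjoint_def by blast
    ultimately show ?thesis using part(2) by (simp add: nc_parts_def partition_on_def)
  qed
  moreover have "(\<lambda>B. B - {s}) ` {B \<in> \<pi>. \<not> B \<subseteq> U} \<in> nc_parts V" (is "?\<rho> \<in> _")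
  proof -
    have V': "B - {s} \<subseteq> V \<and> B - {s} \<noteq> {}" if "B \<in> \<pi>" "\<not> B \<subseteq> U" for B
      using that oth[of B] D cut_point part(2) by (cases "B = D") auto
    have "x \<in> \<Union>?\<rho>" if "x \<in> V" for x
    proof -
      obtain B where B: "B \<in> \<pi>" "x \<in> B" using part(1) cut_point(7) \<open>x \<in> V\<close> by blast
      then show ?thesis using cut_point \<open>x \<in> V\<close> by blast
    qed
    then have "\<Union>?\<rho> = V" using V' by blast
    moreover have "{} \<notin> ?\<rho>" using V' by force
    moreover have "disjoint ?\<rho>" using disj unfolding disjoint_def by blast
    moreover have "noncrossing ?\<rho>"
      unfolding noncrossing_def using noncrossingD[OF nc] by blast
    ultimately show ?thesis by (simp add: nc_parts_def partition_on_def)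
  qed
  ultimately show ?thesis by (simp add: unglue_def)
qed

lemma glue_unglue:
  assumes "\<pi> \<in> nc_parts (insert s S)" "second_elem s t \<pi>"
  shows "glue s t (unglue s U \<pi>) = \<pi>"
proof -
  obtain D where D: "D \<in> \<pi>" "s \<in> D" "t \<in> D" "D - {s} \<subseteq> V"
    and oth: "\<And>B. B \<in> \<pi> \<Longrightarrow> B \<noteq> D \<Longrightarrow> s \<notin> B \<and> t \<notin> B \<and> (B \<subseteq> U \<or> B \<subseteq> V)"
    using second_elem_blocks[OF assms] by blast
  have "(if t \<in> B - {s} then insert s (B - {s}) else B - {s}) = B" if "B \<in> \<pi>" for B
    using that oth[of B] D cut_point(1) by (cases "B = D") auto
  then have "(\<lambda>C. if t \<in> C then insert s C else C) ` (\<lambda>B. B - {s}) ` {B \<in> \<pi>. \<not> B \<subseteq> U} = {B \<in> \<pi>. \<not> B \<subseteq> U}"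
    unfolding image_image by force
  then show ?thesis unfolding glue_def unglue_def by auto
qed

context
  fixes \<sigma> \<rho> :: "nat set set"
  assumes \<sigma>: "\<sigma> \<in> nc_parts U" and \<rho>: "\<rho> \<in> nc_parts V"
begin

lemma glue_blocks:
  shows "\<Union>\<sigma> = U" "{} \<notin> \<sigma>" "noncrossing \<sigma>" "\<Union>\<rho> = V" "{} \<notin> \<rho>" "noncrossing \<rho>"
    "\<And>B. B \<in> \<sigma> \<Longrightarrow> B \<subseteq> U" "\<And>C. C \<in> \<rho> \<Longrightarrow> C \<subseteq> V"
  using \<sigma> \<rho> by (auto simp: nc_parts_def partition_on_def)

lemma glue_in: "glue s t (\<sigma>, \<rho>) \<in> nc_parts (insert s S)" "second_elem s t (glue s t (\<sigma>, \<rho>))"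
proof -
  note g = glue_blocks
  let ?h = "\<lambda>C. if t \<in> C then insert s C else C"
  obtain C\<^sub>0 where C\<^sub>0: "C\<^sub>0 \<in> \<rho>" "t \<in> C\<^sub>0" using g(4) cut_point(5) by blast
  have h: "?h C \<subseteq> insert s V" "C \<subseteq> ?h C" if "C \<in> \<rho>" for C using g(8)[OF that] by auto
  have ge: "t \<le> x" if "x \<in> V" for x using that unfolding V by simp
  show "second_elem s t (glue s t (\<sigma>, \<rho>))"
    unfolding second_elem_def glue_def using C\<^sub>0 g(8)[OF C\<^sub>0(1)] ge
    by (auto intro!: bexI[of _ "insert s C\<^sub>0"])
  have "\<Union>(?h ` \<rho>) = insert s V" using g(4) C\<^sub>0 by auto
  then have "\<Union>(glue s t (\<sigma>, \<rho>)) = insert s S" unfolding glue_def cut_point(7) using g(1) by auto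
  moreover have "{} \<notin> glue s t (\<sigma>, \<rho>)" unfolding glue_def using g by auto
  moreover have h_eq: "?h B = ?h C" if "B \<in> \<rho>" "C \<in> \<rho>" "x \<in> ?h B" "x \<in> ?h C" for B C x
  proof (cases "x = s")
    case True
    then have "t \<in> B" "t \<in> C" using that g(8) cut_point(3) by (auto split: if_splits)
    then show ?thesis using nc_parts_eqI[OF \<rho>] that by metis
  next
    case False
    then have "x \<in> B" "x \<in> C" using that by (auto split: if_splits)
    then show ?thesis using nc_parts_eqI[OF \<rho>] that by metis
  qed
  have eq: "B = C" if "B \<in> glue s t (\<sigma>, \<rho>)" "C \<in> glue s t (\<sigma>, \<rho>)" "x \<in> B" "x \<in> C" for B C x
  proof -
    have no: "\<not> (x \<in> D \<and> x \<in> ?h E)" if "D \<in> \<sigma>" "E \<in> \<rho>" for D E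
      using g(7)[OF that(1)] h(1)[OF that(2)] cut_point by blast
    consider "B \<in> \<sigma>" "C \<in> \<sigma>" | B' C' where "B' \<in> \<rho>" "C' \<in> \<rho>" "B = ?h B'" "C = ?h C'"
      using \<open>B \<in> glue s t (\<sigma>, \<rho>)\<close> \<open>C \<in> glue s t (\<sigma>, \<rho>)\<close> \<open>x \<in> B\<close> \<open>x \<in> C\<close> no
      unfolding glue_def by blast
    then show ?thesis
      by cases (use nc_parts_eqI[OF \<sigma>] h_eq \<open>x \<in> B\<close> \<open>x \<in> C\<close> in blast)+
  qed
  then have "disjoint (glue s t (\<sigma>, \<rho>))" unfolding disjoint_def by blast
  moreover have "noncrossing (glue s t (\<sigma>, \<rho>))"
    unfolding noncrossing_def
  proof (intro ballI allI impI, elim conjE)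
    fix B C i j k l
    assume BC: "B \<in> glue s t (\<sigma>, \<rho>)" "C \<in> glue s t (\<sigma>, \<rho>)"
      and lt: "i < j" "j < k" "k < l" and mem: "i \<in> B" "k \<in> B" "j \<in> C" "l \<in> C"
    have lo: "s < x \<and> x < t" if "D \<in> \<sigma>" "x \<in> D" for D x
      using g(7)[OF that(1)] that(2) less unfolding U by blast
    have hi: "x = s \<or> t \<le> x" if "D \<in> \<rho>" "x \<in> ?h D" for D x
      using h(1)[OF that(1)] that(2) ge by blast
    consider "B \<in> \<sigma>" "C \<in> \<sigma>" | C' where "B \<in> \<sigma>" "C' \<in> \<rho>" "C = ?h C'"
      | B' where "B' \<in> \<rho>" "B = ?h B'" "C \<in> \<sigma>"
      | B' C' where "B' \<in> \<rho>" "C' \<in> \<rho>" "B = ?h B'" "C = ?h C'"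
      using BC unfolding glue_def by blast
    then show "B = C"
    proof cases
      case 1
      then show ?thesis using noncrossingD[OF g(3)] lt mem by blast
    next
      case 2
      then show ?thesis using lo[of B i] lo[of B k] hi[of C' j] lt mem by auto
    next
      case 3
      then show ?thesis using lo[of C j] lo[of C l] hi[of B' k] lt mem by auto
    next
      case 4
      have jkl: "j \<noteq> s" "k \<noteq> s" "l \<noteq> s" "t \<le> j" "t \<le> k"
        using hi[OF 4(1), of i] hi[OF 4(2), of j] hi[OF 4(1), of k] 4 lt mem cut_point(1) by auto
      then have jl: "j \<in> C'" "l \<in> C'" "k \<in> B'" using 4 mem by (auto split: if_splits)
      show ?thesis
      proof (cases "i = s")
        case False
        then have "i \<in> B'" using 4 mem by (auto split: if_splits)
        then have "B' = C'" using noncrossingD[OF g(6) 4(1,2) lt] jl by blast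
        then show ?thesis using 4 by simp
      next
        \<comment> \<open>The crossing is transferred from \<open>s\<close> to \<open>t\<close>, the
          next element of the same block; should \<open>t = j\<close> hold, the two blocks already
          share an element.\<close>
        case True
        then have "t \<in> B'" using 4 mem g(8)[OF 4(1)] cut_point(3) by (auto split: if_splits)
        then have "B' = C'"
          using noncrossingD[OF g(6) 4(1,2), of t j k l] jl jkl lt nc_parts_eqI[OF \<rho> 4(1,2)]
          by (metis le_neq_implies_less)
        then show ?thesis using 4 by simp
      qed
    qed
  qed
  ultimately show "glue s t (\<sigma>, \<rho>) \<in> nc_parts (insert s S)"
    by (simp add: nc_parts_def partition_on_def)
qed

lemma glued_block:
  assumes "C \<in> \<rho>"
  shows "\<not> (if t \<in> C then insert s C else C) \<subseteq> U" "(if t \<in> C then insert s C else C) - {s} = C"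
proof -
  have "C \<noteq> {}" "C \<subseteq> V" using glue_blocks(5,8) assms by blast+
  then show "\<not> (if t \<in> C then insert s C else C) \<subseteq> U" "(if t \<in> C then insert s C else C) - {s} = C"
    using cut_point by auto
qed

lemma unglue_glue: "unglue s U (glue s t (\<sigma>, \<rho>)) = (\<sigma>, \<rho>)"
proof -
  note g = glue_blocks
  let ?h = "\<lambda>C. if t \<in> C then insert s C else C"
  note h = glued_block
  define R where "R = ?h ` \<rho>"
  have R: "\<not> B \<subseteq> U" if B: "B \<in> R" for B
  proof -
    obtain C where C: "B = ?h C" "C \<in> \<rho>" using B unfolding R_def image_iff by blast
    show ?thesis unfolding C(1) by (rule h(1)[OF C(2)])
  qed
  have glue: "glue s t (\<sigma>, \<rho>) = \<sigma> \<union> R" by (simp add: glue_def R_def)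
  have "B \<in> {B \<in> glue s t (\<sigma>, \<rho>). B \<subseteq> U} \<longleftrightarrow> B \<in> \<sigma>"
    and "B \<in> {B \<in> glue s t (\<sigma>, \<rho>). \<not> B \<subseteq> U} \<longleftrightarrow> B \<in> R" for B
    unfolding glue using g(7)[of B] R[of B] by auto
  then have "{B \<in> glue s t (\<sigma>, \<rho>). B \<subseteq> U} = \<sigma>"
    and "{B \<in> glue s t (\<sigma>, \<rho>). \<not> B \<subseteq> U} = ?h ` \<rho>"
    unfolding R_def[symmetric] by (auto simp only: set_eq_iff)
  moreover have "(\<lambda>B. B - {s}) ` ?h ` \<rho> = \<rho>"
    unfolding image_image using h(2) by force
  ultimately show ?thesis by (simp add: unglue_def)
qed

text \<open>Deleting \<open>s\<close> shortens its block by one; in return the mark on the rest of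
  that block, now attached to \<open>t\<close>, grows by one.\<close>

lemma marked_prod_glue:
  "marked_prod f k s (glue s t (\<sigma>, \<rho>)) = (\<Prod>B\<in>\<sigma>. f (card B)) * marked_prod f (Suc k) t \<rho>"
proof -
  note g = glue_blocks
  let ?h = "\<lambda>C. if t \<in> C then insert s C else C"
  have fV: "finite V" "finite U" using fin unfolding U V by auto
  have fin': "finite \<sigma>" "finite \<rho>"
    using nc_parts_finite \<sigma> \<rho> fV by blast+
  note h = glued_block
  have inj: "inj_on ?h \<rho>" by (rule inj_on_inverseI[where g = "\<lambda>B. B - {s}"]) (use h(2) in blast)
  have "\<not> B \<subseteq> U" if B: "B \<in> ?h ` \<rho>" for B
  proof -
    obtain C where C: "B = ?h C" "C \<in> \<rho>" using B unfolding image_iff by blast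
    show ?thesis unfolding C(1) by (rule h(1)[OF C(2)])
  qed
  then have "\<not> (B \<in> \<sigma> \<and> B \<in> ?h ` \<rho>)" for B using g(7)[of B] by metis
  then have "\<sigma> \<inter> ?h ` \<rho> = {}" unfolding disjoint_iff by metis
  then have "marked_prod f k s (glue s t (\<sigma>, \<rho>)) =
      (\<Prod>B\<in>\<sigma>. f (card B + (if s \<in> B then k else 0))) *
      (\<Prod>C\<in>?h ` \<rho>. f (card C + (if s \<in> C then k else 0)))"
    unfolding marked_prod_def glue_def prod.case
    using fin' by (intro prod.union_disjoint) (simp_all only: finite_imageI)
  also have "(\<Prod>C\<in>?h ` \<rho>. f (card C + (if s \<in> C then k else 0))) =
      (\<Prod>C\<in>\<rho>. f (card (?h C) + (if s \<in> ?h C then k else 0)))"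
    by (subst prod.reindex[OF inj]) (simp only: o_def)
  also have "(\<Prod>B\<in>\<sigma>. f (card B + (if s \<in> B then k else 0))) = (\<Prod>B\<in>\<sigma>. f (card B))"
    using g(7) cut_point(2) by (intro prod.cong refl) auto
  also have "(\<Prod>C\<in>\<rho>. f (card (?h C) + (if s \<in> ?h C then k else 0))) = marked_prod f (Suc k) t \<rho>"
    unfolding marked_prod_def
  proof (intro prod.cong refl)
    fix C assume "C \<in> \<rho>"
    then have "s \<notin> C" "finite C" using g(8) cut_point(3) fV finite_subset by blast+
    then show "f (card (?h C) + (if s \<in> ?h C then k else 0)) = f (card C + (if t \<in> C then Suc k else 0))"
      by simp
  qed
  finally show ?thesis .
qed

end

lemma sum_second_elem:
  "(\<Sum>\<pi> | \<pi> \<in> nc_parts (insert s S) \<and> second_elem s t \<pi>. marked_prod f k s \<pi>) =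
    nc_sum f U * marked_sum f (Suc k) t V"
proof -
  have "(\<Sum>\<pi> | \<pi> \<in> nc_parts (insert s S) \<and> second_elem s t \<pi>. marked_prod f k s \<pi>) =
      (\<Sum>p\<in>nc_parts U \<times> nc_parts V. (\<Prod>B\<in>fst p. f (card B)) * marked_prod f (Suc k) t (snd p))"
  proof (rule sum.reindex_bij_witness[where i = "glue s t" and j = "unglue s U"])
    fix \<pi> assume "\<pi> \<in> {\<pi>. \<pi> \<in> nc_parts (insert s S) \<and> second_elem s t \<pi>}"
    then have \<pi>: "\<pi> \<in> nc_parts (insert s S)" "second_elem s t \<pi>" by auto
    show g: "glue s t (unglue s U \<pi>) = \<pi>" by (rule glue_unglue[OF \<pi>])
    show "unglue s U \<pi> \<in> nc_parts U \<times> nc_parts V" by (rule unglue_in[OF \<pi>])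
    then show "(\<Prod>B\<in>fst (unglue s U \<pi>). f (card B)) * marked_prod f (Suc k) t (snd (unglue s U \<pi>)) =
        marked_prod f k s \<pi>"
      using marked_prod_glue[of "fst (unglue s U \<pi>)" "snd (unglue s U \<pi>)" f k] g by auto
  qed (auto simp: unglue_glue glue_in)
  then show ?thesis
    by (simp add: nc_sum_def marked_sum_def sum_product sum.cartesian_product case_prod_unfold)
qed

end

lemma sum_singleton_block:
  assumes "finite S" "s \<notin> S"
  shows "(\<Sum>\<pi> | \<pi> \<in> nc_parts (insert s S) \<and> {s} \<in> \<pi>. marked_prod f k s \<pi>) = f (Suc k) * nc_sum f S"
proof -
  have no: "s \<notin> B" if "\<pi> \<in> nc_parts S" "B \<in> \<pi>" for \<pi> B
    using that assms by (auto simp: nc_parts_def partition_on_def)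
  have "(\<Sum>\<pi> | \<pi> \<in> nc_parts (insert s S) \<and> {s} \<in> \<pi>. marked_prod f k s \<pi>) =
      (\<Sum>\<pi>\<in>nc_parts S. f (Suc k) * (\<Prod>B\<in>\<pi>. f (card B)))"
  proof (rule sum.reindex_bij_witness[where i = "insert {s}" and j = "\<lambda>\<pi>. \<pi> - {{s}}"])
    fix \<pi> assume \<pi>: "\<pi> \<in> nc_parts S"
    have "{s} \<notin> \<pi>" using no[OF \<pi>] by blast
    then show "insert {s} \<pi> - {{s}} = \<pi>" by simp
    have part: "\<Union>\<pi> = S" "{} \<notin> \<pi>" "disjoint \<pi>" "noncrossing \<pi>"
      using \<pi> by (auto simp: nc_parts_def partition_on_def)
    have "B \<inter> {s} = {}" if "B \<in> \<pi>" for B using no[OF \<pi> that] by simp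
    then have "disjoint (insert {s} \<pi>)"
      using part(3) by (auto simp: disjoint_def pairwise_insert disjnt_def)
    moreover have "noncrossing (insert {s} \<pi>)"
      unfolding noncrossing_def
    proof (intro ballI allI impI, elim conjE)
      fix B C i j k l
      assume "B \<in> insert {s} \<pi>" "C \<in> insert {s} \<pi>"
        and lt: "i < j" "j < k" "k < l" and mem: "i \<in> B" "k \<in> B" "j \<in> C" "l \<in> C"
      moreover have "B \<noteq> {s}" "C \<noteq> {s}" using lt mem by auto
      ultimately show "B = C" using noncrossingD[OF part(4), of B C i j k l] by simp
    qed
    ultimately show "insert {s} \<pi> \<in> {\<pi> \<in> nc_parts (insert s S). {s} \<in> \<pi>}"
      using part by (auto simp: nc_parts_def partition_on_def)
  next
    fix \<pi> assume "\<pi> \<in> {\<pi> \<in> nc_parts (insert s S). {s} \<in> \<pi>}"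
    then have \<pi>: "\<pi> \<in> nc_parts (insert s S)" "{s} \<in> \<pi>" by auto
    then show ins: "insert {s} (\<pi> - {{s}}) = \<pi>" by blast
    have part: "\<Union>\<pi> = insert s S" "{} \<notin> \<pi>" "disjoint \<pi>" "noncrossing \<pi>"
      using \<pi> by (auto simp: nc_parts_def partition_on_def)
    have sB: "s \<notin> B" if "B \<in> \<pi> - {{s}}" for B
      using nc_parts_eqI[OF \<pi>(1), of "{s}" B s] \<pi>(2) that by auto
    have "\<Union>(\<pi> - {{s}}) = S"
    proof (rule set_eqI)
      fix x
      have "x \<in> \<Union>(\<pi> - {{s}}) \<longleftrightarrow> x \<noteq> s \<and> x \<in> \<Union>\<pi>" using sB by auto
      then show "x \<in> \<Union>(\<pi> - {{s}}) \<longleftrightarrow> x \<in> S" unfolding part(1) using assms(2) by auto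
    qed
    moreover have "disjoint (\<pi> - {{s}})" using part(3) unfolding disjoint_def by blast
    moreover have "noncrossing (\<pi> - {{s}})" using part(4) unfolding noncrossing_def by blast
    ultimately show mem: "\<pi> - {{s}} \<in> nc_parts S"
      using part(2) by (auto simp: nc_parts_def partition_on_def)
    have "marked_prod f k s (insert {s} (\<pi> - {{s}})) =
        f (Suc k) * (\<Prod>B\<in>\<pi> - {{s}}. f (card B + (if s \<in> B then k else 0)))"
      unfolding marked_prod_def
      using nc_parts_finite[OF assms(1) mem] by (subst prod.insert) auto
    also have "(\<Prod>B\<in>\<pi> - {{s}}. f (card B + (if s \<in> B then k else 0))) = (\<Prod>B\<in>\<pi> - {{s}}. f (card B))"
      using sB by (intro prod.cong refl) auto
    finally show "f (Suc k) * (\<Prod>B\<in>\<pi> - {{s}}. f (card B)) = marked_prod f k s \<pi>"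
      unfolding ins by simp
  qed
  then show ?thesis by (simp add: nc_sum_def sum_distrib_left)
qed

text \<open>The block of \<open>s\<close> is either a singleton or has a unique second element
  \<open>t\<close>.\<close>

lemma marked_sum_insert:
  assumes "finite S" "\<And>x. x \<in> S \<Longrightarrow> s < x"
  shows "marked_sum f k s (insert s S) = f (Suc k) * nc_sum f S +
    (\<Sum>t\<in>S. nc_sum f {x \<in> S. x < t} * marked_sum f (Suc k) t {x \<in> S. t \<le> x})"
proof -
  let ?P = "nc_parts (insert s S)"
  let ?C = "\<lambda>t. {\<pi>. \<pi> \<in> ?P \<and> second_elem s t \<pi>}"
  have s: "s \<notin> S" using assms(2) by blast
  have "?P = {\<pi>. \<pi> \<in> ?P \<and> {s} \<in> \<pi>} \<union> (\<Union>t\<in>S. ?C t)"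
  proof (intro equalityI subsetI)
    fix \<pi> assume \<pi>: "\<pi> \<in> ?P"
    then have "\<Union>\<pi> = insert s S" by (auto simp: nc_parts_def partition_on_def)
    then obtain B where B: "B \<in> \<pi>" "s \<in> B" "B \<subseteq> insert s S" by blast
    show "\<pi> \<in> {\<pi>. \<pi> \<in> ?P \<and> {s} \<in> \<pi>} \<union> (\<Union>t\<in>S. ?C t)"
    proof (cases "B = {s}")
      case False
      define t where "t = Min (B - {s})"
      have fB: "finite (B - {s})" using assms(1) B(3) by (meson finite_Diff finite_insert finite_subset)
      have "B - {s} \<noteq> {}" using False B(2) by blast
      then have "t \<in> B - {s}" "\<forall>x\<in>B - {s}. t \<le> x"
        unfolding t_def using Min_in[OF fB] Min_le[OF fB] by blast+
      then have "second_elem s t \<pi>" "t \<in> S" unfolding second_elem_def using B by blast+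
      then show ?thesis using \<pi> by blast
    qed (use \<pi> B in blast)
  qed auto
  moreover have "{\<pi>. \<pi> \<in> ?P \<and> {s} \<in> \<pi>} \<inter> (\<Union>t\<in>S. ?C t) = {}"
  proof -
    have False if "\<pi> \<in> ?P" "{s} \<in> \<pi>" "t \<in> S" "second_elem s t \<pi>" for \<pi> t
      using that nc_parts_eqI[OF that(1,2), of _ s] s unfolding second_elem_def by blast
    then show ?thesis by blast
  qed
  moreover have "?C t \<inter> ?C u = {}" if "t \<in> S" "u \<in> S" "t \<noteq> u" for t u
  proof -
    have False if "\<pi> \<in> ?P" "second_elem s t \<pi>" "second_elem s u \<pi>" for \<pi>
    proof -
      obtain B where B: "B \<in> \<pi>" "s \<in> B" "t \<in> B" "\<forall>x\<in>B. x = s \<or> t \<le> x"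
        using \<open>second_elem s t \<pi>\<close> unfolding second_elem_def by blast
      obtain C where C: "C \<in> \<pi>" "s \<in> C" "u \<in> C" "\<forall>x\<in>C. x = s \<or> u \<le> x"
        using \<open>second_elem s u \<pi>\<close> unfolding second_elem_def by blast
      have "B = C" using nc_parts_eqI[OF \<open>\<pi> \<in> ?P\<close> B(1) C(1)] B C by blast
      then show False using B C \<open>t \<noteq> u\<close> s \<open>t \<in> S\<close> \<open>u \<in> S\<close> by (metis antisym)
    qed
    then show ?thesis by blast
  qed
  moreover have "finite ?P" using assms(1) by (simp add: finite_nc_parts)
  ultimately have "marked_sum f k s (insert s S) =
      (\<Sum>\<pi> | \<pi> \<in> ?P \<and> {s} \<in> \<pi>. marked_prod f k s \<pi>) + (\<Sum>t\<in>S. \<Sum>\<pi>\<in>?C t. marked_prod f k s \<pi>)"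
    unfolding marked_sum_def using assms(1)
    by (subst (1) \<open>?P = _\<close>, subst sum.union_disjoint) (auto simp: sum.UNION_disjoint)
  also have "(\<Sum>t\<in>S. \<Sum>\<pi>\<in>?C t. marked_prod f k s \<pi>) =
      (\<Sum>t\<in>S. nc_sum f {x \<in> S. x < t} * marked_sum f (Suc k) t {x \<in> S. t \<le> x})"
    by (intro sum.cong refl sum_second_elem assms) auto
  finally show ?thesis unfolding sum_singleton_block[OF assms(1) s] .
qed

text \<open>The value of \<open>marked_sum\<close> for a set with \<open>n\<close> elements above
  \<open>s\<close>: the index \<open>j\<close> is the distance, in rank, from \<open>s\<close> to
  the last element of its block.\<close>

definition marked_mom :: "(nat \<Rightarrow> complex) \<Rightarrow> nat \<Rightarrow> nat \<Rightarrow> complex" where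
  "marked_mom f k n = (\<Sum>j\<le>n. nc_arc f (Suc k) j * nc_moment f (n - j))"

lemma marked_mom_0: "marked_mom f 0 n = nc_moment f (Suc n)"
  by (simp add: marked_mom_def)

text \<open>The definition cuts behind the last element of the block, the recursion in front of the
  second one. The two agree because the convolution of moments, arcs and moments is
  associative.\<close>

lemma marked_mom_rec:
  "marked_mom f k n = f (Suc k) * nc_moment f n + (\<Sum>i<n. nc_moment f i * marked_mom f (Suc k) (n - 1 - i))"
proof (cases n)
  case (Suc m)
  define a where "a = Abs_fps (nc_moment f)"
  define b where "b = Abs_fps (nc_arc f (Suc (Suc k)))"
  have "fps_nth (a * b * a) m = fps_nth (a * (b * a)) m" by (simp add: mult.assoc)
  then have "(\<Sum>j\<le>m. (\<Sum>i\<le>j. nc_moment f i * nc_arc f (Suc (Suc k)) (j - i)) * nc_moment f (m - j)) =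
      (\<Sum>i\<le>m. nc_moment f i * marked_mom f (Suc k) (m - i))"
    by (simp add: a_def b_def fps_mult_nth atLeast0AtMost marked_mom_def)
  then show ?thesis
    unfolding Suc marked_mom_def[of f k] sum.atMost_Suc_shift
    by (simp add: lessThan_Suc_atMost del: nc_moment.simps sum.atMost_Suc)
qed (simp add: marked_mom_def)

lemma sum_rank:
  fixes h :: "nat \<Rightarrow> complex" and S :: "nat set"
  assumes "finite S"
  shows "(\<Sum>t\<in>S. h (card {x \<in> S. x < t})) = (\<Sum>i<card S. h i)"
  using assms
proof (induction S rule: finite_linorder_max_induct)
  case (insert b A)
  have "b \<notin> A" using insert by blast
  have "{x \<in> insert b A. x < t} = {x \<in> A. x < t}" if "t \<in> A" for t
    using insert that by force
  moreover have "{x \<in> insert b A. x < b} = A" using insert by auto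
  ultimately show ?case using insert \<open>b \<notin> A\<close> by (simp add: add.commute)
qed simp

lemma nc_sum_eq_mom:
  assumes "finite S"
  shows "nc_sum f S = nc_moment f (card S)"
proof -
  \<comment> \<open>The two claims interlock: the unmarked sum for size \<open>m\<close> uses a
    marked one for size \<open>m - 1\<close>, and the marked ones for size \<open>m\<close> use the
    unmarked sum for size \<open>m\<close>.\<close>
  have "\<forall>S. finite S \<and> card S = m \<longrightarrow> nc_sum f S = nc_moment f m \<and>
      (\<forall>k s. (\<forall>x\<in>S. s < x) \<longrightarrow> marked_sum f k s (insert s S) = marked_mom f k m)" for m
  proof (induction m rule: less_induct)
    case (less m)
    show ?case
    proof (intro allI impI, elim conjE)
      fix S :: "nat set" assume S: "finite S" "card S = m"
      have nc: "nc_sum f S = nc_moment f m"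
      proof (cases "S = {}")
        case True
        have "nc_parts {} = {{}}" by (auto simp: nc_parts_def noncrossing_def partition_on_def)
        then show ?thesis using True S by (simp add: nc_sum_def)
      next
        case False
        define s where "s = Min S"
        define R where "R = S - {s}"
        have s: "s \<in> S" "\<And>x. x \<in> R \<Longrightarrow> s < x" "S = insert s R"
          unfolding s_def R_def using Min_in[OF S(1) False] Min_le[OF S(1)]
          by (auto simp: order.not_eq_order_implies_strict)
        have R: "finite R" "Suc (card R) = m" using S card_Suc_Diff1[OF S(1) s(1)] unfolding R_def by auto
        have "nc_sum f S = marked_sum f 0 s (insert s R)"
          unfolding s(3)[symmetric] by (rule nc_sum_marked)
        also have "\<dots> = marked_mom f 0 (card R)" using less[of "card R"] R s(2) by auto
        finally show ?thesis using R by (simp only: marked_mom_0)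
      qed
      have "marked_sum f k s (insert s S) = marked_mom f k m" if s: "\<forall>x\<in>S. s < x" for k s
      proof -
        have "nc_sum f {x \<in> S. x < t} * marked_sum f (Suc k) t {x \<in> S. t \<le> x} =
            nc_moment f (card {x \<in> S. x < t}) * marked_mom f (Suc k) (m - 1 - card {x \<in> S. x < t})"
          if t: "t \<in> S" for t
        proof -
          let ?L = "{x \<in> S. x < t}" and ?R = "{x \<in> S. t < x}"
          have "S = ?L \<union> insert t ?R" using t by auto
          then have "card S = card ?L + card (insert t ?R)"
            using S by (subst \<open>S = _\<close>, subst card_Un_disjoint) auto
          then have c: "card ?L < m" "card ?R = m - 1 - card ?L" "card ?R < m" using S by auto
          have "{x \<in> S. t \<le> x} = insert t ?R" using t by auto
          moreover have "nc_sum f ?L = nc_moment f (card ?L)" using less[OF c(1)] S by auto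
          moreover have "marked_sum f (Suc k) t (insert t ?R) = marked_mom f (Suc k) (card ?R)"
            using less[OF c(3)] S by auto
          ultimately show ?thesis using c by simp
        qed
        then have "marked_sum f k s (insert s S) = f (Suc k) * nc_moment f m +
            (\<Sum>t\<in>S. nc_moment f (card {x \<in> S. x < t}) * marked_mom f (Suc k) (m - 1 - card {x \<in> S. x < t}))"
          using marked_sum_insert[OF S(1), of s f k] s nc by simp
        also have "\<dots> = marked_mom f k m"
          using sum_rank[OF S(1), of "\<lambda>i. nc_moment f i * marked_mom f (Suc k) (m - 1 - i)"] S(2)
          by (simp add: marked_mom_rec[of f k m])
        finally show ?thesis .
      qed
      with nc show "nc_sum f S = nc_moment f m \<and>
          (\<forall>k s. (\<forall>x\<in>S. s < x) \<longrightarrow> marked_sum f k s (insert s S) = marked_mom f k m)" by blast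
    qed
  qed
  then show ?thesis using assms by blast
qed

text \<open>Moments determine cumulants through a triangular system whose diagonal term is the
  one-block partition. Both \<open>\<kappa>\<close> and \<open>free_cumulant\<close> solve it for
  the moments of \<open>Y\<close>.\<close>

lemma free_cumulant_replicate:
  fixes \<tau> :: "'a::monoid_mult \<Rightarrow> complex"
  assumes "\<And>m. \<tau> (Y ^ m) = nc_moment \<kappa> m" and "n \<ge> 1"
  shows "free_cumulant \<tau> (replicate n Y) = \<kappa> n"
  using assms(2)
proof (induction n rule: less_induct)
  case (less n)
  let ?NC = "noncrossing_partitions n" and ?one = "{{..<n}} :: nat set set"
  have "(\<Prod>B\<in>\<pi>. free_cumulant \<tau> (nths (replicate n Y) B)) = (\<Prod>B\<in>\<pi>. \<kappa> (card B))"
    if \<pi>: "\<pi> \<in> ?NC - {?one}" for \<pi>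
  proof (intro prod.cong refl)
    fix B assume B: "B \<in> \<pi>"
    then have sub: "B \<subseteq> {..<n}" "B \<noteq> {}"
      using \<pi> by (auto simp: noncrossing_partitions_def partition_on_def)
    then have "{i. i < n \<and> i \<in> B} = B" by auto
    then have len: "length (nths (replicate n Y) B) = card B" by (simp add: length_nths)
    then have eq: "nths (replicate n Y) B = replicate (card B) Y"
      by (intro replicate_eqI) (use set_nths_subset in fastforce)+
    have "card B < n"
      using length_nths_noncrossing[of \<pi> "replicate n Y" B] \<pi> B len by simp
    moreover have "card B \<ge> 1"
      using sub finite_subset[OF sub(1)] by (simp add: Suc_le_eq card_gt_0_iff)
    ultimately show "free_cumulant \<tau> (nths (replicate n Y) B) = \<kappa> (card B)"
      unfolding eq using less.IH by blast
  qed
  then have "(\<Sum>\<pi>\<in>?NC - {?one}. \<Prod>B\<in>\<pi>. free_cumulant \<tau> (nths (replicate n Y) B)) =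
      (\<Sum>\<pi>\<in>?NC - {?one}. \<Prod>B\<in>\<pi>. \<kappa> (card B))" by (rule sum.cong[OF refl])
  moreover have "{..<n} \<noteq> {}" using less.prems by (simp add: lessThan_empty_iff)
  then have "?one \<in> ?NC" by (auto simp: noncrossing_partitions_def partition_on_def)
  then have "nc_moment \<kappa> n = \<kappa> n + (\<Sum>\<pi>\<in>?NC - {?one}. \<Prod>B\<in>\<pi>. \<kappa> (card B))"
    using nc_sum_eq_mom[of "{..<n}" \<kappa>]
    by (simp add: nc_sum_def noncrossing_partitions_eq[symmetric]
        sum.remove[OF finite_noncrossing_partitions, of ?one])
  ultimately show ?case
    by (subst free_cumulant.simps) (simp add: assms(1) prod_list_replicate)
qed

section \<open>Traces of powers of the order matrix\<close>

definition order_weight :: "complex \<Rightarrow> complex \<Rightarrow> nat \<Rightarrow> nat \<Rightarrow> complex" where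
  "order_weight \<alpha> \<beta> k l = (if k < l then \<alpha> else if l < k then \<beta> else 0)"

text \<open>Powers of a Toeplitz matrix need not be Toeplitz. Here a step down a diagonal that
  leaves the last column reenters in the first one with factor \<open>\<beta>\<close> /
  \<open>\<alpha>\<close>, as in a twisted circulant, and this passes to powers. The second clause
  states the twist without division.\<close>

lemma mpow_order_weight_toeplitz:
  fixes \<alpha> \<beta> :: complex
  defines "A \<equiv> order_weight \<alpha> \<beta>"
  shows "(\<forall>a\<in>{1..m}. \<forall>b\<in>{1..m}. mpow (Suc m) A k (Suc a) (Suc b) = mpow (Suc m) A k a b) \<and>
    (\<forall>a\<in>{1..m}. \<alpha> * mpow (Suc m) A k (Suc a) 1 = \<beta> * mpow (Suc m) A k a (Suc m))"
proof (induction k)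
  case (Suc k)
  let ?P = "mpow (Suc m) A k"
  have first: "(\<Sum>c\<in>{1..Suc m}. g c) = g 1 + (\<Sum>c\<in>{1..m}. g (Suc c))" for g :: "nat \<Rightarrow> complex"
    using sum.atLeast_Suc_atMost[of 1 "Suc m" g] sum.shift_bounds_cl_Suc_ivl[of g 1 m]
    by (simp del: sum.cl_ivl_Suc)
  have last: "(\<Sum>c\<in>{1..Suc m}. g c) = (\<Sum>c\<in>{1..m}. g c) + g (Suc m)" for g :: "nat \<Rightarrow> complex"
    by simp
  have "mpow (Suc m) A (Suc k) (Suc a) (Suc b) = mpow (Suc m) A (Suc k) a b"
    if ab: "a \<in> {1..m}" "b \<in> {1..m}" for a b
  proof -
    have "mpow (Suc m) A (Suc k) (Suc a) (Suc b) =
        ?P (Suc a) 1 * \<alpha> + (\<Sum>c\<in>{1..m}. ?P (Suc a) (Suc c) * A (Suc c) (Suc b))"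
      unfolding mpow.simps mat_mul_def first using ab by (simp add: A_def order_weight_def)
    \<comment> \<open>The terms peeled off at opposite ends of the two sums are exactly those
      exchanged by the twist; the others match index by index.\<close>
    also have "?P (Suc a) 1 * \<alpha> = ?P a (Suc m) * \<beta>" using Suc ab by (simp add: mult.commute)
    also have "(\<Sum>c\<in>{1..m}. ?P (Suc a) (Suc c) * A (Suc c) (Suc b)) = (\<Sum>c\<in>{1..m}. ?P a c * A c b)"
    proof (intro sum.cong refl)
      fix c assume c: "c \<in> {1..m}"
      have "A (Suc c) (Suc b) = A c b" by (simp add: A_def order_weight_def)
      moreover have "?P (Suc a) (Suc c) = ?P a c" using Suc ab c by blast
      ultimately show "?P (Suc a) (Suc c) * A (Suc c) (Suc b) = ?P a c * A c b" by (simp only:)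
    qed
    also have "?P a (Suc m) * \<beta> + (\<Sum>c\<in>{1..m}. ?P a c * A c b) = mpow (Suc m) A (Suc k) a b"
      unfolding mpow.simps mat_mul_def last using ab by (simp add: A_def order_weight_def)
    finally show ?thesis .
  qed
  moreover have "\<alpha> * mpow (Suc m) A (Suc k) (Suc a) 1 = \<beta> * mpow (Suc m) A (Suc k) a (Suc m)"
    if a: "a \<in> {1..m}" for a
  proof -
    have "mpow (Suc m) A (Suc k) (Suc a) 1 = (\<Sum>c\<in>{1..m}. ?P (Suc a) (Suc c) * \<beta>)"
      unfolding mpow.simps mat_mul_def first by (simp add: A_def order_weight_def)
    also have "\<dots> = (\<Sum>c\<in>{1..m}. ?P a c) * \<beta>"
      unfolding sum_distrib_right using Suc a by (intro sum.cong refl arg_cong[of _ _ "\<lambda>x. x * \<beta>"]) blast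
    finally have 1: "mpow (Suc m) A (Suc k) (Suc a) 1 = (\<Sum>c\<in>{1..m}. ?P a c) * \<beta>" .
    have 2: "mpow (Suc m) A (Suc k) a (Suc m) = (\<Sum>c\<in>{1..m}. ?P a c) * \<alpha>"
      unfolding mpow.simps mat_mul_def last sum_distrib_right by (simp add: A_def order_weight_def)
    show ?thesis unfolding 1 2 by (simp only: mult_ac)
  qed
  ultimately show ?case by blast
qed auto

text \<open>Hence the trace is \<open>n\<close> times the first diagonal entry, and one entry of the
  resolvent suffices.\<close>

lemma mpow_order_weight_diag:
  assumes "a \<in> {1..n}"
  shows "mpow n (order_weight \<alpha> \<beta>) k a a = mpow n (order_weight \<alpha> \<beta>) k 1 1"
proof -
  obtain m where n: "n = Suc m" using assms by (cases n) auto
  have "1 \<le> a \<Longrightarrow> a \<le> n \<longrightarrow> mpow n (order_weight \<alpha> \<beta>) k a a = mpow n (order_weight \<alpha> \<beta>) k 1 1"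
  proof (induction a rule: dec_induct)
    case (step a)
    then show ?case using mpow_order_weight_toeplitz[of m \<alpha> \<beta> k] n by auto
  qed simp
  then show ?thesis using assms by auto
qed

text \<open>Pure ring algebra, detached so that it is checked on variables instead of power series:
  \<open>V\<close> stands for the first resolvent entry, \<open>X\<close> and \<open>Y\<close> for
  \<open>x ^ m\<close> and \<open>y ^ m\<close>.\<close>

lemma resolvent_identity:
  fixes V p q z X Y :: "'a::comm_ring_1"
  assumes "(p - q) * (V - 1) * Y = q * (V * (1 + p * z) - 1) * (X - Y)"
  shows "(V - 1) * (p * ((1 + q * z) * Y) - q * ((1 + p * z) * X)) = z * (p * q * (X - Y))"
proof -
  have "(V - 1) * (p * ((1 + q * z) * Y) - q * ((1 + p * z) * X)) - z * (p * q * (X - Y)) =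
      (p - q) * (V - 1) * Y - q * (V * (1 + p * z) - 1) * (X - Y)" by (simp add: algebra_simps)
  then show ?thesis using assms by simp
qed

text \<open>The first row v of the resolvent satisfies v (1 - z A) = e_1. Differences of
  neighbouring columns turn this into a two-term recurrence with ratio x / y, and the first column
  closes the system with a geometric sum. Here \<open>u\<close> is the first entry of v without its
  constant term, divided by z.\<close>

lemma resolvent_first_entry:
  fixes \<alpha> \<beta> :: complex
  assumes n: "n = Suc m"
  defines "x \<equiv> 1 + fps_const \<alpha> * fps_X" and "y \<equiv> 1 + fps_const \<beta> * fps_X"
  defines "u \<equiv> Abs_fps (\<lambda>k. mpow n (order_weight \<alpha> \<beta>) (Suc k) 1 1)"
  shows "u * (fps_const \<alpha> * y ^ n - fps_const \<beta> * x ^ n) = fps_const (\<alpha> * \<beta>) * (x ^ m - y ^ m)"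
proof -
  define A where "A = order_weight \<alpha> \<beta>"
  define v where "v b = Abs_fps (\<lambda>k. mpow n A k 1 b)" for b
  \<comment> \<open>Two neighbouring columns of \<open>A\<close> differ only in the rows
    \<open>b\<close> and \<open>Suc b\<close>.\<close>
  have step: "v (Suc b) * y = v b * x - of_bool (b = 1)" if b: "b \<in> {1..m}" for b
  proof (rule fps_ext)
    fix k
    have xv: "v b * x = v b + fps_X * (fps_const \<alpha> * v b)" by (simp add: x_def algebra_simps)
    have yv: "v (Suc b) * y = v (Suc b) + fps_X * (fps_const \<beta> * v (Suc b))"
      by (simp add: y_def algebra_simps)
    show "fps_nth (v (Suc b) * y) k = fps_nth (v b * x - of_bool (b = 1)) k"
    proof (cases k)
      case 0
      then show ?thesis using b by (simp add: v_def x_def y_def distrib_left)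
    next
      case (Suc j)
      have "mpow n A k 1 (Suc b) - mpow n A k 1 b =
          (\<Sum>c\<in>{1..n}. mpow n A j 1 c * (A c (Suc b) - A c b))"
        unfolding Suc mpow.simps mat_mul_def sum_subtractf[symmetric] by (simp only: right_diff_distrib)
      also have "\<dots> = (\<Sum>c\<in>{1..n}. (if c = b then mpow n A j 1 b * \<alpha> else 0) +
          (if c = Suc b then - (mpow n A j 1 (Suc b) * \<beta>) else 0))"
        by (intro sum.cong refl) (auto simp: A_def order_weight_def)
      also have "\<dots> = mpow n A j 1 b * \<alpha> - mpow n A j 1 (Suc b) * \<beta>"
        using b n by (simp add: sum.distrib sum.delta)
      finally have "mpow n A k 1 (Suc b) + \<beta> * mpow n A j 1 (Suc b) = mpow n A k 1 b + \<alpha> * mpow n A j 1 b"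
        by (simp add: algebra_simps del: mpow.simps)
      then show ?thesis
        unfolding Suc xv yv by (simp add: v_def of_bool_def del: mpow.simps)
    qed
  qed
  \<comment> \<open>First column of v (1 - z A) = e_1: below the diagonal every entry of
    \<open>A\<close> is \<open>\<beta>\<close>. The index \<open>j + 2\<close> runs from 2 to
    \<open>n\<close>.\<close>
  have v1: "v 1 - 1 = fps_X * fps_const \<beta> * (\<Sum>j<m. v (j + 2))"
  proof (rule fps_ext)
    fix k
    show "fps_nth (v 1 - 1) k = fps_nth (fps_X * fps_const \<beta> * (\<Sum>j<m. v (j + 2))) k"
    proof (cases k)
      case (Suc j)
      have "mpow n A (Suc j) 1 1 = (\<Sum>c\<in>{1..m}. mpow n A j 1 (Suc c) * \<beta>)"
        unfolding n mpow.simps mat_mul_def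
        by (subst sum.atLeast_Suc_atMost) (auto simp: sum.shift_bounds_cl_Suc_ivl A_def order_weight_def
          simp del: mpow.simps sum.cl_ivl_Suc)
      also have "\<dots> = (\<Sum>i<m. mpow n A j 1 (i + 2) * \<beta>)"
        by (rule sum.reindex_bij_witness[of _ Suc "\<lambda>c. c - 1"]) auto
      finally show ?thesis
        unfolding Suc by (simp add: v_def mult.assoc fps_sum_nth sum_distrib_left mult.commute del: mpow.simps)
    qed (simp add: v_def mult.assoc)
  qed
  have geo: "v (j + 2) * y ^ Suc j = (v 1 * x - 1) * x ^ j" if "j < m" for j
    using that
  proof (induction j)
    case 0
    then show ?case using step[of 1] by simp
  next
    case (Suc j)
    have "v (Suc j + 2) * y ^ Suc (Suc j) = (v (Suc (j + 2)) * y) * y ^ Suc j" by (simp add: mult_ac)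
    also have "v (Suc (j + 2)) * y = v (j + 2) * x" using step[of "j + 2"] Suc.prems by simp
    also have "v (j + 2) * x * y ^ Suc j = (v (j + 2) * y ^ Suc j) * x" by (simp add: mult_ac)
    also have "\<dots> = (v 1 * x - 1) * x ^ Suc j" using Suc by (simp add: mult_ac)
    finally show ?case .
  qed
  have xy: "x - y = fps_X * (fps_const \<alpha> - fps_const \<beta>)" by (simp add: x_def y_def algebra_simps)
  have "(\<Sum>j<m. v (j + 2)) * y ^ m = (\<Sum>j<m. (v 1 * x - 1) * (y ^ (m - Suc j) * x ^ j))"
    unfolding sum_distrib_right
  proof (intro sum.cong refl)
    fix j assume "j \<in> {..<m}"
    then have "m = Suc j + (m - Suc j)" by simp
    then have "y ^ m = y ^ Suc j * y ^ (m - Suc j)" by (metis power_add)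
    then show "v (j + 2) * y ^ m = (v 1 * x - 1) * (y ^ (m - Suc j) * x ^ j)"
      using geo[of j] \<open>j \<in> {..<m}\<close> by (simp add: mult_ac del: power_Suc)
  qed
  then have "(\<Sum>j<m. v (j + 2)) * y ^ m = (v 1 * x - 1) * (\<Sum>j<m. y ^ (m - Suc j) * x ^ j)"
    by (simp only: sum_distrib_left)
  \<comment> \<open>The factor \<open>x - y\<close> sums the geometric series, and the
    \<open>fps_X\<close> contained in it recombines with the sum over \<open>v\<close> to
    \<open>v 1 - 1\<close>.\<close>
  then have "(x - y) * ((\<Sum>j<m. v (j + 2)) * y ^ m) = (v 1 * x - 1) * (x ^ m - y ^ m)"
    unfolding power_diff_sumr2 by (simp only: mult_ac)
  then have "(fps_const \<alpha> - fps_const \<beta>) * (v 1 - 1) * y ^ m =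
      fps_const \<beta> * (v 1 * x - 1) * (x ^ m - y ^ m)"
    unfolding v1 xy by (simp add: mult_ac)
  then have "(v 1 - 1) * (fps_const \<alpha> * y ^ n - fps_const \<beta> * x ^ n) =
      fps_X * (fps_const \<alpha> * fps_const \<beta> * (x ^ m - y ^ m))"
    unfolding n power_Suc x_def y_def by (rule resolvent_identity)
  moreover have "v 1 - 1 = fps_X * u"
  proof (rule fps_ext)
    show "fps_nth (v 1 - 1) k = fps_nth (fps_X * u) k" for k
      by (cases k) (simp_all add: v_def u_def A_def del: mpow.simps(2))
  qed
  ultimately show ?thesis by (simp add: mult.assoc)
qed

section \<open>The limit of the scaled traces\<close>

lemma fps_nth_linear_power:
  "fps_nth ((1 + fps_const c * fps_X) ^ n) k = of_nat (n choose k) * (c :: complex) ^ k"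
proof (induction n arbitrary: k)
  case (Suc n)
  have "(1 + fps_const c * fps_X) ^ Suc n =
      (1 + fps_const c * fps_X) ^ n + fps_X * (fps_const c * (1 + fps_const c * fps_X) ^ n)"
    by (simp add: algebra_simps)
  then show ?case using Suc by (cases k) (simp_all add: algebra_simps)
qed (simp add: binomial_eq_0_iff)

text \<open>The limit of the formula in \<open>resolvent_first_entry\<close> when z is replaced by z
  / n, so that the powers of \<open>x\<close> and \<open>y\<close> tend to exponential
  series.\<close>

definition cumulant_fps :: "complex \<Rightarrow> complex \<Rightarrow> complex fps" where
  "cumulant_fps \<alpha> \<beta> = fps_const (\<alpha> * \<beta>) * (fps_exp \<alpha> - fps_exp \<beta>) /
     (fps_const \<alpha> * fps_exp \<beta> - fps_const \<beta> * fps_exp \<alpha>)"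

text \<open>The coefficientwise form of the convergence of (1 + z/n)^n to exp z.\<close>

lemma tendsto_binomial_over_power: "(\<lambda>n. complex_of_nat (n choose k) / of_nat n ^ k) \<longlonglongrightarrow> 1 / fact k"
proof (induction k)
  case (Suc k)
  have "(\<lambda>n. complex_of_nat (n choose k) / of_nat n ^ k * (1 - of_nat k / of_nat n) / of_nat (Suc k))
      \<longlonglongrightarrow> 1 / fact k * (1 - 0) / of_nat (Suc k)"
    by (intro tendsto_divide[OF tendsto_mult[OF Suc tendsto_diff[OF tendsto_const lim_const_over_n]]
      tendsto_const]) (simp del: of_nat_Suc)
  moreover have "\<forall>\<^sub>F n in sequentially.
      complex_of_nat (n choose k) / of_nat n ^ k * (1 - of_nat k / of_nat n) / of_nat (Suc k) =
      of_nat (n choose Suc k) / of_nat n ^ Suc k"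
    using eventually_gt_at_top[of k]
  proof eventually_elim
    case (elim n)
    have "Suc k * (n choose Suc k) = (n - k) * (n choose k)"
      using binomial_absorption[of k n] binomial_absorb_comp[of n k] by simp
    then have "of_nat (Suc k) * complex_of_nat (n choose Suc k) = of_nat (n - k) * of_nat (n choose k)"
      by (metis of_nat_mult)
    then have "complex_of_nat (n choose Suc k) = (of_nat n - of_nat k) * of_nat (n choose k) / of_nat (Suc k)"
      using elim by (simp add: field_simps of_nat_diff del: of_nat_Suc)
    then show ?case
      using elim by (simp only:) (simp add: field_simps del: of_nat_Suc)
  qed
  ultimately show ?case by (auto intro: Lim_transform_eventually simp: mult.commute)
qed simp

definition scaled_trace :: "complex \<Rightarrow> complex \<Rightarrow> nat \<Rightarrow> nat \<Rightarrow> complex" where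
  "scaled_trace \<alpha> \<beta> n k = mtrace n (mpow n (order_weight \<alpha> \<beta>) k) / of_nat n ^ k"

text \<open>Coefficient \<open>k\<close> of \<open>resolvent_first_entry\<close>, divided by
  \<open>n ^ k\<close>. One factor \<open>n\<close> of the trace cancels, so
  \<open>scaled_trace\<close> at \<open>Suc i\<close> is the first entry divided by
  \<open>n ^ i\<close>, and the powers of \<open>n\<close> balance in the convolution.\<close>

lemma scaled_trace_conv:
  assumes "n \<ge> 1"
  shows "(\<Sum>i\<le>k. scaled_trace \<alpha> \<beta> n (Suc i) *
      ((\<alpha> * \<beta> ^ (k - i) - \<beta> * \<alpha> ^ (k - i)) * (of_nat (n choose (k - i)) / of_nat n ^ (k - i)))) =
    \<alpha> * \<beta> * (\<alpha> ^ k - \<beta> ^ k) * (of_nat ((n - 1) choose k) / of_nat n ^ k)"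
proof -
  obtain m where n: "n = Suc m" using assms by (cases n) auto
  let ?d = "\<lambda>k. mpow n (order_weight \<alpha> \<beta>) (Suc k) 1 1"
  have tr: "scaled_trace \<alpha> \<beta> n (Suc i) = ?d i / of_nat n ^ i" for i
  proof -
    have "mtrace n (mpow n (order_weight \<alpha> \<beta>) (Suc i)) = (\<Sum>a\<in>{1..n}. ?d i)"
      unfolding mtrace_def by (intro sum.cong refl mpow_order_weight_diag)
    also have "\<dots> = of_nat n * ?d i" by simp
    finally show ?thesis using assms by (simp add: scaled_trace_def del: mpow.simps)
  qed
  have "(\<Sum>i\<le>k. scaled_trace \<alpha> \<beta> n (Suc i) *
      ((\<alpha> * \<beta> ^ (k - i) - \<beta> * \<alpha> ^ (k - i)) * (of_nat (n choose (k - i)) / of_nat n ^ (k - i)))) =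
      (\<Sum>i\<le>k. ?d i * (\<alpha> * (of_nat (n choose (k - i)) * \<beta> ^ (k - i)) -
        \<beta> * (of_nat (n choose (k - i)) * \<alpha> ^ (k - i)))) / of_nat n ^ k"
    unfolding sum_divide_distrib tr
  proof (intro sum.cong refl)
    fix i assume "i \<in> {..k}"
    then have "of_nat n ^ k = (of_nat n ^ i * of_nat n ^ (k - i) :: complex)"
      by (simp add: power_add[symmetric])
    then show "?d i / of_nat n ^ i *
        ((\<alpha> * \<beta> ^ (k - i) - \<beta> * \<alpha> ^ (k - i)) * (of_nat (n choose (k - i)) / of_nat n ^ (k - i))) =
        ?d i * (\<alpha> * (of_nat (n choose (k - i)) * \<beta> ^ (k - i)) -
        \<beta> * (of_nat (n choose (k - i)) * \<alpha> ^ (k - i))) / of_nat n ^ k"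
      by (simp only: times_divide_eq_left times_divide_eq_right divide_divide_eq_left)
         (simp add: algebra_simps del: mpow.simps)
  qed
  also have "(\<Sum>i\<le>k. ?d i * (\<alpha> * (of_nat (n choose (k - i)) * \<beta> ^ (k - i)) -
        \<beta> * (of_nat (n choose (k - i)) * \<alpha> ^ (k - i)))) =
      \<alpha> * \<beta> * (of_nat (m choose k) * \<alpha> ^ k - of_nat (m choose k) * \<beta> ^ k)"
    using arg_cong[OF resolvent_first_entry[OF n, of \<alpha> \<beta>], of "\<lambda>f. fps_nth f k"]
    by (simp add: fps_mult_nth[of "Abs_fps _"] fps_nth_linear_power atLeast0AtMost
        del: mpow.simps power_Suc fps_const_mult)
  also have "\<alpha> * \<beta> * (of_nat (m choose k) * \<alpha> ^ k - of_nat (m choose k) * \<beta> ^ k) / of_nat n ^ k =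
      \<alpha> * \<beta> * (\<alpha> ^ k - \<beta> ^ k) * (of_nat ((n - 1) choose k) / of_nat n ^ k)"
    by (simp add: n algebra_simps diff_divide_distrib)
  finally show ?thesis .
qed

text \<open>The convolution determines its top coefficient from the lower ones, the divisor being
  the constant term \<open>\<alpha> - \<beta>\<close>. So convergence is proved one coefficient at a
  time.\<close>

lemma tendsto_scaled_trace:
  assumes "\<alpha> \<noteq> \<beta>"
  shows "(\<lambda>n. scaled_trace \<alpha> \<beta> n (Suc k)) \<longlonglongrightarrow> fps_nth (cumulant_fps \<alpha> \<beta>) k"
proof (induction k rule: less_induct)
  case (less k)
  let ?R = "cumulant_fps \<alpha> \<beta>"
  define e where "e n j = (\<alpha> * \<beta> ^ j - \<beta> * \<alpha> ^ j) * (of_nat (n choose j) / of_nat n ^ j)" for n j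
  define r where "r n = \<alpha> * \<beta> * (\<alpha> ^ k - \<beta> ^ k) * (complex_of_nat ((n - 1) choose k) / of_nat n ^ k)" for n
  define D where "D = fps_const \<alpha> * fps_exp \<beta> - fps_const \<beta> * fps_exp \<alpha>"
  have D0: "fps_nth D 0 = \<alpha> - \<beta>" by (simp add: D_def)
  have RD: "?R * D = fps_const (\<alpha> * \<beta>) * (fps_exp \<alpha> - fps_exp \<beta>)"
    using assms D0 unfolding cumulant_fps_def D_def[symmetric]
    by (simp add: fps_divide_unit mult.assoc inverse_mult_eq_1)
  have e: "(\<lambda>n. e n j) \<longlonglongrightarrow> fps_nth D j" for j
  proof -
    have "(\<lambda>n. e n j) \<longlonglongrightarrow> (\<alpha> * \<beta> ^ j - \<beta> * \<alpha> ^ j) * (1 / fact j)"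
      unfolding e_def by (intro tendsto_intros tendsto_binomial_over_power)
    then show ?thesis by (simp add: D_def field_simps)
  qed
  \<comment> \<open>Passing from \<open>n - 1\<close> to \<open>n\<close> in the binomial
    coefficient costs the factor 1 - k / n, which tends to 1.\<close>
  have r: "r \<longlonglongrightarrow> fps_nth (?R * D) k"
  proof -
    have "(\<lambda>n. \<alpha> * \<beta> * (\<alpha> ^ k - \<beta> ^ k) * (complex_of_nat (n choose k) / of_nat n ^ k * (1 - of_nat k / of_nat n)))
        \<longlonglongrightarrow> \<alpha> * \<beta> * (\<alpha> ^ k - \<beta> ^ k) * (1 / fact k * (1 - 0))"
      by (intro tendsto_mult[OF tendsto_const] tendsto_mult[OF tendsto_binomial_over_power
        tendsto_diff[OF tendsto_const lim_const_over_n]])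
    moreover have "\<forall>\<^sub>F n in sequentially.
      \<alpha> * \<beta> * (\<alpha> ^ k - \<beta> ^ k) * (complex_of_nat (n choose k) / of_nat n ^ k * (1 - of_nat k / of_nat n)) = r n"
      using eventually_gt_at_top[of k]
    proof eventually_elim
      case (elim n)
      have "complex_of_nat (n - k) * of_nat (n choose k) = of_nat n * of_nat ((n - 1) choose k)"
        by (metis of_nat_mult binomial_absorb_comp)
      then have "of_nat n * complex_of_nat ((n - 1) choose k) = (of_nat n - of_nat k) * of_nat (n choose k)"
        using elim by (simp add: of_nat_diff)
      then have "complex_of_nat ((n - 1) choose k) = of_nat (n choose k) * (1 - of_nat k / of_nat n)"
        using elim by (simp add: field_simps)
      then show ?case by (simp add: r_def)
    qed
    ultimately have "r \<longlonglongrightarrow> \<alpha> * \<beta> * (\<alpha> ^ k - \<beta> ^ k) * (1 / fact k * (1 - 0))"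
      by (rule Lim_transform_eventually)
    then show ?thesis unfolding RD by (simp add: field_simps)
  qed
  have conv: "scaled_trace \<alpha> \<beta> n (Suc k) =
      (r n - (\<Sum>i<k. scaled_trace \<alpha> \<beta> n (Suc i) * e n (k - i))) / (\<alpha> - \<beta>)" if "n \<ge> 1" for n
    using scaled_trace_conv[OF that, of \<alpha> \<beta> k] assms
    by (simp add: e_def r_def lessThan_Suc_atMost[symmetric] field_simps)
  have "(\<lambda>n. (r n - (\<Sum>i<k. scaled_trace \<alpha> \<beta> n (Suc i) * e n (k - i))) / (\<alpha> - \<beta>))
      \<longlonglongrightarrow> (fps_nth (?R * D) k - (\<Sum>i<k. fps_nth ?R i * fps_nth D (k - i))) / (\<alpha> - \<beta>)"
    using assms by (intro tendsto_intros r e less) auto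
  also have "(fps_nth (?R * D) k - (\<Sum>i<k. fps_nth ?R i * fps_nth D (k - i))) / (\<alpha> - \<beta>) = fps_nth ?R k"
    using assms by (simp add: fps_mult_nth atLeast0AtMost lessThan_Suc_atMost[symmetric] D0)
  finally show ?case
    by (rule Lim_transform_eventually)
       (use eventually_ge_at_top[of 1] in eventually_elim, simp add: conv)
qed

text \<open>The entries of the \<open>k\<close>-th power are at most \<open>n ^ (k - 1)\<close>. The
  bound survives in the limit cumulants and is the source of the exponential bound on the
  moments.\<close>

lemma norm_scaled_trace_le:
  assumes "cmod \<alpha> \<le> 1" "cmod \<beta> \<le> 1" "k \<ge> 1"
  shows "cmod (scaled_trace \<alpha> \<beta> n k) \<le> 1"
proof -
  have A: "cmod (order_weight \<alpha> \<beta> a b) \<le> 1" for a b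
    using assms by (simp add: order_weight_def)
  have entry: "cmod (mpow n (order_weight \<alpha> \<beta>) (Suc j) a b) \<le> real n ^ j" if "a \<in> {1..n}" for a b j
  proof (induction j arbitrary: b)
    case 0
    then show ?case using mpow_1[OF that] A by simp
  next
    case (Suc j)
    have "cmod (mpow n (order_weight \<alpha> \<beta>) (Suc (Suc j)) a b) \<le> (\<Sum>c\<in>{1..n}. real n ^ j * 1)"
      unfolding mpow.simps(2)[of _ _ "Suc j"] mat_mul_def
      by (rule sum_norm_le, unfold norm_mult, rule mult_mono[OF Suc A]) simp_all
    then show ?case by simp
  qed
  obtain j where k: "k = Suc j" using assms(3) by (cases k) auto
  have "cmod (mtrace n (mpow n (order_weight \<alpha> \<beta>) k)) \<le> (\<Sum>a\<in>{1..n}. real n ^ j)"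
    unfolding mtrace_def k by (rule sum_norm_le) (rule entry)
  then have "cmod (mtrace n (mpow n (order_weight \<alpha> \<beta>) k)) \<le> real n ^ k" by (simp add: k)
  then show ?thesis
    by (cases "n = 0") (simp_all add: scaled_trace_def norm_divide norm_mult norm_power k divide_le_eq_1)
qed

abbreviation "\<alpha>\<^sub>0 \<equiv> (1 + \<i>) / 2"
abbreviation "\<beta>\<^sub>0 \<equiv> (1 - \<i>) / 2"

text \<open>Both exponents share the summand z / 2, so exp(z/2) cancels and S / (C - S) remains,
  with S and C the sine and cosine of z / 2. Extending by C + S makes the denominator cos z.\<close>

lemma zigzag_has_fps_expansion:
  "(\<lambda>z. 1 / 2 * (tan z + 1 / cos z - 1)) has_fps_expansion cumulant_fps \<alpha>\<^sub>0 \<beta>\<^sub>0"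
proof -
  define g where "g z = \<alpha>\<^sub>0 * \<beta>\<^sub>0 * (exp (\<alpha>\<^sub>0 * z) - exp (\<beta>\<^sub>0 * z)) / (\<alpha>\<^sub>0 * exp (\<beta>\<^sub>0 * z) - \<beta>\<^sub>0 * exp (\<alpha>\<^sub>0 * z))" for z
  have "g has_fps_expansion cumulant_fps \<alpha>\<^sub>0 \<beta>\<^sub>0"
    unfolding g_def cumulant_fps_def by (intro fps_expansion_intros) (simp_all add: field_simps)
  moreover have "\<forall>\<^sub>F z in nhds 0. cos z \<noteq> (0 :: complex)"
    using tendsto_imp_eventually_ne[of cos "cos 0" "nhds (0 :: complex)" 0]
      isCont_cos[of "0 :: complex", unfolded isCont_def tendsto_at_iff_tendsto_nhds] by simp
  then have "\<forall>\<^sub>F z in nhds 0. g z = 1 / 2 * (tan z + 1 / cos z - 1)"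
  proof eventually_elim
    case (elim z)
    define S C where "S = sin (z / 2)" and "C = cos (z / 2)"
    have e1: "exp (\<alpha>\<^sub>0 * z) = exp (z / 2) * (C + \<i> * S)"
      by (simp add: C_def S_def exp_Euler[symmetric] exp_add[symmetric] field_simps)
    have e2: "exp (\<beta>\<^sub>0 * z) = exp (z / 2) * (C - \<i> * S)"
    proof -
      have "exp (\<beta>\<^sub>0 * z) = exp (z / 2) * exp (- (\<i> * (z / 2)))"
        by (simp add: exp_add[symmetric] field_simps)
      also have "exp (- (\<i> * (z / 2))) = C - \<i> * S"
        using exp_Euler[of "- (z / 2)"] by (simp add: C_def S_def)
      finally show ?thesis .
    qed
    have z: "z = 2 * (z / 2)" by simp
    have s: "sin z = 2 * S * C" unfolding S_def C_def by (subst z, rule sin_double)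
    have c: "cos z = C\<^sup>2 - S\<^sup>2" unfolding S_def C_def by (subst z, rule cos_double)
    have one: "S\<^sup>2 + C\<^sup>2 = 1" by (simp add: S_def C_def)
    have cS: "cos z = (C - S) * (C + S)" unfolding c by (simp add: algebra_simps power2_eq_square)
    have nz: "C - S \<noteq> 0" "C + S \<noteq> 0" using elim unfolding cS by auto
    have num: "\<alpha>\<^sub>0 * \<beta>\<^sub>0 * (exp (\<alpha>\<^sub>0 * z) - exp (\<beta>\<^sub>0 * z)) = (\<i> * exp (z / 2)) * S"
      unfolding e1 e2 by (simp add: field_simps)
    have den: "\<alpha>\<^sub>0 * exp (\<beta>\<^sub>0 * z) - \<beta>\<^sub>0 * exp (\<alpha>\<^sub>0 * z) = (\<i> * exp (z / 2)) * (C - S)"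
      unfolding e1 e2 by (simp add: field_simps)
    have "g z = S / (C - S)" unfolding g_def num den by simp
    also have "\<dots> = (S * (C + S)) / cos z" unfolding cS using nz by simp
    also have "S * (C + S) = (sin z + 1 - cos z) / 2"
      unfolding s c one[symmetric] by (simp add: field_simps power2_eq_square)
    also have "(sin z + 1 - cos z) / 2 / cos z = 1 / 2 * (tan z + 1 / cos z - 1)"
      using elim by (simp add: tan_def field_simps)
    finally show ?case .
  qed
  ultimately show ?thesis
    unfolding has_fps_expansion_def by (auto elim: eventually_elim2)
qed

section \<open>Jacobi operators and their commutants\<close>

lemma cinner_add_left: "cinner (x + y) z = cinner x z + cinner y z"
  for x y z :: "'h::chilbert_space"
  by (metis cinner_commute cinner_add_right complex_cnj_add)

lemma cinner_scaleC_left: "cinner (a *\<^sub>C x) y = cnj a * cinner x y"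
  for x y :: "'h::chilbert_space"
  by (metis cinner_commute cinner_scaleC_right complex_cnj_mult)

lemma cinner_zero_left: "cinner 0 x = 0" for x :: "'h::chilbert_space"
  by (metis cinner_commute cinner_zero_right complex_cnj_zero)

lemma cinner_sum_right: "cinner x (\<Sum>i\<in>I. f i) = (\<Sum>i\<in>I. cinner x (f i))"
  for x :: "'h::chilbert_space"
  by (induction I rule: infinite_finite_induct) (simp_all add: cinner_zero_right cinner_add_right)

lemma cinner_conv_inner: "cinner x y = of_real (inner x y) + \<i> * of_real (inner x ((- \<i>) *\<^sub>C y))"
  for x y :: "'h::chilbert_space"
  by (simp add: inner_eq_Re_cinner cinner_scaleC_right complex_eq_iff)

lemma tendsto_cinner_right:
  fixes x :: "'h::chilbert_space"
  assumes "(f \<longlongrightarrow> l) F"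
  shows "((\<lambda>n. cinner x (f n)) \<longlongrightarrow> cinner x l) F"
  unfolding cinner_conv_inner
  by (intro tendsto_intros assms bounded_linear.tendsto[OF bounded_linear_scaleC])

lemma cinner_ell2: "cinner f g = (\<Sum>n. cnj (ell2_nth f n) * ell2_nth g n)"
  by (simp add: cinner_ell2_def ell2_cinner.rep_eq)

lemma ell2_eqI: "(\<And>n. ell2_nth f n = ell2_nth g n) \<Longrightarrow> f = g"
  by (metis ell2_nth_inject ext)

lemma ell2_nth_simps [simp]:
  "ell2_nth 0 n = 0" "ell2_nth (f + g) n = ell2_nth f n + ell2_nth g n"
  "ell2_nth (f - g) n = ell2_nth f n - ell2_nth g n" "ell2_nth (c *\<^sub>C f) n = c * ell2_nth f n"
  by (simp_all add: zero_ell2.rep_eq plus_ell2.rep_eq minus_ell2.rep_eq scaleC_ell2.rep_eq)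

lemma ell2_nth_sum: "ell2_nth (\<Sum>i\<in>I. f i) n = (\<Sum>i\<in>I. ell2_nth (f i) n)"
  by (induction I rule: infinite_finite_induct) simp_all

lift_definition ket :: "nat \<Rightarrow> ell2" is "\<lambda>n k. if k = n then 1 else 0"
  by (rule summable_finite[of "{_}"]) auto

lemma nth_ket [simp]: "ell2_nth (ket n) k = (if k = n then 1 else 0)"
  by (simp add: ket.rep_eq)

lemma cinner_ket_left [simp]: "cinner (ket n) f = ell2_nth f n"
proof -
  have "(\<lambda>k. cnj (ell2_nth (ket n) k) * ell2_nth f k) = (\<lambda>k. if k = n then ell2_nth f n else 0)"
    by auto
  then show ?thesis unfolding cinner_ell2 using sums_single[of n "\<lambda>_. ell2_nth f n"] by (simp add: sums_iff)
qed

lemma cinner_ket_right [simp]: "cinner f (ket n) = cnj (ell2_nth f n)"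
  by (subst cinner_commute) simp

lemma ell2_expansion: "(\<lambda>N. \<Sum>n<N. ell2_nth f n *\<^sub>C ket n) \<longlonglongrightarrow> f"
proof -
  let ?t = "\<lambda>N. \<Sum>n<N. ell2_nth f n *\<^sub>C ket n"
  have nth: "ell2_nth (f - ?t N) k = (if k < N then 0 else ell2_nth f k)" for N k
    by (simp add: ell2_nth_sum if_distrib[of "\<lambda>x. _ * x"] sum.delta cong: if_cong)
  have "(norm (f - ?t N))\<^sup>2 = (norm f)\<^sup>2 - (\<Sum>n<N. (cmod (ell2_nth f n))\<^sup>2)" for N
  proof -
    have "(\<lambda>k. (cmod (ell2_nth f k))\<^sup>2) sums (norm f)\<^sup>2"
      unfolding ell2_norm_sq by (rule summable_sums[OF ell2_summable])
    moreover have "(\<lambda>k. if k \<in> {..<N} then (cmod (ell2_nth f k))\<^sup>2 else 0) sums (\<Sum>n<N. (cmod (ell2_nth f n))\<^sup>2)"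
      by (rule sums_If_finite_set) simp
    ultimately have "(\<lambda>k. (cmod (ell2_nth f k))\<^sup>2 - (if k \<in> {..<N} then (cmod (ell2_nth f k))\<^sup>2 else 0))
        sums ((norm f)\<^sup>2 - (\<Sum>n<N. (cmod (ell2_nth f n))\<^sup>2))" by (rule sums_diff)
    moreover have "(\<lambda>k. (cmod (ell2_nth f k))\<^sup>2 - (if k \<in> {..<N} then (cmod (ell2_nth f k))\<^sup>2 else 0)) =
        (\<lambda>k. (cmod (ell2_nth (f - ?t N) k))\<^sup>2)" unfolding nth by auto
    ultimately show ?thesis unfolding ell2_norm_sq by (simp add: sums_iff)
  qed
  moreover have "(\<lambda>N. (norm f)\<^sup>2 - (\<Sum>n<N. (cmod (ell2_nth f n))\<^sup>2)) \<longlonglongrightarrow> (norm f)\<^sup>2 - (norm f)\<^sup>2"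
    by (intro tendsto_intros) (simp add: ell2_norm_sq summable_LIMSEQ[OF ell2_summable])
  ultimately have "(\<lambda>N. (norm (f - ?t N))\<^sup>2) \<longlonglongrightarrow> 0" by simp
  then have "(\<lambda>N. sqrt ((norm (f - ?t N))\<^sup>2)) \<longlonglongrightarrow> sqrt 0" by (rule tendsto_real_sqrt)
  then have "(\<lambda>N. norm (?t N - f)) \<longlonglongrightarrow> 0" by (simp add: norm_minus_commute)
  then show ?thesis by (simp add: tendsto_norm_zero_iff LIM_zero_iff)
qed

lemma bop_bounded_linear: "bounded_linear (bop_apply T)"
  using bop_apply[of T] by simp

lemma bop_apply_simps [simp]:
  "bop_apply T (a *\<^sub>C x) = a *\<^sub>C bop_apply T x" "bop_apply T (x + y) = bop_apply T x + bop_apply T y"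
  "bop_apply T 0 = 0" "bop_apply (S * T) x = bop_apply S (bop_apply T x)"
  "bop_apply (S + T) x = bop_apply S x + bop_apply T x" "bop_apply (S - T) x = bop_apply S x - bop_apply T x"
  "bop_apply (a *\<^sub>C T) x = a *\<^sub>C bop_apply T x" "bop_apply 1 x = x" "bop_apply 0 x = 0"
  using bop_apply[of T] linear_add[OF bounded_linear.linear[OF bop_bounded_linear, of T]]
    linear_0[OF bounded_linear.linear[OF bop_bounded_linear, of T]]
  by (auto simp: times_bop.rep_eq plus_bop.rep_eq minus_bop.rep_eq scaleC_bop.rep_eq one_bop.rep_eq zero_bop.rep_eq)

lemma bop_apply_sum: "bop_apply T (\<Sum>i\<in>I. f i) = (\<Sum>i\<in>I. bop_apply T (f i))"
  by (induction I rule: infinite_finite_induct) simp_all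

lemma bop_eqI: "(\<And>x. bop_apply S x = bop_apply T x) \<Longrightarrow> S = T"
  by (metis bop_apply_inject ext)

lemma bop_apply_commute: "S * T = T * S \<Longrightarrow> bop_apply S (bop_apply T x) = bop_apply T (bop_apply S x)"
  by (simp only: bop_apply_simps(4)[symmetric])

lemma tendsto_bop_apply: "(f \<longlongrightarrow> l) F \<Longrightarrow> ((\<lambda>n. bop_apply T (f n)) \<longlongrightarrow> bop_apply T l) F"
  by (rule bounded_linear.tendsto[OF bop_bounded_linear])

lemma bop_eq_0_if_ket:
  fixes T :: "ell2 bop"
  assumes "\<And>n. bop_apply T (ket n) = 0"
  shows "T = 0"
proof (rule bop_eqI)
  fix f
  have "(\<lambda>N. bop_apply T (\<Sum>n<N. ell2_nth f n *\<^sub>C ket n)) \<longlonglongrightarrow> bop_apply T f"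
    by (intro tendsto_bop_apply ell2_expansion)
  then show "bop_apply T f = bop_apply 0 f"
    by (simp add: bop_apply_sum assms scaleC_zero_right LIMSEQ_const_iff)
qed

text \<open>The bound on partial sums serves twice: it makes the coordinates square-summable and the
  resulting map bounded.\<close>

lemma bop_from_coords:
  fixes g :: "ell2 \<Rightarrow> nat \<Rightarrow> complex"
  assumes add: "\<And>f f' n. g (f + f') n = g f n + g f' n"
    and scale: "\<And>c f n. g (c *\<^sub>C f) n = c * g f n"
    and bound: "\<And>f N. (\<Sum>n<N. (cmod (g f n))\<^sup>2) \<le> C * (norm f)\<^sup>2"
  shows "\<exists>T. \<forall>f n. ell2_nth (bop_apply T f) n = g f n"
proof -
  have sm: "summable (\<lambda>n. (cmod (g f n))\<^sup>2)" for f
    by (rule bounded_imp_summable[where B = "C * (norm f)\<^sup>2"])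
       (use bound[of f "Suc _"] in \<open>auto simp: lessThan_Suc_atMost\<close>)
  define h where "h f = Ell2 (g f)" for f
  have h: "ell2_nth (h f) n = g f n" for f n by (simp add: h_def Ell2_inverse sm)
  have hC: "h (c *\<^sub>C f) = c *\<^sub>C h f" for c f by (rule ell2_eqI) (simp add: h scale)
  have "bounded_linear h"
  proof (rule bounded_linear_intro[where K = "sqrt C"])
    show "h (f + f') = h f + h f'" for f f' by (rule ell2_eqI) (simp add: h add)
    show "h (r *\<^sub>R f) = r *\<^sub>R h f" for r f by (simp add: scaleR_scaleC hC)
    fix f
    have "(norm (h f))\<^sup>2 \<le> C * (norm f)\<^sup>2"
      unfolding ell2_norm_sq[of "h f"] h by (rule suminf_le_const[OF sm bound])
    then have "sqrt ((norm (h f))\<^sup>2) \<le> sqrt (C * (norm f)\<^sup>2)" by (rule real_sqrt_le_mono)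
    then show "norm (h f) \<le> norm f * sqrt C" by (simp add: real_sqrt_mult mult.commute)
  qed
  then have "bop_apply (Bop h) = h" by (intro Bop_inverse) (simp add: hC)
  then show ?thesis using h by (intro exI[of _ "Bop h"]) simp
qed

text \<open>The adjoint is written down by its coordinates, which leaves only boundedness to prove.
  The explicit coordinates are reused to show that Jacobi operators are self-adjoint.\<close>

lemma adjoint_exists:
  fixes T :: "ell2 bop"
  shows "\<exists>S. is_adjoint S T \<and> (\<forall>f n. ell2_nth (bop_apply S f) n = cinner (bop_apply T (ket n)) f)"
proof -
  define g where "g f n = cinner (bop_apply T (ket n)) f" for f n
  obtain K where K: "\<And>f. norm (bop_apply T f) \<le> norm f * K" "K \<ge> 0"
    using bounded_linear.nonneg_bounded[OF bop_bounded_linear] by blast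
  have "(\<Sum>n<N. (cmod (g f n))\<^sup>2) \<le> K\<^sup>2 * (norm f)\<^sup>2" for f N
  proof -
    define A where "A = (\<Sum>n<N. (cmod (g f n))\<^sup>2)"
    \<comment> \<open>Testing \<open>T\<close> on the truncation \<open>p\<close>, whose norm is the
      square root of \<open>A\<close>, gives \<open>A\<close> again; Cauchy-Schwarz then allows one
      factor sqrt A to be cancelled.\<close>
    define p where "p = (\<Sum>n<N. g f n *\<^sub>C ket n)"
    have A0: "A \<ge> 0" by (simp add: A_def sum_nonneg)
    have nth_p: "ell2_nth p k = (if k < N then g f k else 0)" for k
      by (simp add: p_def ell2_nth_sum if_distrib[of "\<lambda>x. _ * x"] sum.delta cong: if_cong)
    have "(\<lambda>k. if k \<in> {..<N} then (cmod (g f k))\<^sup>2 else 0) sums A"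
      unfolding A_def by (rule sums_If_finite_set) simp
    moreover have "(\<lambda>k. if k \<in> {..<N} then (cmod (g f k))\<^sup>2 else 0) = (\<lambda>k. (cmod (ell2_nth p k))\<^sup>2)"
      unfolding nth_p by auto
    ultimately have np: "(norm p)\<^sup>2 = A" unfolding ell2_norm_sq by (simp add: sums_iff)
    have "cinner f (bop_apply T p) = (\<Sum>n<N. g f n * cinner f (bop_apply T (ket n)))"
      by (simp add: p_def bop_apply_sum cinner_sum_right cinner_scaleC_right)
    also have "\<dots> = (\<Sum>n<N. g f n * cnj (g f n))"
      unfolding g_def by (intro sum.cong refl arg_cong2[of _ _ _ _ "(*)"] cinner_commute)
    also have "\<dots> = of_real A" unfolding A_def of_real_sum by (simp only: complex_norm_square)
    finally have "inner f (bop_apply T p) = A" by (simp add: inner_eq_Re_cinner)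
    then have "A \<le> norm f * norm (bop_apply T p)" using norm_cauchy_schwarz[of f "bop_apply T p"] by simp
    also have "\<dots> \<le> norm f * (norm p * K)" by (intro mult_left_mono K) simp
    also have "norm p = sqrt A" using np by (metis norm_ge_zero real_sqrt_unique)
    finally have "sqrt A * sqrt A \<le> (norm f * K) * sqrt A" using A0 by (simp add: mult_ac)
    then have "sqrt A \<le> norm f * K"
      using A0 K(2) mult_right_le_imp_le[of "sqrt A" "sqrt A" "norm f * K"]
      by (cases "A = 0") simp_all
    then have "(sqrt A)\<^sup>2 \<le> (norm f * K)\<^sup>2" using A0 by (intro power_mono) auto
    then show ?thesis using A0 by (simp add: A_def power_mult_distrib mult.commute)
  qed
  then obtain S where S: "\<And>f n. ell2_nth (bop_apply S f) n = g f n"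
    using bop_from_coords[of g "K\<^sup>2"] by (auto simp: g_def cinner_add_right cinner_scaleC_right)
  have "cinner (bop_apply S x) y = cinner x (bop_apply T y)" for x y
  proof -
    have "(\<lambda>N. cinner x (bop_apply T (\<Sum>n<N. ell2_nth y n *\<^sub>C ket n))) \<longlonglongrightarrow> cinner x (bop_apply T y)"
      by (intro tendsto_cinner_right tendsto_bop_apply ell2_expansion)
    moreover have "cinner x (bop_apply T (\<Sum>n<N. ell2_nth y n *\<^sub>C ket n)) =
        (\<Sum>n<N. cnj (ell2_nth (bop_apply S x) n) * ell2_nth y n)" for N
      unfolding bop_apply_sum cinner_sum_right S g_def
      by (intro sum.cong refl) (simp add: cinner_scaleC_right cinner_commute[of x])
    moreover have "(\<lambda>N. \<Sum>n<N. cnj (ell2_nth (bop_apply S x) n) * ell2_nth y n) \<longlonglongrightarrow> cinner (bop_apply S x) y"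
      unfolding cinner_ell2 by (intro summable_LIMSEQ ell2_summable_mult ell2_summable)
    ultimately show ?thesis by (simp add: LIMSEQ_unique)
  qed
  then show ?thesis using S unfolding is_adjoint_def g_def by blast
qed

lemma ell2_eqI_cinner: "(\<And>y. cinner x y = cinner x' y) \<Longrightarrow> x = x'" for x x' :: ell2
  by (rule ell2_eqI) (metis cinner_ket_right complex_cnj_cnj)

text \<open>Self-adjointness moves \<open>J\<close> to the left argument, so commuting with
  \<open>J\<close> means that all functionals T -> <x, T J y> - <J x, T y> vanish. They are
  continuous in the weak operator topology, which makes the commutant closed; the same symmetry
  gives closure under adjoints.\<close>

lemma von_neumann_algebra_commutant:
  fixes J :: "ell2 bop"
  assumes J: "selfadjoint J"
  shows "von_neumann_algebra {T. T * J = J * T}"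
proof -
  let ?N = "{T. T * J = J * T}" and ?W = "weak_operator_topology :: ell2 bop topology"
  have Jc: "cinner (bop_apply J x) y = cinner x (bop_apply J y)" for x y
    using J by (simp add: selfadjoint_def is_adjoint_def)
  show ?thesis unfolding von_neumann_algebra_def
  proof (intro conjI ballI allI)
    show "1 \<in> ?N" by simp
    fix T assume T: "T \<in> ?N"
    show "a *\<^sub>C T \<in> ?N" for a
      using T bop_apply_commute[of T J] by (auto intro!: bop_eqI)
    show "\<exists>S\<in>?N. is_adjoint S T"
    proof -
      obtain S where S: "is_adjoint S T" using adjoint_exists by blast
      have "S * J = J * S"
      proof (intro bop_eqI ell2_eqI_cinner)
        fix x y
        have "bop_apply T (bop_apply J y) = bop_apply J (bop_apply T y)"
          using T by (intro bop_apply_commute) simp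
        then show "cinner (bop_apply (S * J) x) y = cinner (bop_apply (J * S) x) y"
          using S Jc by (simp add: is_adjoint_def)
      qed
      then show ?thesis using S by blast
    qed
  next
    fix S T assume "S \<in> ?N" "T \<in> ?N"
    then show "S + T \<in> ?N" "S * T \<in> ?N"
      by (simp_all add: distrib_left distrib_right) (metis mult.assoc)
  next
    let ?E = "\<lambda>p. {T. cinner (fst p) (bop_apply T (bop_apply J (snd p))) - cinner (bop_apply J (fst p)) (bop_apply T (snd p)) \<in> {0}}"
    have cont: "continuous_map ?W euclidean (\<lambda>T. cinner x (bop_apply T y))" for x y
      unfolding continuous_map_def
    proof (intro conjI allI impI)
      fix U :: "complex set" assume "openin euclidean U"
      then have "{T. cinner x (bop_apply T y) \<in> U} \<in> {{T. cinner x (bop_apply T y) \<in> U} | x y U. open U}"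
        by auto
      then show "openin ?W {T \<in> topspace ?W. cinner x (bop_apply T y) \<in> U}"
        unfolding topspace_weak_operator_topology unfolding weak_operator_topology_def
        by (simp add: topology_generated_by_Basis)
    qed simp
    have "closedin ?W {T \<in> topspace ?W. cinner x (bop_apply T (bop_apply J y)) - cinner (bop_apply J x) (bop_apply T y) \<in> {0}}"
      for x y
      by (rule closedin_continuous_map_preimage[of _ euclidean])
         (intro continuous_map_diff cont, simp)
    then have "closedin ?W (\<Inter>p. ?E p)"
      by (intro closedin_Inter) auto
    also have "(\<Inter>p. ?E p) = ?N"
    proof (intro equalityI subsetI)
      fix T assume "T \<in> (\<Inter>p. ?E p)"
      then have "cinner x (bop_apply (T * J) y) = cinner x (bop_apply (J * T) y)" for x y
        by (simp add: Jc)
      then have "bop_apply (T * J) y = bop_apply (J * T) y" for y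
        by (intro ell2_eqI_cinner) (metis cinner_commute)
      then show "T \<in> ?N" by (auto intro: bop_eqI)
    next
      fix T assume "T \<in> ?N"
      then have "bop_apply T (bop_apply J y) = bop_apply J (bop_apply T y)" for y
        by (intro bop_apply_commute) simp
      then show "T \<in> (\<Inter>p. ?E p)" by (simp add: Jc)
    qed
    finally show "closedin ?W ?N" .
  qed
qed

text \<open>The sequences \<open>\<xi>\<close> and \<open>\<eta>\<close> of an ultraweak functional
  may be supported at a single index.\<close>

lemma normal_vector_state: "normal_on N (\<lambda>T. cinner x (bop_apply T y))"
proof -
  let ?\<xi> = "\<lambda>n::nat. if n = 0 then x else 0" and ?\<eta> = "\<lambda>n::nat. if n = 0 then y else 0"
  have sums: "(\<Sum>n. cinner (?\<xi> n) (bop_apply T (?\<eta> n))) = cinner x (bop_apply T y)" for T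
  proof -
    have "(\<lambda>n. cinner (?\<xi> n) (bop_apply T (?\<eta> n))) = (\<lambda>n. if n = 0 then cinner x (bop_apply T y) else 0)"
      by (auto simp: cinner_zero_left)
    then show ?thesis using sums_single[of 0 "\<lambda>_. cinner x (bop_apply T y)"] by (simp add: sums_iff)
  qed
  have sm: "summable (\<lambda>n. (norm (?\<xi> n))\<^sup>2)" "summable (\<lambda>n. (norm (?\<eta> n))\<^sup>2)"
    by (rule summable_finite[of "{0}"]; simp)+
  have "continuous_map ultraweak_topology euclidean (\<lambda>T. cinner x (bop_apply T y))"
    unfolding continuous_map_def
  proof (intro conjI allI impI)
    fix U :: "complex set" assume "openin euclidean U"
    then have "{T. cinner x (bop_apply T y) \<in> U} \<in> {{T. (\<Sum>n. cinner (\<xi> n) (bop_apply T (\<eta> n))) \<in> U} | \<xi> \<eta> U.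
       summable (\<lambda>n::nat. (norm (\<xi> n))\<^sup>2) \<and> summable (\<lambda>n::nat. (norm (\<eta> n))\<^sup>2) \<and> open U}"
      using sums sm by (intro CollectI exI[of _ ?\<xi>] exI[of _ ?\<eta>] exI[of _ U]) simp
    then show "openin ultraweak_topology {T \<in> topspace ultraweak_topology. cinner x (bop_apply T y) \<in> U}"
      unfolding topspace_ultraweak_topology unfolding ultraweak_topology_def
      by (simp add: topology_generated_by_Basis)
  qed simp
  then show ?thesis unfolding normal_on_def by (rule continuous_map_from_subtopology)
qed

text \<open>The symmetric tridiagonal matrix with diagonal \<open>b\<close> and off-diagonal
  \<open>a\<close>. It acts on arbitrary sequences, so that \<open>jacobi_ncps\<close> can apply it
  to \<open>c k\<close> before this is known to be a vector of the Hilbert space.\<close>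

definition jacobi :: "(nat \<Rightarrow> real) \<Rightarrow> (nat \<Rightarrow> real) \<Rightarrow> (nat \<Rightarrow> complex) \<Rightarrow> nat \<Rightarrow> complex" where
  "jacobi a b f n = (case n of 0 \<Rightarrow> 0 | Suc k \<Rightarrow> of_real (a k) * f k) + of_real (b n) * f n +
     of_real (a n) * f (Suc n)"

lemma jacobi_bop_exists:
  assumes a: "\<And>n. \<bar>a n\<bar> \<le> K" and b: "\<And>n. \<bar>b n\<bar> \<le> K"
  shows "\<exists>J. \<forall>f n. ell2_nth (bop_apply J f) n = jacobi a b (ell2_nth f) n"
proof (rule bop_from_coords)
  fix f g :: ell2 and c n
  show "jacobi a b (ell2_nth (f + g)) n = jacobi a b (ell2_nth f) n + jacobi a b (ell2_nth g) n"
    "jacobi a b (ell2_nth (c *\<^sub>C f)) n = c * jacobi a b (ell2_nth f) n"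
    by (simp_all add: jacobi_def algebra_simps split: nat.split)
next
  fix f :: ell2 and N
  let ?f = "\<lambda>n. (cmod (ell2_nth f n))\<^sup>2"
  have K: "K \<ge> 0" using a[of 0] by linarith
  have pair_weight: "(cmod (of_real r * z))\<^sup>2 \<le> K\<^sup>2 * (cmod z)\<^sup>2" if "\<bar>r\<bar> \<le> K" for r z
    using that by (simp add: norm_mult power_mult_distrib mult_right_mono abs_le_square_iff[symmetric])
  have three: "(cmod (x + y + z))\<^sup>2 \<le> 3 * ((cmod x)\<^sup>2 + (cmod y)\<^sup>2 + (cmod z)\<^sup>2)" for x y z
  proof -
    have "(cmod (x + y + z))\<^sup>2 \<le> (cmod x + cmod y + cmod z)\<^sup>2"
      by (intro power_mono norm_triangle_le add_right_mono norm_triangle_ineq) simp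
    moreover have "0 \<le> (cmod x - cmod y)\<^sup>2 + (cmod y - cmod z)\<^sup>2 + (cmod x - cmod z)\<^sup>2" by simp
    ultimately show ?thesis by (simp add: power2_eq_square algebra_simps)
  qed
  have "(cmod (jacobi a b (ell2_nth f) n))\<^sup>2 \<le>
      3 * (K\<^sup>2 * (case n of 0 \<Rightarrow> 0 | Suc k \<Rightarrow> ?f k) + K\<^sup>2 * ?f n + K\<^sup>2 * ?f (Suc n))" for n
    unfolding jacobi_def
    by (rule order_trans[OF three]) (intro mult_left_mono add_mono; cases n; simp add: pair_weight a b)
  then have "(\<Sum>n<N. (cmod (jacobi a b (ell2_nth f) n))\<^sup>2) \<le>
      (\<Sum>n<N. 3 * (K\<^sup>2 * (case n of 0 \<Rightarrow> 0 | Suc k \<Rightarrow> ?f k) + K\<^sup>2 * ?f n + K\<^sup>2 * ?f (Suc n)))"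
    by (rule sum_mono)
  also have "\<dots> = 3 * K\<^sup>2 * ((\<Sum>n<N. case n of 0 \<Rightarrow> 0 | Suc k \<Rightarrow> ?f k) + (\<Sum>n<N. ?f n) + (\<Sum>n<N. ?f (Suc n)))"
    by (simp add: sum.distrib sum_distrib_left algebra_simps)
  also have "\<dots> \<le> 3 * K\<^sup>2 * ((norm f)\<^sup>2 + (norm f)\<^sup>2 + (norm f)\<^sup>2)"
  proof (intro mult_left_mono add_mono)
    have "(\<Sum>n<N. case n of 0 \<Rightarrow> 0 | Suc k \<Rightarrow> ?f k) \<le> (\<Sum>n<Suc N. case n of 0 \<Rightarrow> 0 | Suc k \<Rightarrow> ?f k)"
      by (intro sum_mono2) (auto split: nat.split)
    also have "\<dots> = (\<Sum>n<N. ?f n)" by (subst sum.lessThan_Suc_shift) simp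
    also have "\<dots> \<le> (norm f)\<^sup>2" by (rule ell2_partial_sum_le)
    finally show "(\<Sum>n<N. case n of 0 \<Rightarrow> 0 | Suc k \<Rightarrow> ?f k) \<le> (norm f)\<^sup>2" .
    have "(\<Sum>n<N. ?f (Suc n)) \<le> (\<Sum>n<Suc N. ?f n)" by (subst sum.lessThan_Suc_shift) simp
    also have "\<dots> \<le> (norm f)\<^sup>2" by (rule ell2_partial_sum_le)
    finally show "(\<Sum>n<N. ?f (Suc n)) \<le> (norm f)\<^sup>2" .
  qed (auto simp: ell2_partial_sum_le)
  finally show "(\<Sum>n<N. (cmod (jacobi a b (ell2_nth f) n))\<^sup>2) \<le> (9 * K\<^sup>2) * (norm f)\<^sup>2" by simp
qed

lemma jacobi_bop_selfadjoint:
  fixes J :: "ell2 bop"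
  assumes J: "\<And>f n. ell2_nth (bop_apply J f) n = jacobi a b (ell2_nth f) n"
  shows "selfadjoint J"
proof -
  obtain S where S: "is_adjoint S J" "\<And>f n. ell2_nth (bop_apply S f) n = cinner (bop_apply J (ket n)) f"
    using adjoint_exists[of J] by blast
  have "bop_apply J (ket n) = (case n of 0 \<Rightarrow> 0 | Suc k \<Rightarrow> of_real (a k) *\<^sub>C ket k) +
      of_real (b n) *\<^sub>C ket n + of_real (a n) *\<^sub>C ket (Suc n)" for n
    by (rule ell2_eqI) (auto simp: J jacobi_def split: nat.split)
  then have "cinner (bop_apply J (ket n)) f = jacobi a b (ell2_nth f) n" for n f
    by (simp add: jacobi_def cinner_add_left cinner_scaleC_left cinner_zero_left split: nat.split)
  then have "S = J" by (intro bop_eqI ell2_eqI) (simp add: S(2) J)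
  then show ?thesis using S(1) by (simp add: selfadjoint_def)
qed

text \<open>\<open>R\<close> is the \<open>n\<close>-th orthonormal polynomial of the recurrence
  evaluated at \<open>J\<close>, obtained by dividing by the \<open>a n\<close>. As a real
  polynomial in \<open>J\<close> it is self-adjoint and commutes with the commutant; only these
  properties are recorded.\<close>

lemma jacobi_basis_operators:
  fixes J :: "ell2 bop"
  assumes J: "\<And>f n. ell2_nth (bop_apply J f) n = jacobi a b (ell2_nth f) n" and a: "\<And>n. a n \<noteq> 0"
  shows "\<exists>R. bop_apply R (ket 0) = ket n \<and> (\<forall>T. T * J = J * T \<longrightarrow> T * R = R * T) \<and> selfadjoint R"
proof -
  define P where "P n R \<longleftrightarrow> bop_apply R (ket 0) = ket n \<and> (\<forall>T. T * J = J * T \<longrightarrow> T * R = R * T) \<and>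
    selfadjoint R" for n R
  have sa: "cinner (bop_apply J x) y = cinner x (bop_apply J y)" for x y
    using jacobi_bop_selfadjoint[of J a b] J by (simp add: selfadjoint_def is_adjoint_def)
  \<comment> \<open>\<open>c\<close> and \<open>R'\<close> abstract the term with the previous
    operator; for \<open>n = 0\<close>, where there is none, 0 and 1 are inserted.\<close>
  have step: "P (Suc n) ((1 / of_real (a n)) *\<^sub>C (J * R - of_real (b n) *\<^sub>C R - of_real c *\<^sub>C R'))"
    if R: "P n R" and ket: "of_real c *\<^sub>C bop_apply R' (ket 0) =
        (case n of 0 \<Rightarrow> 0 | Suc k \<Rightarrow> of_real (a k) *\<^sub>C ket k)"
      and R': "\<forall>T. T * J = J * T \<longrightarrow> T * R' = R' * T" "selfadjoint R'" for n R R' c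
    unfolding P_def
  proof (intro conjI allI impI)
    show "bop_apply ((1 / of_real (a n)) *\<^sub>C (J * R - of_real (b n) *\<^sub>C R - of_real c *\<^sub>C R')) (ket 0) = ket (Suc n)"
    proof -
      have "bop_apply R (ket 0) = ket n" using R unfolding P_def by blast
      then show ?thesis using a by (intro ell2_eqI) (auto simp: ket J jacobi_def split: nat.split)
    qed
  next
    fix T assume T: "T * J = J * T"
    have c: "bop_apply T (bop_apply J x) = bop_apply J (bop_apply T x)"
      "bop_apply T (bop_apply R x) = bop_apply R (bop_apply T x)"
      "bop_apply T (bop_apply R' x) = bop_apply R' (bop_apply T x)" for x
      using T R R'(1) unfolding P_def by (auto intro: bop_apply_commute)
    have diff: "bop_apply T (x - y) = bop_apply T x - bop_apply T y" for x y
      using bop_bounded_linear linear_diff bounded_linear.linear by blast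
    show "T * ((1 / of_real (a n)) *\<^sub>C (J * R - of_real (b n) *\<^sub>C R - of_real c *\<^sub>C R')) =
        (1 / of_real (a n)) *\<^sub>C (J * R - of_real (b n) *\<^sub>C R - of_real c *\<^sub>C R') * T"
      by (intro bop_eqI) (simp add: c diff)
  next
    have JR: "bop_apply J (bop_apply R x) = bop_apply R (bop_apply J x)" for x
      using R unfolding P_def by (auto intro: bop_apply_commute)
    have sR: "cinner (bop_apply R x) y = cinner x (bop_apply R y)"
      "cinner (bop_apply R' x) y = cinner x (bop_apply R' y)" for x y
      using R R'(2) by (auto simp: P_def selfadjoint_def is_adjoint_def)
    have dl: "cinner (x - y) z = cinner x z - cinner y z" "cinner z (x - y) = cinner z x - cinner z y"
      for x y z :: ell2
      using cinner_add_left[of "x - y" y z] cinner_add_right[of z "x - y" y] by simp_all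
    show "selfadjoint ((1 / of_real (a n)) *\<^sub>C (J * R - of_real (b n) *\<^sub>C R - of_real c *\<^sub>C R'))"
      unfolding selfadjoint_def is_adjoint_def
      by (simp add: dl cinner_scaleC_left cinner_scaleC_right sa sR JR)
  qed
  have "selfadjoint (1 :: ell2 bop)" by (simp add: selfadjoint_def is_adjoint_def)
  then have P0: "P 0 1" by (simp add: P_def)
  \<comment> \<open>Two consecutive operators are carried along, as the recurrence has three
    terms.\<close>
  have "(\<exists>R. P n R) \<and> (\<exists>R. P (Suc n) R)" for n
  proof (induction n)
    case 0
    have "P (Suc 0) ((1 / of_real (a 0)) *\<^sub>C (J * 1 - of_real (b 0) *\<^sub>C 1 - of_real 0 *\<^sub>C 1))"
      by (rule step[OF P0]) (use P0 in \<open>auto simp: P_def scaleC_zero_left\<close>)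
    with P0 show ?case by blast
  next
    case (Suc n)
    then obtain R' R where R: "P n R'" "P (Suc n) R" by blast
    have "P (Suc (Suc n)) ((1 / of_real (a (Suc n))) *\<^sub>C
        (J * R - of_real (b (Suc n)) *\<^sub>C R - of_real (a n) *\<^sub>C R'))"
      by (rule step[OF R(2)]) (use R(1) in \<open>auto simp: P_def\<close>)
    with R show ?case by blast
  qed
  then show ?thesis unfolding P_def by blast
qed

text \<open>
  Elements of the commutant commute with the real operators mapping \<open>ket 0\<close> to \<open>ket n\<close>; hence
  they are determined by their value at \<open>ket 0\<close>, and passing to the adjoint conjugates the
  coordinates of that value.
\<close>

lemma jacobi_ncps:
  assumes a: "\<And>n. \<bar>a n\<bar> \<le> K" "\<And>n. a n \<noteq> 0" and b: "\<And>n. \<bar>b n\<bar> \<le> K"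
    and c0: "\<And>n. c 0 n = (if n = 0 then 1 else 0)" and c: "\<And>k. c (Suc k) = jacobi a b (c k)"
  shows "\<exists>(N :: ell2 bop set) \<phi> Y. tracial_ncps N \<phi> \<and> Y \<in> N \<and> selfadjoint Y \<and> (\<forall>k. \<phi> (Y ^ k) = c k 0)"
proof -
  obtain J :: "ell2 bop" where J: "\<And>f n. ell2_nth (bop_apply J f) n = jacobi a b (ell2_nth f) n"
    using jacobi_bop_exists[of a K b] a b by blast
  have saJ: "selfadjoint J" by (rule jacobi_bop_selfadjoint) (rule J)
  define N where "N = {T. T * J = J * T}"
  define \<phi> where "\<phi> T = cinner (ket 0) (bop_apply T (ket 0))" for T
  have R: "\<exists>R. bop_apply R (ket 0) = ket n \<and> (\<forall>T\<in>N. T * R = R * T) \<and> selfadjoint R" for n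
    using jacobi_basis_operators[of J a b n] J a(2) unfolding N_def by blast
  have faith: "T = 0" if "T \<in> N" "bop_apply T (ket 0) = 0" for T
  proof (rule bop_eq_0_if_ket)
    fix n
    obtain R where R: "bop_apply R (ket 0) = ket n" "T * R = R * T" using R[of n] \<open>T \<in> N\<close> by blast
    have "bop_apply T (ket n) = bop_apply (T * R) (ket 0)" by (simp add: R(1))
    also have "\<dots> = 0" unfolding R(2) by (simp add: that(2))
    finally show "bop_apply T (ket n) = 0" .
  qed
  have star: "ell2_nth (bop_apply S' (ket 0)) n = cnj (ell2_nth (bop_apply S (ket 0)) n)"
    if S: "S \<in> N" "is_adjoint S' S" for S S' n
  proof -
    obtain R where R: "bop_apply R (ket 0) = ket n" "S * R = R * S" "selfadjoint R"
      using R[of n] S(1) by blast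
    have "bop_apply S (ket n) = bop_apply (S * R) (ket 0)" by (simp add: R(1))
    then have "cinner (bop_apply S' (ket 0)) (ket n) = cinner (ket 0) (bop_apply (S * R) (ket 0))"
      using S(2) unfolding is_adjoint_def by metis
    also have "\<dots> = cinner (bop_apply R (ket 0)) (bop_apply S (ket 0))"
      unfolding R(2) using R(3) unfolding selfadjoint_def is_adjoint_def bop_apply_simps by simp
    finally show ?thesis unfolding R(1) by (metis cinner_ket_left cinner_ket_right complex_cnj_cnj)
  qed
  \<comment> \<open>\<open>\<phi> (S * T)\<close> is the inner product of S* e_0 and T e_0.
    Conjugating the coordinates of S* e_0 by \<open>star\<close> gives an expression symmetric in
    \<open>S\<close> and \<open>T\<close>, which is traciality.\<close>
  have prod: "\<phi> (S * T) = (\<Sum>n. ell2_nth (bop_apply S (ket 0)) n * ell2_nth (bop_apply T (ket 0)) n)"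
    if S: "S \<in> N" for S T
  proof -
    obtain S' where S': "is_adjoint S' S" using adjoint_exists by blast
    have "\<phi> (S * T) = cinner (bop_apply S' (ket 0)) (bop_apply T (ket 0))"
      using S' unfolding \<phi>_def is_adjoint_def bop_apply_simps by simp
    then show ?thesis unfolding cinner_ell2 using star[OF S S'] by simp
  qed
  have pos: "\<phi> (S * T) = of_real ((norm (bop_apply T (ket 0)))\<^sup>2)" if "is_adjoint S T" for S T
  proof -
    have "cinner (bop_apply S (bop_apply T (ket 0))) (ket 0) = cinner (bop_apply T (ket 0)) (bop_apply T (ket 0))"
      using that unfolding is_adjoint_def by blast
    then have "cinner (ket 0) (bop_apply S (bop_apply T (ket 0))) = cnj (of_real ((norm (bop_apply T (ket 0)))\<^sup>2))"
      unfolding cinner_same_real by (metis cinner_commute)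
    then show ?thesis by (simp add: \<phi>_def)
  qed
  have "tracial_ncps N \<phi>"
    unfolding tracial_ncps_def
  proof (intro conjI)
    show "von_neumann_algebra N" unfolding N_def by (rule von_neumann_algebra_commutant[OF saJ])
    show "state_on N \<phi>"
      unfolding state_on_def using pos by (auto simp: \<phi>_def)
    show "normal_on N \<phi>" unfolding \<phi>_def by (rule normal_vector_state)
    show "faithful_on N \<phi>"
      unfolding faithful_on_def using pos faith by auto
    show "tracial_on N \<phi>"
      unfolding tracial_on_def by (auto simp: prod mult.commute)
  qed
  moreover have "J \<in> N" by (simp add: N_def)
  moreover have "ell2_nth (bop_apply (J ^ k) (ket 0)) = c k" for k
    by (induction k) (auto simp: c0 c J intro!: ext)
  then have "\<phi> (J ^ k) = c k 0" for k by (simp add: \<phi>_def)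
  ultimately show ?thesis using saJ by blast
qed

section \<open>Orthogonal polynomials\<close>

text \<open>Stands in for integration against a measure with moments \<open>m\<close>.\<close>

definition moment_functional :: "(nat \<Rightarrow> real) \<Rightarrow> real poly \<Rightarrow> real" where
  "moment_functional m p = (\<Sum>i\<le>degree p. coeff p i * m i)"

lemma moment_functional_eq:
  assumes "degree p \<le> n"
  shows "moment_functional m p = (\<Sum>i\<le>n. coeff p i * m i)"
  unfolding moment_functional_def
  by (rule sum.mono_neutral_left) (use assms in \<open>auto simp: coeff_eq_0\<close>)

lemma moment_functional_add:
  "moment_functional m (p + q) = moment_functional m p + moment_functional m q"
proof -
  let ?n = "max (degree p) (degree q)"
  have "degree (p + q) \<le> ?n" by (rule degree_add_le_max)
  then show ?thesis
    by (simp add: moment_functional_eq[of _ ?n] sum.distrib distrib_right)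
qed

lemma moment_functional_smult: "moment_functional m (smult c p) = c * moment_functional m p"
  by (simp add: moment_functional_eq[of "smult c p" "degree p"] moment_functional_eq[of p "degree p"]
      sum_distrib_left mult.assoc)

lemma moment_functional_diff:
  "moment_functional m (p - q) = moment_functional m p - moment_functional m q"
  using moment_functional_add[of m p "smult (-1) q"] moment_functional_smult[of m "-1" q] by simp

lemma moment_functional_0 [simp]: "moment_functional m 0 = 0"
  by (simp add: moment_functional_def)

lemma moment_functional_monom: "moment_functional m (monom c k) = c * m k"
  by (simp add: moment_functional_eq[of _ k] degree_monom_le if_distrib[of "\<lambda>x. x * _"] sum.delta cong: if_cong)

lemma moment_functional_sum: "moment_functional m (\<Sum>i\<in>I. f i) = (\<Sum>i\<in>I. moment_functional m (f i))"
  by (induction I rule: infinite_finite_induct)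
     (simp_all add: moment_functional_add moment_functional_def[of m 0])

lemma moment_functional_mult:
  "moment_functional m (p * q) =
    (\<Sum>i\<le>degree p. \<Sum>j\<le>degree q. coeff p i * coeff q j * m (i + j))"
proof -
  have "p * q = (\<Sum>i\<le>degree p. monom (coeff p i) i) * (\<Sum>j\<le>degree q. monom (coeff q j) j)"
    by (simp only: poly_as_sum_of_monoms)
  then show ?thesis
    by (simp add: sum_product mult_monom moment_functional_sum moment_functional_monom)
qed

definition pX :: "real poly" where "pX = [:0, 1:]"

text \<open>Monic orthogonal polynomials, introduced by their three-term recurrence instead of
  Gram-Schmidt: this hands over the Jacobi coefficients directly and leaves orthogonality to be
  proved in \<open>orth\<close>.\<close>

fun orth_poly :: "(nat \<Rightarrow> real) \<Rightarrow> nat \<Rightarrow> real poly" where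
  "orth_poly m 0 = 1"
| "orth_poly m (Suc n) = (let q = orth_poly m n; h = moment_functional m (q * q) in
     pX * q - smult (moment_functional m (pX * q * q) / h) q -
     (case n of 0 \<Rightarrow> 0 | Suc k \<Rightarrow> smult (h / moment_functional m (orth_poly m k * orth_poly m k)) (orth_poly m k)))"

declare orth_poly.simps(2) [simp del]

lemma orth_poly_monic: "degree (orth_poly m n) = n \<and> coeff (orth_poly m n) n = 1"
proof (induction n rule: less_induct)
  case (less n)
  show ?case
  proof (cases n)
    case (Suc k)
    have q: "degree (orth_poly m k) = k" "coeff (orth_poly m k) k = 1" using less[of k] Suc by auto
    define r where "r = smult (moment_functional m (pX * orth_poly m k * orth_poly m k) /
      moment_functional m (orth_poly m k * orth_poly m k)) (orth_poly m k) +
      (case k of 0 \<Rightarrow> 0 | Suc j \<Rightarrow> smult (moment_functional m (orth_poly m k * orth_poly m k) /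
        moment_functional m (orth_poly m j * orth_poly m j)) (orth_poly m j))"
    have eq: "orth_poly m n = pX * orth_poly m k - r"
      unfolding Suc r_def orth_poly.simps(2) Let_def by simp
    have "degree r \<le> k"
      unfolding r_def using q less Suc
      by (intro degree_add_le) (auto split: nat.split intro: order.trans[OF degree_smult_le])
    then have r: "degree r < n" using Suc by simp
    have "orth_poly m k \<noteq> 0" using q by auto
    then have d: "degree (pX * orth_poly m k) = n" using q Suc by (simp add: pX_def degree_mult_eq)
    have "coeff (pX * orth_poly m k) n = 1" using q Suc by (simp add: pX_def)
    then have "coeff (orth_poly m n) n = 1" unfolding eq using r by (simp add: coeff_eq_0)
    moreover have "degree (orth_poly m n) \<le> n" unfolding eq using d r by (intro degree_diff_le) auto
    ultimately show ?thesis by (metis le_antisym le_degree zero_neq_one)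
  qed simp
qed

context
  fixes m :: "nat \<Rightarrow> real" and C M :: real
  assumes pos: "\<And>p. p \<noteq> 0 \<Longrightarrow> moment_functional m (p * p) > 0"
    and bound: "\<And>k. \<bar>m k\<bar> \<le> C * M ^ k" and M: "M > 0" and m0: "m 0 = 1"
begin

private abbreviation "L \<equiv> moment_functional m"
private abbreviation "q \<equiv> orth_poly m"

private definition h where "h n = L (q n * q n)"
private definition bc where "bc n = L (pX * q n * q n) / h n"

private lemma h_pos: "h n > 0"
  unfolding h_def using orth_poly_monic[of m n] by (intro pos) auto

private lemma three_term:
  "pX * q n = q (Suc n) + smult (bc n) (q n) +
    (case n of 0 \<Rightarrow> 0 | Suc k \<Rightarrow> smult (h n / h k) (q k))"
  unfolding orth_poly.simps(2)[of m n] bc_def h_def Let_def by simp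

lemma moment_functional_Cauchy_Schwarz: "(L (p * r))\<^sup>2 \<le> L (p * p) * L (r * r)"
proof (cases "r = 0")
  case False
  \<comment> \<open>This \<open>t\<close> minimises the value of \<open>L\<close> at the square of
    \<open>p - smult t r\<close>.\<close>
  define t where "t = L (p * r) / L (r * r)"
  have r: "L (r * r) > 0" using pos False by blast
  have "0 \<le> L ((p - smult t r) * (p - smult t r))"
    using pos[of "p - smult t r"] by (cases "p - smult t r = 0") (auto simp: moment_functional_def)
  also have "L ((p - smult t r) * (p - smult t r)) = L (p * p) - 2 * t * L (p * r) + t * t * L (r * r)"
    by (simp add: left_diff_distrib right_diff_distrib moment_functional_diff moment_functional_smult
        mult.commute[of r p])
  also have "\<dots> = L (p * p) - (L (p * r))\<^sup>2 / L (r * r)"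
    using r by (simp add: t_def power2_eq_square)
  finally show ?thesis using r by (simp add: field_simps)
qed (simp add: moment_functional_def)

text \<open>The even moments \<open>L (x\<^sup>2\<^sup>k p\<^sup>2)\<close> are log-convex in \<open>k\<close> and grow at most like \<open>M\<^sup>2\<^sup>k\<close>.\<close>

lemma moment_functional_mult_X_le: "L ((pX * p) * (pX * p)) \<le> M\<^sup>2 * L (p * p)"
proof (cases "p = 0")
  case False
  define s where "s k = L ((pX ^ k * p) * (pX ^ k * p))" for k
  have s_pos: "s k > 0" for k unfolding s_def using False by (intro pos) (simp add: pX_def)
  have convex: "(s (Suc k))\<^sup>2 \<le> s k * s (Suc (Suc k))" for k
  proof -
    have "(pX ^ Suc k * p) * (pX ^ Suc k * p) = (pX ^ k * p) * (pX ^ Suc (Suc k) * p)"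
      by (simp only: power_Suc mult_ac)
    then show ?thesis
      unfolding s_def using moment_functional_Cauchy_Schwarz[of "pX ^ k * p" "pX ^ Suc (Suc k) * p"]
      by (simp only:)
  qed
  define K where "K = (\<Sum>i\<le>degree (p * p). \<bar>coeff (p * p) i\<bar> * (C * M ^ i))"
  have s_le: "s k \<le> K * (M\<^sup>2) ^ k" for k
  proof -
    have "(pX ^ k * p) * (pX ^ k * p) = (pX ^ k * pX ^ k) * (p * p)" by (simp only: mult_ac)
    also have "pX ^ k * pX ^ k = monom 1 (2 * k)"
      by (simp add: monom_altdef pX_def mult_2 power_add)
    finally have "(pX ^ k * p) * (pX ^ k * p) = monom 1 (2 * k) * (p * p)" .
    then have "s k = L (monom 1 (2 * k) * (\<Sum>i\<le>degree (p * p). monom (coeff (p * p) i) i))"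
      unfolding s_def by (simp only: poly_as_sum_of_monoms)
    also have "\<dots> = (\<Sum>i\<le>degree (p * p). coeff (p * p) i * m (2 * k + i))"
      by (simp add: sum_distrib_left mult_monom moment_functional_sum moment_functional_monom)
    also have "\<dots> \<le> (\<Sum>i\<le>degree (p * p). \<bar>coeff (p * p) i\<bar> * (C * M ^ (2 * k + i)))"
    proof (rule sum_mono)
      fix i
      have "coeff (p * p) i * m (2 * k + i) \<le> \<bar>coeff (p * p) i\<bar> * \<bar>m (2 * k + i)\<bar>"
        by (metis abs_ge_self abs_mult)
      also have "\<dots> \<le> \<bar>coeff (p * p) i\<bar> * (C * M ^ (2 * k + i))"
        by (rule mult_left_mono[OF bound]) simp
      finally show "coeff (p * p) i * m (2 * k + i) \<le> \<bar>coeff (p * p) i\<bar> * (C * M ^ (2 * k + i))" .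
    qed
    also have "\<dots> = K * (M\<^sup>2) ^ k"
    proof -
      have "M ^ (2 * k + i) = M ^ i * (M\<^sup>2) ^ k" for i by (simp add: power_add power_mult)
      then show ?thesis by (simp only: K_def sum_distrib_right mult.assoc)
    qed
    finally show ?thesis .
  qed
  \<comment> \<open>Log-convexity makes the ratios of consecutive \<open>s k\<close> nondecreasing,
    so \<open>s k\<close> grows at least like \<open>r ^ k\<close>; the upper bound
    \<open>s_le\<close> then forces \<open>r \<le> M\<^sup>2\<close>, whatever the constant
    \<open>K\<close>.\<close>
  define r where "r = s 1 / s 0"
  have r0: "r > 0" using s_pos by (simp add: r_def)
  have ratio: "r * s k \<le> s (Suc k)" for k
  proof (induction k)
    case 0
    then show ?case using s_pos[of 0] by (simp add: r_def)
  next
    case (Suc k)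
    have "(r * s (Suc k)) * s k = (r * s k) * s (Suc k)" by simp
    also have "\<dots> \<le> s (Suc k) * s (Suc k)" using Suc s_pos[of "Suc k"] by (intro mult_right_mono) auto
    also have "\<dots> \<le> s (Suc (Suc k)) * s k" using convex[of k] by (simp add: power2_eq_square mult.commute)
    finally show ?case using s_pos[of k] by (simp add: mult_le_cancel_right)
  qed
  have geo: "s 0 * r ^ k \<le> s k" for k
  proof (induction k)
    case (Suc k)
    have "s 0 * r ^ Suc k \<le> r * s k" using Suc r0 by (simp add: mult.left_commute)
    then show ?case using ratio[of k] by linarith
  qed simp
  have "r \<le> M\<^sup>2"
  proof (rule ccontr)
    assume "\<not> r \<le> M\<^sup>2"
    then have "r / M\<^sup>2 > 1" using M by simp
    then obtain k where "(r / M\<^sup>2) ^ k > K / s 0" using real_arch_pow by blast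
    then have "K * (M\<^sup>2) ^ k < s 0 * r ^ k"
      using M s_pos[of 0] by (simp add: power_divide field_simps)
    then show False using geo[of k] s_le[of k] by linarith
  qed
  then have "s 1 \<le> M\<^sup>2 * s 0" using s_pos[of 0] by (simp add: r_def field_simps)
  then show ?thesis by (simp add: s_def)
qed (simp add: moment_functional_def)

text \<open>The factor X is moved from q_k to q_i and expanded there. For i = k the coefficient
  \<open>bc\<close> was chosen to cancel, for i = k - 1 the quotient of the \<open>h\<close> does
  so, and for smaller i every term vanishes by induction.\<close>

private lemma orth: "i < n \<Longrightarrow> L (q i * q n) = 0"
proof (induction n arbitrary: i rule: less_induct)
  case (less n)
  then obtain k where n: "n = Suc k" by (cases n) auto
  have IH: "L (q i * q j) = 0" if "i \<noteq> j" "i \<le> k" "j \<le> k" for i j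
    using that less.IH[of i j] less.IH[of j i] n by (cases i j rule: linorder_cases) (auto simp: mult.commute)
  have q_n: "q n = pX * q k - smult (bc k) (q k) - (case k of 0 \<Rightarrow> 0 | Suc j \<Rightarrow> smult (h k / h j) (q j))"
    using three_term[of k] n by (simp add: algebra_simps)
  have expand: "L (q i * q n) = L (pX * q i * q k) - bc k * L (q i * q k) -
      (case k of 0 \<Rightarrow> 0 | Suc j \<Rightarrow> h k / h j * L (q i * q j))"
    unfolding q_n
    by (cases k) (simp_all add: right_diff_distrib moment_functional_diff moment_functional_smult mult_ac)
  show ?case
  proof (cases "i = k")
    case True
    have "(case k of 0 \<Rightarrow> 0 | Suc j \<Rightarrow> h k / h j * L (q i * q j)) = 0"
      using IH True by (auto split: nat.split)
    then show ?thesis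
      unfolding expand unfolding True using h_pos[of k] by (simp add: bc_def h_def)
  next
    case False
    then have ik: "i < k" using less.prems n by simp
    then obtain j where k: "k = Suc j" by (cases k) auto
    have "L (pX * q i * q k) = L (q (Suc i) * q k)"
      unfolding three_term[of i] using IH[of i k] IH[of _ k] ik
      by (cases i) (simp_all add: distrib_right moment_functional_add moment_functional_smult)
    moreover have "L (q i * q k) = 0" using IH ik by simp
    ultimately have *: "L (q i * q n) = L (q (Suc i) * q k) - h k / h j * L (q i * q j)"
      unfolding expand k by simp
    show ?thesis
    proof (cases "i = j")
      case True
      then show ?thesis unfolding * using k h_pos[of j] by (simp add: h_def)
    next
      case False
      then have "L (q (Suc i) * q k) = 0" "L (q i * q j) = 0" using IH ik k by auto
      then show ?thesis unfolding * by simp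
    qed
  qed
qed

lemma moment_ncps:
  "\<exists>(N :: ell2 bop set) \<phi> Y. tracial_ncps N \<phi> \<and> Y \<in> N \<and> selfadjoint Y \<and> (\<forall>k. \<phi> (Y ^ k) = of_real (m k))"
proof -
  \<comment> \<open>The normalised polynomials q_n / sqrt(h n) have recurrence coefficients
    \<open>a\<close> and \<open>bc\<close>, and \<open>c k n\<close> is the n-th coordinate of x^k
    with respect to them.\<close>
  define a where "a n = sqrt (h (Suc n) / h n)" for n
  define c where "c k n = complex_of_real (L (pX ^ k * q n) / sqrt (h n))" for k n
  have a_pos: "a n > 0" for n using h_pos by (simp add: a_def)
  \<comment> \<open>\<open>h (Suc n)\<close> is the pairing of X q_n with the next polynomial, so
    Cauchy-Schwarz and the bound for multiplication by X control it by \<open>h n\<close>.\<close>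
  have "h (Suc n) \<le> M\<^sup>2 * h n" for n
  proof -
    have "L (pX * q n * q (Suc n)) = h (Suc n)"
      unfolding three_term using orth[of n "Suc n"] orth[of _ "Suc n"]
      by (cases n) (simp_all add: h_def distrib_right moment_functional_add moment_functional_smult)
    then have "(h (Suc n))\<^sup>2 \<le> L ((pX * q n) * (pX * q n)) * h (Suc n)"
      using moment_functional_Cauchy_Schwarz[of "pX * q n" "q (Suc n)"] by (simp add: h_def)
    then have "h (Suc n) \<le> L ((pX * q n) * (pX * q n))"
      using h_pos[of "Suc n"] by (simp add: power2_eq_square)
    then show ?thesis using moment_functional_mult_X_le[of "q n"] by (simp add: h_def)
  qed
  then have "h (Suc n) / h n \<le> M\<^sup>2" for n using h_pos[of n] by (simp add: divide_le_eq)
  then have a_le: "\<bar>a n\<bar> \<le> M" for n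
    using a_pos[of n] M real_le_lsqrt[of M "h (Suc n) / h n"] by (simp add: a_def)
  have b_le: "\<bar>bc n\<bar> \<le> M" for n
  proof -
    have "(L (pX * q n * q n))\<^sup>2 \<le> L ((pX * q n) * (pX * q n)) * h n"
      using moment_functional_Cauchy_Schwarz[of "pX * q n" "q n"] by (simp add: h_def)
    also have "\<dots> \<le> (M\<^sup>2 * h n) * h n"
      using moment_functional_mult_X_le[of "q n"] h_pos[of n] by (intro mult_right_mono) (auto simp: h_def)
    finally have "(L (pX * q n * q n))\<^sup>2 \<le> (M * h n)\<^sup>2" by (simp add: power2_eq_square mult_ac)
    then have "\<bar>L (pX * q n * q n)\<bar> \<le> M * h n"
      using M h_pos[of n] by (simp add: power2_le_iff_abs_le)
    then show ?thesis using h_pos[of n] by (simp add: bc_def divide_le_eq)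
  qed
  have c0: "c 0 n = (if n = 0 then 1 else 0)" for n
  proof (cases n)
    case 0
    then show ?thesis by (simp add: c_def h_def moment_functional_def m0)
  next
    case (Suc k)
    then show ?thesis using orth[of 0 n] by (simp add: c_def)
  qed
  have c_Suc: "c (Suc k) = jacobi a bc (c k)" for k
  proof
    fix n
    have "pX ^ Suc k * q n = pX ^ k * (pX * q n)" by (simp only: power_Suc mult_ac)
    then have "L (pX ^ Suc k * q n) = L (pX ^ k * q (Suc n)) + bc n * L (pX ^ k * q n) +
        (case n of 0 \<Rightarrow> 0 | Suc j \<Rightarrow> h n / h j * L (pX ^ k * q j))"
      unfolding three_term
      by (cases n) (simp_all add: distrib_left moment_functional_add moment_functional_smult)
    then have "L (pX ^ Suc k * q n) / sqrt (h n) = L (pX ^ k * q (Suc n)) / sqrt (h n) +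
        bc n * (L (pX ^ k * q n) / sqrt (h n)) +
        (case n of 0 \<Rightarrow> 0 | Suc j \<Rightarrow> h n / h j * L (pX ^ k * q j)) / sqrt (h n)"
      by (simp add: add_divide_distrib)
    also have "L (pX ^ k * q (Suc n)) / sqrt (h n) = a n * (L (pX ^ k * q (Suc n)) / sqrt (h (Suc n)))"
      using h_pos[of n] h_pos[of "Suc n"] by (simp add: a_def real_sqrt_divide)
    also have "(case n of 0 \<Rightarrow> 0 | Suc j \<Rightarrow> h n / h j * L (pX ^ k * q j)) / sqrt (h n) =
        (case n of 0 \<Rightarrow> 0 | Suc j \<Rightarrow> a j * (L (pX ^ k * q j) / sqrt (h j)))"
    proof (cases n)
      case (Suc j)
      have "h n / h j / sqrt (h n) = a j / sqrt (h j)"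
        using h_pos[of n] h_pos[of j] Suc
        by (simp add: a_def real_sqrt_divide field_simps flip: real_sqrt_mult)
      then have "h n / h j / sqrt (h n) * L (pX ^ k * q j) = a j / sqrt (h j) * L (pX ^ k * q j)"
        by (rule arg_cong)
      then show ?thesis unfolding Suc nat.case by simp
    qed simp
    finally show "c (Suc k) n = jacobi a bc (c k) n"
      unfolding c_def jacobi_def by (simp only:) (simp split: nat.split)
  qed
  have "c k 0 = of_real (m k)" for k
  proof -
    have "pX ^ k = monom 1 k" by (simp add: monom_altdef pX_def)
    then show ?thesis using m0
      by (simp add: c_def h_def moment_functional_monom) (simp add: moment_functional_def)
  qed
  then show ?thesis
    using jacobi_ncps[of a M bc c] a_le a_pos b_le c0 c_Suc by (metis less_irrefl)
qed

end

section \<open>Words in free variables\<close>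

lemma bop_scaleC_left [simp]: "(a *\<^sub>C S) * T = a *\<^sub>C (S * T)" for S T :: "'h::chilbert_space bop"
  by (rule bop_eqI) simp

lemma bop_scaleC_right [simp]: "S * (a *\<^sub>C T) = a *\<^sub>C (S * T)" for S T :: "'h::chilbert_space bop"
  by (rule bop_eqI) simp

lemma scaleC_sum_right: "a *\<^sub>C (\<Sum>i\<in>I. f i) = (\<Sum>i\<in>I. a *\<^sub>C f i)"
  for f :: "'i \<Rightarrow> 'a::complex_vector"
  by (induction I rule: infinite_finite_induct) (simp_all add: scaleC_zero_right scaleC_add_right)

lemma is_adjoint_1: "is_adjoint 1 1"
  by (simp add: is_adjoint_def)

lemma is_adjoint_0: "is_adjoint 0 0"
  by (simp add: is_adjoint_def cinner_zero_left cinner_zero_right)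

lemma is_adjoint_mult: "is_adjoint S T \<Longrightarrow> is_adjoint S' T' \<Longrightarrow> is_adjoint (S' * S) (T * T')"
  by (simp add: is_adjoint_def)

lemma is_adjoint_add: "is_adjoint S T \<Longrightarrow> is_adjoint S' T' \<Longrightarrow> is_adjoint (S + S') (T + T')"
  by (simp add: is_adjoint_def cinner_add_left cinner_add_right)

lemma is_adjoint_scaleC: "is_adjoint S T \<Longrightarrow> is_adjoint (cnj a *\<^sub>C S) (a *\<^sub>C T)"
  by (simp add: is_adjoint_def cinner_scaleC_left cinner_scaleC_right)

lemma is_adjoint_sum:
  "(\<And>i. i \<in> I \<Longrightarrow> is_adjoint (f i) (g i)) \<Longrightarrow> is_adjoint (\<Sum>i\<in>I. f i) (\<Sum>i\<in>I. g i)"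
  by (induction I rule: infinite_finite_induct) (simp_all add: is_adjoint_0 is_adjoint_add)

lemma is_adjoint_power: "is_adjoint S T \<Longrightarrow> is_adjoint (S ^ k) (T ^ k)"
proof (induction k)
  case (Suc k)
  have "is_adjoint (S ^ k * S) (T * T ^ k)" using Suc by (intro is_adjoint_mult) auto
  then show ?case by (simp add: power_commutes)
qed (simp add: is_adjoint_1)

lemma polynomial_algebraI: "(\<Sum>k\<le>d. c k *\<^sub>C X ^ k) \<in> polynomial_algebra X"
  unfolding polynomial_algebra_def by blast

lemma polynomial_algebra_mult_X:
  assumes "a \<in> polynomial_algebra X"
  shows "X * a \<in> polynomial_algebra X"
proof -
  obtain c d where a: "a = (\<Sum>k\<le>d. c k *\<^sub>C X ^ k)" using assms unfolding polynomial_algebra_def by blast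
  have "X * a = (\<Sum>k\<le>Suc d. (case k of 0 \<Rightarrow> 0 | Suc j \<Rightarrow> c j) *\<^sub>C X ^ k)"
    unfolding sum.atMost_Suc_shift by (simp add: a sum_distrib_left scaleC_zero_left)
  then show ?thesis using polynomial_algebraI[of "\<lambda>k. case k of 0 \<Rightarrow> 0 | Suc j \<Rightarrow> c j" X "Suc d"] by simp
qed

lemma polynomial_algebra_add_scalar:
  assumes "a \<in> polynomial_algebra X"
  shows "a + e *\<^sub>C 1 \<in> polynomial_algebra X"
proof -
  obtain c d where a: "a = (\<Sum>k\<le>d. c k *\<^sub>C X ^ k)" using assms unfolding polynomial_algebra_def by blast
  have "a + e *\<^sub>C 1 = (\<Sum>k\<le>d. (c(0 := c 0 + e)) k *\<^sub>C X ^ k)"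
    unfolding a sum.atMost_shift by (simp add: scaleC_add_left)
  then show ?thesis using polynomial_algebraI[of "c(0 := c 0 + e)" X d] by simp
qed

lemma X_in_polynomial_algebra: "X \<in> polynomial_algebra X"
  using polynomial_algebraI[of "\<lambda>k. if k = 1 then 1 else 0" X 1] by (simp add: scaleC_zero_left scaleC_one)

lemma not_distinct_adjE:
  assumes "\<not> distinct_adj w"
  obtains u k v where "w = u @ k # k # v"
  using assms
proof (induction w arbitrary: thesis rule: induct_list012)
  case (3 x y zs)
  show ?case
  proof (cases "x = y")
    case True
    then show ?thesis using 3(3)[of "[]" x zs] by simp
  next
    case False
    then have "\<not> distinct_adj (y # zs)" using 3(4) by simp
    then obtain u k v where "y # zs = u @ k # k # v" using 3(2) by blast
    then show ?thesis using 3(3)[of "x # u" k v] by simp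
  qed
qed simp_all

lemma distinct_adj_if_distinct: "distinct xs \<Longrightarrow> distinct_adj xs"
  by (induction xs) (auto simp: distinct_adj_Cons)

section \<open>Cauchy-Schwarz for the trace\<close>

locale tracial_space =
  fixes M :: "'h::chilbert_space bop set" and \<tau> :: "'h bop \<Rightarrow> complex"
  assumes tracial_ncps: "tracial_ncps M \<tau>"
begin

lemma M_1: "1 \<in> M" and M_add: "S \<in> M \<Longrightarrow> T \<in> M \<Longrightarrow> S + T \<in> M"
  and M_mult: "S \<in> M \<Longrightarrow> T \<in> M \<Longrightarrow> S * T \<in> M" and M_scale: "T \<in> M \<Longrightarrow> a *\<^sub>C T \<in> M"
  using tracial_ncps by (auto simp: tracial_ncps_def von_neumann_algebra_def)

lemma M_0: "0 \<in> M"
  using M_scale[OF M_1, of 0] by (simp add: scaleC_zero_left)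

lemma M_sum: "(\<And>i. i \<in> I \<Longrightarrow> f i \<in> M) \<Longrightarrow> (\<Sum>i\<in>I. f i) \<in> M"
  by (induction I rule: infinite_finite_induct) (simp_all add: M_0 M_add)

lemma M_power: "T \<in> M \<Longrightarrow> T ^ k \<in> M"
  by (induction k) (simp_all add: M_1 M_mult)

lemma M_prod_list: "set xs \<subseteq> M \<Longrightarrow> prod_list xs \<in> M"
  by (induction xs) (simp_all add: M_1 M_mult)

lemma M_polynomial_algebra: "X \<in> M \<Longrightarrow> polynomial_algebra X \<subseteq> M"
  unfolding polynomial_algebra_def by (auto intro!: M_sum M_scale M_power)

lemmas M_intros = M_1 M_add M_mult M_scale M_sum M_power

lemma tr_add: "S \<in> M \<Longrightarrow> T \<in> M \<Longrightarrow> \<tau> (S + T) = \<tau> S + \<tau> T"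
  and tr_scale: "T \<in> M \<Longrightarrow> \<tau> (a *\<^sub>C T) = a * \<tau> T"
  and tr_1: "\<tau> 1 = 1"
  and tr_pos: "S \<in> M \<Longrightarrow> T \<in> M \<Longrightarrow> is_adjoint S T \<Longrightarrow> \<tau> (S * T) \<in> \<real>\<^sub>\<ge>\<^sub>0"
  and tr_commute: "S \<in> M \<Longrightarrow> T \<in> M \<Longrightarrow> \<tau> (S * T) = \<tau> (T * S)"
  using tracial_ncps by (auto simp: tracial_ncps_def state_on_def tracial_on_def)

lemma tr_0: "\<tau> 0 = 0"
  using tr_scale[OF M_1, of 0] by (simp add: scaleC_zero_left)

lemma tr_sum: "(\<And>i. i \<in> I \<Longrightarrow> f i \<in> M) \<Longrightarrow> \<tau> (\<Sum>i\<in>I. f i) = (\<Sum>i\<in>I. \<tau> (f i))"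
  by (induction I rule: infinite_finite_induct) (simp_all add: tr_0 tr_add M_sum)

context
  fixes x x' y y' :: "'h bop"
  assumes mem: "x \<in> M" "x' \<in> M" "y \<in> M" "y' \<in> M" and adj: "is_adjoint x' x" "is_adjoint y' y"
begin

text \<open>Positivity at x + t y. Adjoints appear as explicit partners \<open>x'\<close> and
  \<open>y'\<close> because \<open>is_adjoint\<close> is a relation.\<close>

lemma tr_sesquilinear_pos:
  "\<tau> (x' * x) + t * \<tau> (x' * y) + cnj t * \<tau> (y' * x) + cnj t * t * \<tau> (y' * y) \<in> \<real>\<^sub>\<ge>\<^sub>0"
proof -
  have "\<tau> ((x' + cnj t *\<^sub>C y') * (x + t *\<^sub>C y)) \<in> \<real>\<^sub>\<ge>\<^sub>0"
    by (intro tr_pos M_intros mem is_adjoint_add is_adjoint_scaleC adj)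
  also have "(x' + cnj t *\<^sub>C y') * (x + t *\<^sub>C y) =
      x' * x + t *\<^sub>C (x' * y) + (cnj t *\<^sub>C (y' * x) + (cnj t * t) *\<^sub>C (y' * y))"
    by (simp add: distrib_left distrib_right scaleC_scaleC scaleC_add_right mult.commute add_ac)
  also have "\<tau> \<dots> = \<tau> (x' * x) + t * \<tau> (x' * y) + cnj t * \<tau> (y' * x) + cnj t * t * \<tau> (y' * y)"
    by (simp add: tr_add tr_scale M_intros mem)
  finally show ?thesis .
qed

text \<open>The form is real at t = 1 and at t = i, which compares first the imaginary and then the
  real parts.\<close>

lemma tr_adjoint: "\<tau> (y' * x) = cnj (\<tau> (x' * y))"
proof -
  have a: "Im (\<tau> (x' * x)) = 0" "Im (\<tau> (y' * y)) = 0"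
    using tr_pos mem adj by (auto simp: complex_nonneg_Reals_iff)
  have "Im (\<tau> (x' * x) + 1 * \<tau> (x' * y) + cnj 1 * \<tau> (y' * x) + cnj 1 * 1 * \<tau> (y' * y)) = 0"
    "Im (\<tau> (x' * x) + \<i> * \<tau> (x' * y) + cnj \<i> * \<tau> (y' * x) + cnj \<i> * \<i> * \<tau> (y' * y)) = 0"
    using tr_sesquilinear_pos[of 1] tr_sesquilinear_pos[of \<i>] by (auto simp: complex_nonneg_Reals_iff)
  then show ?thesis using a by (auto simp: complex_eq_iff)
qed

lemma tr_Cauchy_Schwarz: "(cmod (\<tau> (x' * y)))\<^sup>2 \<le> Re (\<tau> (x' * x)) * Re (\<tau> (y' * y))"
proof -
  define a b c where "a = Re (\<tau> (x' * x))" and "b = \<tau> (x' * y)" and "c = Re (\<tau> (y' * y))"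
  have real: "\<tau> (x' * x) = of_real a" "\<tau> (y' * y) = of_real c" "a \<ge> 0" "c \<ge> 0"
    using tr_pos mem adj by (auto simp: complex_nonneg_Reals_iff a_def c_def complex_eq_iff)
  have q: "0 \<le> a - 2 * s * (cmod b)\<^sup>2 + s\<^sup>2 * (cmod b)\<^sup>2 * c" for s :: real
  proof -
    \<comment> \<open>This choice makes each of the two mixed terms equal to -s |b|^2.\<close>
    let ?t = "- of_real s * cnj b"
    have "\<tau> (x' * x) + ?t * \<tau> (x' * y) + cnj ?t * \<tau> (y' * x) + cnj ?t * ?t * \<tau> (y' * y) =
        of_real a - of_real s * (b * cnj b) - of_real s * (b * cnj b) + of_real (s\<^sup>2) * (b * cnj b) * of_real c"
      unfolding tr_adjoint real b_def[symmetric] by (simp add: power2_eq_square)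
    also have "\<dots> = of_real (a - 2 * s * (cmod b)\<^sup>2 + s\<^sup>2 * (cmod b)\<^sup>2 * c)"
      by (simp only: complex_norm_square[symmetric]) simp
    finally show ?thesis using tr_sesquilinear_pos[of ?t] by (simp add: complex_nonneg_Reals_iff)
  qed
  show ?thesis
  proof (cases "c = 0")
    case True
    have "b = 0"
    proof (rule ccontr)
      assume "b \<noteq> 0"
      \<comment> \<open>For \<open>c = 0\<close> the form is linear in \<open>s\<close>, and this
        \<open>s\<close> would bring it down to -1.\<close>
      then have "2 * ((a + 1) / (2 * (cmod b)\<^sup>2)) * (cmod b)\<^sup>2 = a + 1" by simp
      then show False using q[of "(a + 1) / (2 * (cmod b)\<^sup>2)"] True by simp
    qed
    then show ?thesis using real by (simp add: a_def[symmetric] b_def[symmetric] c_def[symmetric])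
  next
    case False
    then have c: "c > 0" using real by simp
    have "0 \<le> a - (cmod b)\<^sup>2 / c" using q[of "1 / c"] c by (simp add: power2_eq_square)
    then show ?thesis using c by (simp add: a_def[symmetric] b_def[symmetric] c_def[symmetric] field_simps)
  qed
qed

end

lemma tr_selfadjoint_real:
  assumes "T \<in> M" "is_adjoint T T"
  shows "Im (\<tau> T) = 0"
  using tr_adjoint[of 1 1 T T] assms M_1 is_adjoint_1 by (auto simp: complex_eq_iff)

end

section \<open>Traces of words in free copies\<close>

locale free_copies = tracial_space M \<tau>
  for M :: "'h::chilbert_space bop set" and \<tau> :: "'h bop \<Rightarrow> complex" +
  fixes X :: "nat \<Rightarrow> 'h bop" and mu :: "nat \<Rightarrow> complex"
  assumes X_M: "\<And>k. k \<ge> 1 \<Longrightarrow> X k \<in> M"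
    and X_sa: "\<And>k. k \<ge> 1 \<Longrightarrow> is_adjoint (X k) (X k)"
    and X_mu: "\<And>k m. k \<ge> 1 \<Longrightarrow> \<tau> (X k ^ m) = mu m"
    and mu_1: "mu 1 = 0" and mu_2: "mu 2 = 1"
    and X_free: "free_variables \<tau> {1..} X"
begin

definition xw :: "nat list \<Rightarrow> 'h bop" where
  "xw w = prod_list (map X w)"

lemma xw_simps [simp]: "xw [] = 1" "xw (k # w) = X k * xw w" "xw (u @ v) = xw u * xw v"
  by (simp_all add: xw_def)

lemma xw_M: "set w \<subseteq> {1..} \<Longrightarrow> xw w \<in> M"
  unfolding xw_def by (rule M_prod_list) (use X_M in auto)

lemma xw_adjoint: "set w \<subseteq> {1..} \<Longrightarrow> is_adjoint (xw (rev w)) (xw w)"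
  by (induction w) (auto intro!: is_adjoint_mult X_sa is_adjoint_1 simp: mult_1_right)

abbreviation "P k \<equiv> polynomial_algebra (X k)"

text \<open>Freeness speaks only about alternating products of centered factors. This is the linear
  span of those avoiding the index \<open>k\<close>; the empty product contributes the unit.\<close>

inductive_set alt_span :: "nat \<Rightarrow> 'h bop set" for k where
  base: "distinct_adj (map fst ps) \<Longrightarrow> \<forall>(i, a)\<in>set ps. i \<ge> 1 \<and> i \<noteq> k \<and> a \<in> P i \<and> \<tau> a = 0 \<Longrightarrow>
    prod_list (map snd ps) \<in> alt_span k"
| add: "x \<in> alt_span k \<Longrightarrow> y \<in> alt_span k \<Longrightarrow> x + y \<in> alt_span k"
| scale: "x \<in> alt_span k \<Longrightarrow> a *\<^sub>C x \<in> alt_span k"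

lemma alt_span_M: "x \<in> alt_span k \<Longrightarrow> x \<in> M"
proof (induction rule: alt_span.induct)
  case (base ps)
  then show ?case using M_polynomial_algebra X_M by (intro M_prod_list) fastforce
qed (auto intro: M_intros)

lemma P_M: "k \<ge> 1 \<Longrightarrow> a \<in> P k \<Longrightarrow> a \<in> M"
  using M_polynomial_algebra X_M by blast

text \<open>If the product already starts with index \<open>j\<close>, merging the two factors
  destroys centering. Splitting the merged factor into a centered part and a scalar restores it, and
  the scalar term is a shorter alternating product.\<close>

lemma alt_span_mult:
  assumes j: "j \<ge> 1" "j \<noteq> k" and x: "x \<in> alt_span k"
  shows "X j * x \<in> alt_span k"
  using x
proof (induction rule: alt_span.induct)
  case (base ps)
  have tau_X: "\<tau> (X j) = 0" using X_mu[of j 1] j mu_1 by simp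
  show ?case
  proof (cases "ps \<noteq> [] \<and> fst (hd ps) = j")
    case False
    have "distinct_adj (map fst ((j, X j) # ps))"
      using base(1) False by (cases ps) (auto simp: distinct_adj_Cons)
    then show ?thesis
      using alt_span.base[of "(j, X j) # ps" k] base(2) j tau_X by (auto simp: X_in_polynomial_algebra)
  next
    case True
    then obtain a qs where ps: "ps = (j, a) # qs" by (cases ps) auto
    define b where "b = X j * a"
    have b: "b \<in> P j" using base(2) ps by (auto simp: b_def polynomial_algebra_mult_X)
    define b' where "b' = b + (- \<tau> b) *\<^sub>C 1"
    have b': "b' \<in> P j" "\<tau> b' = 0"
      using b P_M[OF j(1) b] by (simp_all add: b'_def polynomial_algebra_add_scalar tr_add tr_scale M_intros tr_1)
    have "distinct_adj (map fst ((j, b') # qs))" "distinct_adj (map fst qs)"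
      using base(1) by (auto simp: ps distinct_adj_Cons)
    then have 1: "b' * prod_list (map snd qs) \<in> alt_span k" and 2: "prod_list (map snd qs) \<in> alt_span k"
      using alt_span.base[of "(j, b') # qs" k] alt_span.base[of qs k] base(2) j b' by (auto simp: ps)
    have "b = b' + \<tau> b *\<^sub>C 1" by (simp add: b'_def add.assoc scaleC_add_left[symmetric] scaleC_zero_left)
    then have "X j * prod_list (map snd ps) = b' * prod_list (map snd qs) + \<tau> b *\<^sub>C prod_list (map snd qs)"
      by (simp add: ps b_def mult.assoc[symmetric]) (metis bop_scaleC_left distrib_right mult_1_left)
    then show ?thesis using 1 2 by (simp add: alt_span.add alt_span.scale)
  qed
next
  case (add x y)
  then show ?case by (simp add: distrib_left alt_span.add)
next
  case (scale x a)
  then show ?case by (simp add: alt_span.scale)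
qed

lemma xw_alt_span:
  assumes "set w \<subseteq> {1..}" "k \<notin> set w"
  shows "xw w \<in> alt_span k"
  using assms
proof (induction w)
  case Nil
  then show ?case using alt_span.base[of "[]" k] by simp
qed (auto intro: alt_span_mult)

text \<open>Neither side contains the index \<open>k\<close>, so a centered element of
  \<open>P k\<close> between two alternating products yields an alternating product again; the spans
  follow by linearity.\<close>

lemma free_centered:
  assumes "x \<in> alt_span k" "y \<in> alt_span k" and k: "k \<ge> 1" and a: "a \<in> P k" "\<tau> a = 0"
  shows "\<tau> (x * a * y) = 0"
  using assms(1)
proof (induction rule: alt_span.induct)
  case (base ps)
  show ?case using assms(2)
  proof (induction rule: alt_span.induct)
    case (base qs)
    let ?w = "ps @ (k, a) # qs"
    have "distinct_adj (map fst ?w)"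
      using base \<open>distinct_adj (map fst ps)\<close> \<open>\<forall>(i, a)\<in>set ps. _ i a\<close>
      by (cases ps rule: rev_cases; cases qs)
         (auto simp: distinct_adj_append_iff distinct_adj_Cons)
    moreover have "\<forall>(i, a)\<in>set ?w. i \<in> {1..} \<and> a \<in> P i \<and> \<tau> a = 0"
      using base \<open>\<forall>(i, a)\<in>set ps. _ i a\<close> k a by auto
    ultimately have "\<tau> (prod_list (map snd ?w)) = 0"
      using X_free unfolding free_variables_def free_family_def by blast
    then show ?case by (simp add: mult.assoc)
  next
    case (add y z)
    have "prod_list (map snd ps) \<in> M" using base by (intro alt_span_M[of _ k] alt_span.base)
    then show ?case
      using add P_M[OF k a(1)] by (simp add: distrib_left tr_add M_intros alt_span_M)
  next
    case (scale y c)
    have "prod_list (map snd ps) \<in> M" using base by (intro alt_span_M[of _ k] alt_span.base)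
    then show ?case
      using scale P_M[OF k a(1)] by (simp add: tr_scale M_intros alt_span_M)
  qed
next
  case (add x z)
  then show ?case
    using P_M[OF k a(1)] assms(2) by (simp add: distrib_right tr_add M_intros alt_span_M)
next
  case (scale x c)
  then show ?case
    using P_M[OF k a(1)] assms(2) by (simp add: tr_scale M_intros alt_span_M)
qed

text \<open>Centering \<open>a\<close> splits off the scalar, and the centered remainder has trace
  zero by \<open>free_centered\<close>. Applied to \<open>X k\<close> and to its square, this
  deletes lone letters and adjacent pairs.\<close>

lemma free_factor:
  assumes uv: "set u \<subseteq> {1..}" "set v \<subseteq> {1..}" "k \<notin> set u" "k \<notin> set v" and k: "k \<ge> 1" and a: "a \<in> P k"
  shows "\<tau> (xw u * a * xw v) = \<tau> a * \<tau> (xw (u @ v))"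
proof -
  define a' where "a' = a + (- \<tau> a) *\<^sub>C 1"
  have aM: "a \<in> M" by (rule P_M[OF k a])
  have a': "a' \<in> P k" "\<tau> a' = 0" "a' \<in> M"
    using a aM by (simp_all add: a'_def polynomial_algebra_add_scalar tr_add tr_scale M_intros tr_1)
  have eq: "a' + \<tau> a *\<^sub>C 1 = a" by (simp add: a'_def add.assoc scaleC_add_left[symmetric] scaleC_zero_left)
  have "xw u * (a' + \<tau> a *\<^sub>C 1) * xw v = xw u * a' * xw v + \<tau> a *\<^sub>C (xw u * xw v)"
    by (simp add: distrib_left distrib_right)
  then have "xw u * a * xw v = xw u * a' * xw v + \<tau> a *\<^sub>C (xw u * xw v)"
    by (simp only: eq)
  moreover have "\<tau> (xw u * a' * xw v) = 0"
    by (intro free_centered[of _ k] xw_alt_span uv k a')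
  ultimately show ?thesis
    using uv a' by (simp add: tr_add tr_scale M_intros xw_M)
qed

lemma tr_xw_singleton:
  assumes "set w \<subseteq> {1..}" "count_list w k = 1"
  shows "\<tau> (xw w) = 0"
proof -
  have "k \<in> set w" using assms(2) by (metis count_notin zero_neq_one)
  then obtain u v where w: "w = u @ k # v" "k \<notin> set u" by (metis split_list_first)
  have "k \<notin> set v" using assms(2) w by (simp add: count_notin count_list_0_iff)
  moreover have "\<tau> (X k) = 0" using X_mu[of k 1] assms(1) w mu_1 by auto
  ultimately show ?thesis
    using free_factor[of u v k "X k"] assms(1) w by (auto simp: X_in_polynomial_algebra mult.assoc)
qed

lemma tr_xw_pair:
  assumes "set u \<subseteq> {1..}" "set v \<subseteq> {1..}" "k \<notin> set u" "k \<notin> set v" "k \<ge> 1"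
  shows "\<tau> (xw (u @ k # k # v)) = \<tau> (xw (u @ v))"
  using free_factor[OF assms, of "X k * X k"] X_mu[of k 2] assms(5) mu_2
  by (simp add: X_in_polynomial_algebra polynomial_algebra_mult_X mult.assoc power2_eq_square)

lemma tr_xw_distinct_adj:
  assumes "set w \<subseteq> {1..}" "distinct_adj w" "w \<noteq> []"
  shows "\<tau> (xw w) = 0"
proof -
  let ?ps = "map (\<lambda>i. (i, X i)) w"
  have "\<forall>(i, a)\<in>set ?ps. i \<in> {1..} \<and> a \<in> P i \<and> \<tau> a = 0"
  proof -
    have "\<tau> (X i) = 0" if "i \<in> set w" for i using that assms(1) X_mu[of i 1] mu_1 by auto
    then show ?thesis using assms(1) by (auto simp: X_in_polynomial_algebra)
  qed
  moreover have "distinct_adj (map fst ?ps)" using assms(2) by (simp add: o_def)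
  ultimately have "\<tau> (prod_list (map snd ?ps)) = 0"
    using X_free assms(3) unfolding free_variables_def free_family_def by blast
  then show ?thesis by (simp add: xw_def o_def)
qed

text \<open>Trace and pairing number follow the same reduction: an adjacent pair can be deleted from
  both, and a nonempty word without equal neighbours gives zero for both.\<close>

lemma tr_xw_pairing:
  assumes "set w \<subseteq> {1..}" "\<And>k. k \<in> set w \<Longrightarrow> count_list w k = 2"
  shows "\<tau> (xw w) = of_nat (nc_pairings w)"
  using assms
proof (induction w rule: length_induct)
  case (1 w)
  show ?case
  proof (cases "distinct_adj w")
    case True
    then show ?thesis
      using tr_xw_distinct_adj[of w] nc_pairings_distinct_adj[of w] 1(2) tr_1 by (cases "w = []") auto
  next
    case False
    then obtain u k v where w: "w = u @ k # k # v" by (rule not_distinct_adjE)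
    have "count_list w k = 2" using 1(3)[of k] w by simp
    then have k: "k \<notin> set u" "k \<notin> set v" by (auto simp: w count_list_0_iff)
    have "count_list (u @ v) j = 2" if "j \<in> set (u @ v)" for j
      using 1(3)[of j] that k by (auto simp: w split: if_splits)
    then have "\<tau> (xw (u @ v)) = of_nat (nc_pairings (u @ v))"
      using 1(1)[rule_format, of "u @ v"] 1(2) w by simp
    then show ?thesis
      using tr_xw_pair[of u v k] nc_pairings_adjacent[OF k] 1(2) k unfolding w by auto
  qed
qed

lemma tr_xw_rotate: "set (u @ v) \<subseteq> {1..} \<Longrightarrow> \<tau> (xw (u @ v)) = \<tau> (xw (v @ u))"
  by (simp add: tr_commute xw_M)

lemma tr_xw_reflect:
  assumes "set (u @ v) \<subseteq> {1..}"
  shows "(cmod (\<tau> (xw (u @ v))))\<^sup>2 \<le> cmod (\<tau> (xw (u @ rev u))) * cmod (\<tau> (xw (rev v @ v)))"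
proof -
  have "(cmod (\<tau> (xw u * xw v)))\<^sup>2 \<le> Re (\<tau> (xw u * xw (rev u))) * Re (\<tau> (xw (rev v) * xw v))"
    using assms xw_adjoint[of "rev u"] xw_adjoint[of v]
    by (intro tr_Cauchy_Schwarz) (auto simp: xw_M)
  also have "\<dots> \<le> cmod (\<tau> (xw u * xw (rev u))) * cmod (\<tau> (xw (rev v) * xw v))"
  proof (intro mult_mono complex_Re_le_cmod)
    show "0 \<le> Re (\<tau> (xw (rev v) * xw v))"
      using assms xw_adjoint[of v] tr_pos[of "xw (rev v)" "xw v"]
      by (auto simp: xw_M complex_nonneg_Reals_iff)
  qed simp
  finally show ?thesis by simp
qed

text \<open>
  Reflecting a maximising word by Cauchy-Schwarz and rotating it by traciality keeps it
  maximising and extends its initial constant run, so a constant word is maximising.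
\<close>

lemma cmod_tr_xw_le:
  assumes w: "w \<in> words n (2 * m)" and m: "m \<ge> 1"
  shows "cmod (\<tau> (xw w)) \<le> cmod (mu (2 * m))"
proof -
  define f where "f w = cmod (\<tau> (xw w))" for w
  define B where "B = Max (f ` words n (2 * m))"
  have sub: "set w \<subseteq> {1..}" if "w \<in> words n k" for w k using that by (auto simp: words_def)
  have B_ge: "f w \<le> B" if "w \<in> words n (2 * m)" for w unfolding B_def using that by (intro Max_ge) auto
  obtain w\<^sub>0 where w\<^sub>0: "w\<^sub>0 \<in> words n (2 * m)" "f w\<^sub>0 = B"
  proof -
    have "B \<in> f ` words n (2 * m)" unfolding B_def by (rule Max_in) (use w in auto)
    then show ?thesis using that by blast
  qed
  \<comment> \<open>In the reflection inequality the factor coming from \<open>v\<close> is at most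
    \<open>B\<close>, so the word reflected from \<open>u\<close> attains the maximum too.\<close>
  have refl: "u @ rev u \<in> words n (2 * m) \<and> f (u @ rev u) = B"
    if uv: "u @ v \<in> words n (2 * m)" "f (u @ v) = B" "length u = m" for u v
  proof -
    have mem: "u @ rev u \<in> words n (2 * m)" "rev v @ v \<in> words n (2 * m)"
      using uv by (auto simp: words_def)
    have "B * B \<le> f (u @ rev u) * f (rev v @ v)"
      using tr_xw_reflect[of u v] sub[OF uv(1)] uv(2) by (simp add: f_def power2_eq_square)
    also have "\<dots> \<le> f (u @ rev u) * B" using B_ge[OF mem(2)] by (intro mult_left_mono) (auto simp: f_def)
    finally have "B \<le> f (u @ rev u) \<or> B = 0"
      using uv(2) by (auto simp: f_def mult_le_cancel_right)
    moreover have "0 \<le> f (u @ rev u)" by (simp add: f_def)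
    ultimately show ?thesis using mem B_ge[OF mem(1)] by auto
  qed
  have run: "\<exists>k w'. replicate r k @ w' \<in> words n (2 * m) \<and> f (replicate r k @ w') = B" if "r \<le> 2 * m" for r
    using that
  proof (induction r)
    case 0
    then show ?case using w\<^sub>0 by auto
  next
    case (Suc r)
    then obtain k w' where kw: "replicate r k @ w' \<in> words n (2 * m)" "f (replicate r k @ w') = B" by auto
    have len: "r + length w' = 2 * m" using kw by (auto simp: words_def)
    show ?case
    proof (cases "r < m")
      \<comment> \<open>The run already fills the first half, so one reflection makes the whole word
        constant.\<close>
      case False
      define v where "v = drop m (replicate r k @ w')"
      have "replicate r k @ w' = replicate m k @ v"
        using False append_take_drop_id[of m "replicate r k @ w'"] by (simp add: v_def min_def)
      then have "replicate m k @ rev (replicate m k) \<in> words n (2 * m) \<and> f (replicate m k @ rev (replicate m k)) = B"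
        using refl[of "replicate m k" v] kw by simp
      moreover have "2 * m = Suc r + (2 * m - Suc r)" using Suc.prems by simp
      then have "replicate (2 * m) k = replicate (Suc r) k @ replicate (2 * m - Suc r) k"
        by (metis replicate_add)
      moreover have "replicate m k @ rev (replicate m k) = replicate (2 * m) k"
        by (simp add: mult_2 replicate_add)
      ultimately show ?thesis by metis
    next
      case True
      show ?thesis
      proof (cases "r = 0")
        case True
        then obtain k' w'' where "w' = k' # w''" using len m by (cases w') auto
        then show ?thesis using kw True by (intro exI[of _ k'] exI[of _ w'']) simp
      next
        case False
        define u where "u = take (m - r) w'"
        define v where "v = drop (m - r) w'"
        have "(replicate r k @ u) @ v = replicate r k @ w'" by (simp add: u_def v_def)
        moreover have "length (replicate r k @ u) = m" using \<open>r < m\<close> len by (simp add: u_def)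
        ultimately have *: "(replicate r k @ u) @ rev (replicate r k @ u) \<in> words n (2 * m)"
          "f ((replicate r k @ u) @ rev (replicate r k @ u)) = B"
          using refl[of "replicate r k @ u" v] kw by simp_all
        \<comment> \<open>Reflection puts a copy of the run at the end; rotating it to the front
          doubles the run, of which one additional letter is claimed.\<close>
        let ?w = "replicate r k @ u @ rev u"
        have "f (?w @ replicate r k) = B" "?w @ replicate r k \<in> words n (2 * m)" using * by simp_all
        then have "f (replicate r k @ ?w) = B" "replicate r k @ ?w \<in> words n (2 * m)"
          using tr_xw_rotate[of ?w "replicate r k"] sub[of "?w @ replicate r k"]
          by (auto simp: f_def words_def)
        moreover have "replicate r k @ ?w = replicate (Suc r) k @ (replicate (r - 1) k @ u @ rev u)"
        proof -
          obtain r' where r': "r = Suc r'" using False by (cases r) auto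
          have "replicate r k @ [k] = k # replicate r k" by (simp add: replicate_append_same)
          then show ?thesis by (simp add: r')
        qed
        ultimately show ?thesis by metis
      qed
    qed
  qed
  obtain k w' where kw: "replicate (2 * m) k @ w' \<in> words n (2 * m)" "f (replicate (2 * m) k @ w') = B"
    using run[of "2 * m"] by auto
  then have "w' = []" by (auto simp: words_def)
  moreover have "k \<ge> 1" using kw m by (auto simp: words_def)
  ultimately have "B = cmod (mu (2 * m))"
    using kw(2) X_mu[of k "2 * m"] by (simp add: f_def xw_def prod_list_replicate)
  then show ?thesis using B_ge[OF w] by (simp add: f_def)
qed

text \<open>At the seam two letters meet: equal ones cancel, different ones leave the whole word
  without equal neighbours. Thus words with distinct letters are orthonormal.\<close>

lemma tr_xw_rev_distinct:
  assumes "set u \<subseteq> {1..}" "set v \<subseteq> {1..}" "distinct u" "distinct v"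
  shows "\<tau> (xw (rev u @ v)) = of_bool (u = v)"
  using assms
proof (induction u arbitrary: v)
  case Nil
  show ?case
  proof (cases "v = []")
    case False
    then show ?thesis using tr_xw_distinct_adj[of v] Nil by (simp add: distinct_adj_if_distinct)
  qed (simp add: tr_1)
next
  case (Cons a u)
  show ?case
  proof (cases v)
    case Nil
    have "distinct_adj (rev (a # u))" using Cons.prems by (intro distinct_adj_if_distinct) simp
    then show ?thesis using tr_xw_distinct_adj[of "rev (a # u)"] Cons.prems Nil by simp
  next
    case (Cons b v')
    show ?thesis
    proof (cases "a = b")
      case True
      have "\<tau> (xw (rev u @ a # a # v')) = \<tau> (xw (rev u @ v'))"
        using Cons.prems Cons True by (intro tr_xw_pair) auto
      then show ?thesis using Cons.IH[of v'] Cons.prems Cons True by simp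
    next
      case False
      have "distinct_adj (rev (a # u) @ v)"
      proof -
        have "distinct_adj (rev (a # u))" "distinct_adj v"
          using Cons.prems by (intro distinct_adj_if_distinct; simp)+
        then show ?thesis unfolding distinct_adj_append_iff using Cons False by simp
      qed
      then show ?thesis using tr_xw_distinct_adj[of "rev (a # u) @ v"] Cons.prems Cons False by auto
    qed
  qed
qed

end

section \<open>The limit theorem\<close>

abbreviation "A\<^sub>0 \<equiv> order_weight \<alpha>\<^sub>0 \<beta>\<^sub>0"

lemma distinct_count_list: "distinct xs \<Longrightarrow> count_list xs a = of_bool (a \<in> set xs)"
  by (induction xs) auto

lemma norm_order_weight: "k \<noteq> l \<Longrightarrow> (cmod (A\<^sub>0 k l))\<^sup>2 = 1 / 2"
proof -
  have "(cmod \<alpha>\<^sub>0)\<^sup>2 = 1 / 2" "(cmod \<beta>\<^sub>0)\<^sup>2 = 1 / 2"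
    by (simp_all only: cmod_power2) (simp_all add: power2_eq_square)
  then show "k \<noteq> l \<Longrightarrow> (cmod (A\<^sub>0 k l))\<^sup>2 = 1 / 2" unfolding order_weight_def by (auto simp only: if_True if_False split: if_splits)
qed

lemma norm_order_weight_le: "cmod (A\<^sub>0 k l) \<le> 1"
proof (cases "k = l")
  case False
  then have "(cmod (A\<^sub>0 k l))\<^sup>2 \<le> 1\<^sup>2" by (simp add: norm_order_weight)
  then show ?thesis by (rule power2_le_imp_le) simp
qed (simp add: order_weight_def)

lemma norm_wt_le: "cmod (pair_weight A\<^sub>0 w) \<le> 1"
proof (induction A\<^sub>0 w rule: pair_weight.induct)
  case (1 a b w)
  then have "cmod (A\<^sub>0 a b) * cmod (pair_weight A\<^sub>0 w) \<le> 1 * 1"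
    by (intro mult_mono norm_order_weight_le) auto
  then show ?case by (simp add: norm_mult)
qed auto

text \<open>Distinct letters avoid the vanishing diagonal; the exact value enters the lower bound
  behind strict positivity.\<close>

lemma norm_wt_distinct: "distinct w \<Longrightarrow> length w = 2 * d \<Longrightarrow> (cmod (pair_weight A\<^sub>0 w))\<^sup>2 = (1 / 2) ^ d"
proof (induction d arbitrary: w)
  case (Suc d)
  then obtain a b v where w: "w = a # b # v" "length v = 2 * d"
    by (auto simp: length_Suc_conv)
  then show ?case
    using Suc norm_order_weight[of a b] by (simp add: norm_mult power_mult_distrib)
qed simp

lemma zigzag_cumulant_le: "cmod (fps_nth (cumulant_fps \<alpha>\<^sub>0 \<beta>\<^sub>0) k) \<le> 1"
proof (rule tendsto_upperbound)
  show "(\<lambda>n. cmod (scaled_trace \<alpha>\<^sub>0 \<beta>\<^sub>0 n (Suc k))) \<longlonglongrightarrow> cmod (fps_nth (cumulant_fps \<alpha>\<^sub>0 \<beta>\<^sub>0) k)"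
    by (intro tendsto_norm tendsto_scaled_trace) (simp add: complex_eq_iff)
  have "cmod \<alpha>\<^sub>0 \<le> 1" "cmod \<beta>\<^sub>0 \<le> 1"
    using norm_order_weight_le[of 0 1] norm_order_weight_le[of 1 0] by (simp_all add: order_weight_def)
  then show "\<forall>\<^sub>F n in sequentially. cmod (scaled_trace \<alpha>\<^sub>0 \<beta>\<^sub>0 n (Suc k)) \<le> 1"
    by (intro always_eventually allI norm_scaled_trace_le) auto
qed simp

text \<open>The shift is that of the R-transform, whose coefficient of z^n is the cumulant of order
  n + 1. The name refers to Euler's zigzag numbers, whose exponential generating function is tan +
  sec.\<close>

definition zigzag_cumulant :: "nat \<Rightarrow> complex" where
  "zigzag_cumulant k = fps_nth (cumulant_fps \<alpha>\<^sub>0 \<beta>\<^sub>0) (k - 1)"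

text \<open>Orthogonal polynomials are built over the reals; \<open>zigzag_moment_complex\<close>
  shows that nothing is lost by taking the real part.\<close>

definition zigzag_moment :: "nat \<Rightarrow> real" where
  "zigzag_moment m = Re (nc_moment zigzag_cumulant m)"

lemma tendsto_open_sum:
  "(\<lambda>n. open_sum n A\<^sub>0 m / of_nat n ^ m) \<longlonglongrightarrow> nc_moment zigzag_cumulant m"
proof -
  have "(\<lambda>n. nc_moment (scaled_trace \<alpha>\<^sub>0 \<beta>\<^sub>0 n) m) \<longlonglongrightarrow> nc_moment zigzag_cumulant m"
  proof (rule tendsto_nc_moment)
    fix k :: nat assume "k \<ge> 1"
    then show "(\<lambda>n. scaled_trace \<alpha>\<^sub>0 \<beta>\<^sub>0 n k) \<longlonglongrightarrow> zigzag_cumulant k"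
      using tendsto_scaled_trace[of \<alpha>\<^sub>0 \<beta>\<^sub>0 "k - 1"] by (simp add: zigzag_cumulant_def complex_eq_iff)
  qed
  moreover have "\<forall>\<^sub>F n in sequentially. nc_moment (scaled_trace \<alpha>\<^sub>0 \<beta>\<^sub>0 n) m = open_sum n A\<^sub>0 m / of_nat n ^ m"
    using eventually_ge_at_top[of 1]
  proof eventually_elim
    case (elim n)
    then show ?case
      using open_sum_eq_mom[of n A\<^sub>0 m] by (simp add: scaled_trace_def[abs_def])
  qed
  ultimately show ?thesis by (rule Lim_transform_eventually)
qed

section \<open>Moments of the quadratic form\<close>

definition quad_form :: "(nat \<Rightarrow> 'h::chilbert_space bop) \<Rightarrow> nat \<Rightarrow> 'h bop" where
  "quad_form X n = (1 / of_nat n) *\<^sub>C (\<Sum>k\<in>{1..n}. \<Sum>l\<in>{1..n}. A\<^sub>0 k l *\<^sub>C (X k * X l))"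

lemma quad_form_eq:
  "(1 / (2 * of_nat n)) *\<^sub>C (\<Sum>(k, l) \<in> {(k, l). 1 \<le> k \<and> k < l \<and> l \<le> n}.
      X k * X l + X l * X k + \<i> *\<^sub>C (X k * X l - X l * X k)) = quad_form X n"
proof -
  let ?D = "{(k, l). 1 \<le> k \<and> k < l \<and> l \<le> n}"
  let ?D' = "prod.swap ` ?D"
  let ?F = "\<lambda>(k, l). A\<^sub>0 k l *\<^sub>C (X k * X l)"
  have fin: "finite ?D" by (rule finite_subset[of _ "{1..n} \<times> {1..n}"]) auto
  have "(\<Sum>k\<in>{1..n}. \<Sum>l\<in>{1..n}. A\<^sub>0 k l *\<^sub>C (X k * X l)) = (\<Sum>p\<in>{1..n} \<times> {1..n}. ?F p)"
    by (simp add: sum.cartesian_product)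
  also have "\<dots> = (\<Sum>p\<in>?D \<union> ?D'. ?F p)"
  proof (rule sum.mono_neutral_right)
    show "\<forall>p\<in>{1..n} \<times> {1..n} - (?D \<union> ?D'). ?F p = 0"
    proof (rule ballI)
      fix p assume p: "p \<in> {1..n} \<times> {1..n} - (?D \<union> ?D')"
      obtain k l where kl: "p = (k, l)" by (cases p)
      have "(l, k) \<notin> ?D"
      proof
        assume "(l, k) \<in> ?D"
        then have "prod.swap (l, k) \<in> ?D'" by (rule imageI)
        then show False using p kl by simp
      qed
      then have "k = l" using p unfolding kl by auto
      then show "?F p = 0" unfolding kl by (simp add: order_weight_def scaleC_zero_left)
    qed
  qed auto
  also have "\<dots> = (\<Sum>p\<in>?D. ?F p) + (\<Sum>p\<in>?D'. ?F p)"
    using fin by (intro sum.union_disjoint) auto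
  also have "(\<Sum>p\<in>?D'. ?F p) = (\<Sum>p\<in>?D. ?F (prod.swap p))"
    by (subst sum.reindex) (auto simp: inj_on_def)
  finally have eq: "(\<Sum>k\<in>{1..n}. \<Sum>l\<in>{1..n}. A\<^sub>0 k l *\<^sub>C (X k * X l)) =
      (\<Sum>p\<in>?D. ?F p + ?F (prod.swap p))" by (simp add: sum.distrib)
  have "(\<Sum>(k, l)\<in>?D. X k * X l + X l * X k + \<i> *\<^sub>C (X k * X l - X l * X k)) =
      (\<Sum>p\<in>?D. 2 *\<^sub>C (?F p + ?F (prod.swap p)))"
  proof (intro sum.cong refl)
    fix p assume "p \<in> ?D"
    then obtain k l where p: "p = (k, l)" "k < l" by auto
    have "2 *\<^sub>C (\<alpha>\<^sub>0 *\<^sub>C S + \<beta>\<^sub>0 *\<^sub>C T) = S + T + \<i> *\<^sub>C (S - T)" for S T :: "'a bop"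
    proof -
      have "2 *\<^sub>C (\<alpha>\<^sub>0 *\<^sub>C S + \<beta>\<^sub>0 *\<^sub>C T) = (1 + \<i>) *\<^sub>C S + (1 + (- \<i>)) *\<^sub>C T"
      proof -
        have "2 * \<alpha>\<^sub>0 = 1 + \<i>" "2 * \<beta>\<^sub>0 = 1 + (- \<i>)" by simp_all
        then show ?thesis by (simp only: scaleC_add_right scaleC_scaleC)
      qed
      also have "(- \<i>) *\<^sub>C T = - (\<i> *\<^sub>C T)"
        using scaleC_add_left[of \<i> "- \<i>" T] by (simp add: scaleC_zero_left eq_neg_iff_add_eq_0 add.commute)
      then have "(1 + \<i>) *\<^sub>C S + (1 + (- \<i>)) *\<^sub>C T = S + T + \<i> *\<^sub>C (S - T)"
        by (simp only: scaleC_add_left scaleC_one scaleC_diff_right) (simp add: algebra_simps)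
      finally show ?thesis .
    qed
    then show "(case p of (k, l) \<Rightarrow> X k * X l + X l * X k + \<i> *\<^sub>C (X k * X l - X l * X k)) =
        2 *\<^sub>C (?F p + ?F (prod.swap p))"
      using p by (simp add: order_weight_def)
  qed
  then show ?thesis
    unfolding quad_form_def eq by (simp add: scaleC_sum_right[symmetric] scaleC_scaleC)
qed

context free_copies
begin

lemma words_pos: "w \<in> words n k \<Longrightarrow> set w \<subseteq> {1..}"
  by (auto simp: words_def)

lemma quad_form_M: "quad_form X n \<in> M"
  unfolding quad_form_def by (intro M_intros X_M) auto

text \<open>\<open>\<beta>\<^sub>0\<close> is the conjugate of \<open>\<alpha>\<^sub>0\<close>, so
  the coefficient matrix is Hermitian.\<close>

lemma quad_form_adjoint: "is_adjoint (quad_form X n) (quad_form X n)"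
proof -
  let ?S = "\<Sum>k\<in>{1..n}. \<Sum>l\<in>{1..n}. A\<^sub>0 k l *\<^sub>C (X k * X l)"
  have "is_adjoint (\<Sum>k\<in>{1..n}. \<Sum>l\<in>{1..n}. cnj (A\<^sub>0 k l) *\<^sub>C (X l * X k)) ?S"
    by (intro is_adjoint_sum is_adjoint_scaleC is_adjoint_mult X_sa) auto
  also have "(\<Sum>k\<in>{1..n}. \<Sum>l\<in>{1..n}. cnj (A\<^sub>0 k l) *\<^sub>C (X l * X k)) = ?S"
    by (subst sum.swap) (intro sum.cong refl; simp add: order_weight_def)
  finally show ?thesis
    using is_adjoint_scaleC[of ?S ?S "1 / of_nat n"] by (simp add: quad_form_def)
qed

lemma quad_form_power:
  "quad_form X n ^ m = (1 / of_nat n ^ m) *\<^sub>C (\<Sum>w\<in>words n (2 * m). pair_weight A\<^sub>0 w *\<^sub>C xw w)"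
proof (induction m)
  case (Suc m)
  have "(\<Sum>w\<in>words n (2 * Suc m). pair_weight A\<^sub>0 w *\<^sub>C xw w) =
      (\<Sum>k\<in>{1..n}. \<Sum>l\<in>{1..n}. \<Sum>w\<in>words n (2 * m). (A\<^sub>0 k l *\<^sub>C (X k * X l)) * (pair_weight A\<^sub>0 w *\<^sub>C xw w))"
    by (simp add: sum_words_Suc scaleC_scaleC mult.assoc mult.commute[of "pair_weight _ _"])
  also have "\<dots> = (\<Sum>k\<in>{1..n}. \<Sum>l\<in>{1..n}. A\<^sub>0 k l *\<^sub>C (X k * X l)) * (\<Sum>w\<in>words n (2 * m). pair_weight A\<^sub>0 w *\<^sub>C xw w)"
    unfolding sum_distrib_right unfolding sum_distrib_left ..
  finally have *: "(\<Sum>w\<in>words n (2 * Suc m). pair_weight A\<^sub>0 w *\<^sub>C xw w) = \<dots>" .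
  have "quad_form X n ^ Suc m =
      quad_form X n * ((1 / of_nat n ^ m) *\<^sub>C (\<Sum>w\<in>words n (2 * m). pair_weight A\<^sub>0 w *\<^sub>C xw w))"
    by (simp only: power_Suc Suc)
  then show ?case
    unfolding * by (simp add: quad_form_def scaleC_scaleC mult.commute)
qed (simp add: scaleC_one)

lemma tr_quad_form_power:
  "\<tau> (quad_form X n ^ m) = (\<Sum>w\<in>words n (2 * m). pair_weight A\<^sub>0 w * \<tau> (xw w)) / of_nat n ^ m"
proof -
  have "xw w \<in> M" if "w \<in> words n (2 * m)" for w by (rule xw_M[OF words_pos[OF that]])
  then show ?thesis unfolding quad_form_power by (simp add: tr_sum tr_scale M_sum M_scale)
qed

text \<open>A lone letter makes both sides zero, and words with all letters exactly twice agree by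
  \<open>tr_xw_pairing\<close>. In the remaining words every letter occurs at least twice and one
  more often, so 2m positions hold at most m - 1 letters.\<close>

lemma tr_xw_pairing_or_few_letters:
  assumes "w \<in> words n (2 * m)" "\<tau> (xw w) \<noteq> of_nat (nc_pairings w)"
  shows "card (set w) \<le> m - 1"
proof -
  have w: "set w \<subseteq> {1..}" "length w = 2 * m" using assms(1) by (auto simp: words_def)
  have "count_list w k \<noteq> 1" for k
    using assms(2) tr_xw_singleton[OF w(1), of k] nc_pairings_singleton[of w k] by auto
  then have ge: "2 \<le> count_list w k" if "k \<in> set w" for k
    using that by (metis count_list_0_iff One_nat_def Suc_1 less_2_cases not_less)
  obtain k where "k \<in> set w" "count_list w k \<noteq> 2" using tr_xw_pairing[OF w(1)] assms(2) by blast
  then have "(\<Sum>k\<in>set w. 2) < (\<Sum>k\<in>set w. count_list w k)"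
    using ge by (intro sum_strict_mono_ex1) (auto intro!: bexI[of _ k] simp: le_neq_implies_less)
  also have "\<dots> = 2 * m" using w by (simp add: sum_count_set)
  finally show ?thesis by simp
qed

text \<open>Only words with few letters contribute an error, each bounded independently of
  \<open>n\<close>; there are of order \<open>n ^ (m - 1)\<close> of them, against the divisor
  \<open>n ^ m\<close>.\<close>

lemma tr_quad_form_approx:
  assumes m: "m \<ge> 1" and n: "n \<ge> 1"
  shows "cmod (\<tau> (quad_form X n ^ m) - open_sum n A\<^sub>0 m / of_nat n ^ m) \<le>
    (cmod (mu (2 * m)) + fact (2 * m)) * real ((m - 1) ^ (2 * m)) / real n"
proof -
  define e where "e w = pair_weight A\<^sub>0 w * (\<tau> (xw w) - of_nat (nc_pairings w))" for w
  define C where "C = cmod (mu (2 * m)) + fact (2 * m)"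
  let ?B = "{w \<in> words n (2 * m). card (set w) \<le> m - 1}"
  have "cmod (e w) \<le> C" if w: "w \<in> words n (2 * m)" for w
  proof -
    have "cmod (\<tau> (xw w) - of_nat (nc_pairings w)) \<le> cmod (mu (2 * m)) + real (nc_pairings w)"
      using cmod_tr_xw_le[OF w m] norm_triangle_ineq4[of "\<tau> (xw w)" "of_nat (nc_pairings w)"] by simp
    also have "real (nc_pairings w) \<le> fact (2 * m)"
      using of_nat_mono[OF nc_pairings_le_fact[of w], where 'a = real] w by (simp add: words_def)
    finally have "cmod (\<tau> (xw w) - of_nat (nc_pairings w)) \<le> C" by (simp add: C_def)
    then have "cmod (pair_weight A\<^sub>0 w) * cmod (\<tau> (xw w) - of_nat (nc_pairings w)) \<le> 1 * C"
      by (intro mult_mono norm_wt_le) auto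
    then show ?thesis by (simp add: e_def norm_mult)
  qed
  then have "cmod (\<Sum>w\<in>?B. e w) \<le> (\<Sum>w\<in>?B. C)" by (intro sum_norm_le) auto
  also have "\<dots> = real (card ?B) * C" by simp
  also have "\<dots> \<le> real ((m - 1) ^ (2 * m) * n ^ (m - 1)) * C"
  proof (rule mult_right_mono)
    show "real (card ?B) \<le> real ((m - 1) ^ (2 * m) * n ^ (m - 1))"
      by (rule of_nat_mono[OF card_words_few_letters[OF n]])
    show "C \<ge> 0" by (simp add: C_def)
  qed
  finally have B: "cmod (\<Sum>w\<in>?B. e w) \<le> real ((m - 1) ^ (2 * m) * n ^ (m - 1)) * C" .
  have "(\<Sum>w\<in>words n (2 * m). e w) = (\<Sum>w\<in>?B. e w)"
    by (rule sum.mono_neutral_right) (use tr_xw_pairing_or_few_letters in \<open>auto simp: e_def\<close>)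
  moreover have "\<tau> (quad_form X n ^ m) - open_sum n A\<^sub>0 m / of_nat n ^ m =
      (\<Sum>w\<in>words n (2 * m). e w) / of_nat n ^ m"
    unfolding tr_quad_form_power open_sum_def e_def
    by (simp add: diff_divide_distrib right_diff_distrib sum_subtractf)
  ultimately have "cmod (\<tau> (quad_form X n ^ m) - open_sum n A\<^sub>0 m / of_nat n ^ m) =
      cmod (\<Sum>w\<in>?B. e w) / real n ^ m"
    by (simp add: norm_divide norm_power)
  also have "\<dots> \<le> real ((m - 1) ^ (2 * m) * n ^ (m - 1)) * C / real n ^ m"
    by (rule divide_right_mono[OF B]) simp
  also have "real n ^ m = real n ^ (m - 1) * real n"
    using m by (cases m) simp_all
  also have "real ((m - 1) ^ (2 * m) * n ^ (m - 1)) * C / (real n ^ (m - 1) * real n) =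
      C * real ((m - 1) ^ (2 * m)) / real n"
    using n by simp
  finally show ?thesis unfolding C_def .
qed

lemma tendsto_tr_quad_form: "(\<lambda>n. \<tau> (quad_form X n ^ m)) \<longlonglongrightarrow> nc_moment zigzag_cumulant m"
proof (cases "m = 0")
  case False
  define K where "K = (cmod (mu (2 * m)) + fact (2 * m)) * real ((m - 1) ^ (2 * m))"
  have "(\<lambda>n. \<tau> (quad_form X n ^ m) - open_sum n A\<^sub>0 m / of_nat n ^ m) \<longlonglongrightarrow> 0"
  proof (rule Lim_null_comparison)
    show "(\<lambda>n. K / real n) \<longlonglongrightarrow> 0" by (rule lim_const_over_n)
    show "\<forall>\<^sub>F n in sequentially.
        cmod (\<tau> (quad_form X n ^ m) - open_sum n A\<^sub>0 m / of_nat n ^ m) \<le> K / real n"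
      using eventually_ge_at_top[of 1]
    proof eventually_elim
      case (elim n)
      show ?case unfolding K_def by (rule tr_quad_form_approx) (use elim False in simp_all)
    qed
  qed
  from tendsto_add[OF this tendsto_open_sum[of m]] show ?thesis by simp
qed (simp add: tr_1)

text \<open>If \<open>w'\<close> repeats a letter, it has too few letters to contain all those of
  \<open>w\<close>, and a missing one becomes a lone letter. Otherwise orthonormality
  applies.\<close>

lemma tr_xw_rev_word:
  assumes "w \<in> words n (2 * d)" "distinct w" "w' \<in> words n (2 * k)" "k \<le> d"
  shows "\<tau> (xw (rev w) * xw w') = of_bool (w = w')"
proof (cases "distinct w'")
  case True
  then show ?thesis using tr_xw_rev_distinct[of w w'] assms words_pos by simp
next
  case False
  have "card (set w') < card (set w)"
  proof -
    have "card (set w') \<le> length w'" "card (set w') \<noteq> length w'"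
      using False card_length[of w'] card_distinct[of w'] by auto
    then show ?thesis using assms distinct_card[of w] by (simp add: words_def)
  qed
  then have "\<not> set w \<subseteq> set w'" by (meson List.finite_set card_mono not_less)
  then obtain a where a: "a \<in> set w" "a \<notin> set w'" by blast
  have "count_list (rev w @ w') a = 1"
    using a assms(2) by (simp add: distinct_count_list)
  then have "\<tau> (xw (rev w @ w')) = 0"
    using assms words_pos by (intro tr_xw_singleton) auto
  then show ?thesis using False assms(2) by auto
qed

text \<open>
  Testing \<open>p (Q\<^sub>n)\<close> against the part of \<open>Q\<^sub>n\<^sup>d\<close> with distinct indices, \<open>d\<close> the degree of \<open>p\<close>,
  sees only the leading coefficient; this excludes finitely supported limit distributions.
\<close>

lemma tr_poly_quad_form_ge:
  fixes p :: "real poly"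
  defines "d \<equiv> degree p"
  defines "Y \<equiv> \<lambda>n. \<Sum>i\<le>d. of_real (coeff p i) *\<^sub>C quad_form X n ^ i"
  assumes n: "n \<ge> 1" and W: "W = {w \<in> words n (2 * d). distinct w}" and "W \<noteq> {}"
  shows "(coeff p d)\<^sup>2 * (card W * (1 / 2) ^ d / n ^ (2 * d)) \<le> Re (\<tau> (Y n * Y n))"
proof -
  \<comment> \<open>\<open>e w\<close> is the coefficient of \<open>w\<close> in the
    \<open>d\<close>-th power of the quadratic form, so \<open>Z\<close> is the part of that power
    with distinct letters.\<close>
  define e where "e w = pair_weight A\<^sub>0 w / of_nat n ^ d" for w
  define Z where "Z = (\<Sum>w\<in>W. e w *\<^sub>C xw w)"
  define Z' where "Z' = (\<Sum>w\<in>W. cnj (e w) *\<^sub>C xw (rev w))"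
  define c where "c = card W * (1 / 2) ^ d / n ^ (2 * d)"
  have finW: "finite W" unfolding W by simp
  have WM: "xw w \<in> M" "xw (rev w) \<in> M" "set w \<subseteq> {1..}" if "w \<in> W" for w
  proof -
    show "set w \<subseteq> {1..}" using that words_pos unfolding W by blast
    then show "xw w \<in> M" "xw (rev w) \<in> M" by (auto intro!: xw_M simp del: One_nat_def)
  qed
  have ZM: "Z \<in> M" "Z' \<in> M" unfolding Z_def Z'_def by (auto intro!: M_intros WM)
  have YM: "Y n \<in> M" unfolding Y_def by (intro M_intros quad_form_M)
  have adj: "is_adjoint Z' Z"
    unfolding Z_def Z'_def by (intro is_adjoint_sum is_adjoint_scaleC xw_adjoint WM)
  have adjY: "is_adjoint (Y n) (Y n)"
  proof -
    have "is_adjoint (\<Sum>i\<le>d. cnj (of_real (coeff p i)) *\<^sub>C quad_form X n ^ i) (Y n)"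
      unfolding Y_def by (intro is_adjoint_sum is_adjoint_scaleC is_adjoint_power quad_form_adjoint)
    then show ?thesis by (simp add: Y_def)
  qed
  have e_sq: "(\<Sum>w\<in>W. cnj (e w) * e w) = of_real c"
  proof -
    have "cnj (e w) * e w = of_real ((1 / 2) ^ d / n ^ (2 * d))" if "w \<in> W" for w
    proof -
      have "(cmod (e w))\<^sup>2 = (1 / 2) ^ d / n ^ (2 * d)"
        using that norm_wt_distinct[of w d] unfolding W
        by (simp add: e_def norm_divide norm_power power_divide words_def power_mult[symmetric] mult.commute)
      then show ?thesis by (metis complex_norm_square mult.commute)
    qed
    then have "(\<Sum>w\<in>W. cnj (e w) * e w) = (\<Sum>w\<in>W. of_real ((1 / 2) ^ d / n ^ (2 * d)))"
      by (rule sum.cong[OF refl])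
    then show ?thesis by (simp add: c_def)
  qed
  \<comment> \<open>Pairing with \<open>Z'\<close> annihilates every word of even length up to
    \<open>2 * d\<close> outside \<open>W\<close>, hence all lower powers of the quadratic
    form.\<close>
  have pair: "\<tau> (Z' * xw w') = cnj (e w') * of_bool (w' \<in> W)"
    if "w' \<in> words n (2 * k)" "k \<le> d" for w' k
  proof -
    have M': "xw w' \<in> M" using that words_pos xw_M by blast
    have "\<tau> (Z' * xw w') = (\<Sum>w\<in>W. cnj (e w) * \<tau> (xw (rev w) * xw w'))"
      unfolding Z'_def sum_distrib_right by (simp add: tr_sum tr_scale M_intros WM M')
    also have "\<dots> = (\<Sum>w\<in>W. if w = w' then cnj (e w') else 0)"
      using tr_xw_rev_word that unfolding W by (intro sum.cong refl) auto
    also have "\<dots> = cnj (e w') * of_bool (w' \<in> W)" using finW by simp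
    finally show ?thesis .
  qed
  have ZZ: "\<tau> (Z' * Z) = of_real c"
  proof -
    have "\<tau> (Z' * Z) = (\<Sum>w\<in>W. e w * \<tau> (Z' * xw w))"
      unfolding Z_def sum_distrib_left by (simp add: tr_sum tr_scale M_intros WM ZM)
    also have "\<dots> = (\<Sum>w\<in>W. cnj (e w) * e w)"
      using pair[of _ d] unfolding W by (intro sum.cong refl) auto
    finally show ?thesis unfolding e_sq .
  qed
  have ZQ: "\<tau> (Z' * quad_form X n ^ i) = (if i = d then of_real c else 0)" if "i \<le> d" for i
  proof -
    have "\<tau> (Z' * quad_form X n ^ i) =
        (\<Sum>w\<in>words n (2 * i). pair_weight A\<^sub>0 w * (cnj (e w) * of_bool (w \<in> W))) / of_nat n ^ i"
    proof -
      have "\<tau> (Z' * quad_form X n ^ i) = (1 / of_nat n ^ i) * (\<Sum>w\<in>words n (2 * i). pair_weight A\<^sub>0 w * \<tau> (Z' * xw w))"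
      proof -
        have "Z' * xw w \<in> M" if "w \<in> words n (2 * i)" for w
          by (intro M_mult ZM xw_M[OF words_pos[OF that]])
        then show ?thesis
          unfolding quad_form_power bop_scaleC_right sum_distrib_left[of Z']
          by (simp add: tr_sum tr_scale M_sum M_scale)
      qed
      then show ?thesis using pair[OF _ that] by simp
    qed
    also have "(\<Sum>w\<in>words n (2 * i). pair_weight A\<^sub>0 w * (cnj (e w) * of_bool (w \<in> W))) =
        (\<Sum>w\<in>words n (2 * i) \<inter> W. pair_weight A\<^sub>0 w * cnj (e w))"
      by (simp add: of_bool_def if_distrib[of "\<lambda>x. _ * x"] sum.inter_restrict cong: if_cong)
    also have "(\<Sum>w\<in>words n (2 * i) \<inter> W. pair_weight A\<^sub>0 w * cnj (e w)) / of_nat n ^ i = (if i = d then of_real c else 0)"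
    proof (cases "i = d")
      case True
      have "words n (2 * d) \<inter> W = W" unfolding W by auto
      then have "(\<Sum>w\<in>words n (2 * i) \<inter> W. pair_weight A\<^sub>0 w * cnj (e w)) / of_nat n ^ i = (\<Sum>w\<in>W. cnj (e w) * e w)"
        unfolding True sum_divide_distrib by (simp add: e_def mult.commute)
      then show ?thesis using True e_sq by simp
    next
      case False
      then have "words n (2 * i) \<inter> W = {}" unfolding W by (auto simp: words_def)
      then show ?thesis using False by simp
    qed
    finally show ?thesis .
  qed
  have "\<tau> (Z' * Y n) = (\<Sum>i\<le>d. of_real (coeff p i) * \<tau> (Z' * quad_form X n ^ i))"
    unfolding Y_def sum_distrib_left by (simp add: tr_sum tr_scale M_intros ZM quad_form_M)
  also have "\<dots> = (\<Sum>i\<le>d. if i = d then of_real (coeff p d * c) else 0)"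
    by (intro sum.cong refl) (simp add: ZQ)
  also have "\<dots> = of_real (coeff p d * c)" by simp
  \<comment> \<open>The same \<open>c\<close> is the squared length of \<open>Z\<close> and a factor
    of its pairing with \<open>Y n\<close>, so one \<open>c\<close> cancels in
    Cauchy-Schwarz.\<close>
  finally have "(coeff p d * c)\<^sup>2 \<le> c * Re (\<tau> (Y n * Y n))"
    using tr_Cauchy_Schwarz[of Z Z' "Y n" "Y n"] ZM YM adj adjY ZZ by (simp add: norm_mult power_mult_distrib)
  moreover have "c > 0" using n \<open>W \<noteq> {}\<close> finW by (simp add: c_def card_gt_0_iff)
  ultimately have "(coeff p d)\<^sup>2 * c \<le> Re (\<tau> (Y n * Y n))"
    by (simp add: power2_eq_square mult_ac)
  then show ?thesis by (simp add: c_def)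
qed

text \<open>Words with a repeated letter use at most \<open>k - 1\<close> letters and are of lower
  order in \<open>n\<close>.\<close>

lemma tendsto_card_distinct_words:
  "(\<lambda>n. card {w \<in> words n k. distinct w} / real n ^ k) \<longlonglongrightarrow> 1"
proof (cases "k = 0")
  case False
  let ?W = "\<lambda>n. {w \<in> words n k. distinct w}" and ?B = "\<lambda>n. {w \<in> words n k. \<not> distinct w}"
  have "(\<lambda>n. card (?B n) / real n ^ k) \<longlonglongrightarrow> 0"
  proof (rule Lim_null_comparison)
    show "(\<lambda>n. real ((k - 1) ^ k) / real n) \<longlonglongrightarrow> 0" by (rule lim_const_over_n)
    show "\<forall>\<^sub>F n in sequentially. norm (real (card (?B n)) / real n ^ k) \<le> real ((k - 1) ^ k) / real n"
      using eventually_ge_at_top[of 1]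
    proof eventually_elim
      case (elim n)
      have "card (set w) \<le> k - 1" if w: "w \<in> ?B n" for w
      proof -
        have "card (set w) \<le> length w" "card (set w) \<noteq> length w"
          using w card_length[of w] card_distinct[of w] by auto
        then show ?thesis using w by (simp add: words_def)
      qed
      then have "card (?B n) \<le> card {w \<in> words n k. card (set w) \<le> k - 1}" by (intro card_mono) auto
      also have "\<dots> \<le> (k - 1) ^ k * n ^ (k - 1)" by (rule card_words_few_letters[OF elim])
      finally have "real (card (?B n)) \<le> real ((k - 1) ^ k * n ^ (k - 1))" by (rule of_nat_mono)
      then have "real (card (?B n)) / real n ^ k \<le> real ((k - 1) ^ k * n ^ (k - 1)) / real n ^ k"
        by (rule divide_right_mono) simp
      also have "\<dots> = real ((k - 1) ^ k) / real n"
      proof -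
        have "real n ^ k = real n ^ (k - 1) * real n" using False by (cases k) simp_all
        then show ?thesis using elim by simp
      qed
      finally show ?case by simp
    qed
  qed
  then have "(\<lambda>n. 1 - card (?B n) / real n ^ k) \<longlonglongrightarrow> 1 - 0" by (intro tendsto_intros)
  moreover have "\<forall>\<^sub>F n in sequentially. 1 - card (?B n) / real n ^ k = card (?W n) / real n ^ k"
    using eventually_ge_at_top[of 1]
  proof eventually_elim
    case (elim n)
    have "card (?W n) + card (?B n) = card (?W n \<union> ?B n)" by (rule card_Un_disjoint[symmetric]) auto
    also have "?W n \<union> ?B n = words n k" by auto
    finally have "card (?W n) + card (?B n) = n ^ k" by (simp only: card_words)
    then have "real (card (?W n)) + real (card (?B n)) = real n ^ k"
      by (simp only: of_nat_add[symmetric] of_nat_power[symmetric])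
    then show ?case using elim by (simp add: field_simps)
  qed
  ultimately show ?thesis by (auto intro: Lim_transform_eventually)
next
  case True
  have "{w \<in> words n 0. distinct w} = {[]}" for n by auto
  then show ?thesis using True by simp
qed

text \<open>Each approximating moment is real, being the trace of a self-adjoint element.\<close>

lemma zigzag_moment_complex: "complex_of_real (zigzag_moment m) = nc_moment zigzag_cumulant m"
proof -
  have "(\<lambda>n. Im (\<tau> (quad_form X n ^ m))) \<longlonglongrightarrow> Im (nc_moment zigzag_cumulant m)"
    by (intro tendsto_Im tendsto_tr_quad_form)
  moreover have "Im (\<tau> (quad_form X n ^ m)) = 0" for n
    by (intro tr_selfadjoint_real M_power quad_form_M is_adjoint_power quad_form_adjoint)
  ultimately have "Im (nc_moment zigzag_cumulant m) = 0" by (simp add: LIMSEQ_const_iff)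
  then show ?thesis by (simp add: zigzag_moment_def complex_eq_iff)
qed

text \<open>The lower bound of \<open>tr_poly_quad_form_ge\<close> converges to a positive number,
  the squared leading coefficient divided by 2^d with d the degree, so positivity survives the limit
  strictly.\<close>

lemma zigzag_moment_pos:
  assumes "p \<noteq> 0"
  shows "moment_functional zigzag_moment (p * p) > 0"
proof -
  let ?d = "degree p"
  define Y where "Y n = (\<Sum>i\<le>?d. of_real (coeff p i) *\<^sub>C quad_form X n ^ i)" for n
  let ?W = "\<lambda>n. {w \<in> words n (2 * ?d). distinct w}"
  have "\<tau> (Y n * Y n) = (\<Sum>i\<le>?d. \<Sum>j\<le>?d. of_real (coeff p i * coeff p j) * \<tau> (quad_form X n ^ (i + j)))" for n
    unfolding Y_def sum_product
    by (simp add: tr_sum tr_scale M_intros quad_form_M scaleC_scaleC power_add mult.commute)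
  then have "(\<lambda>n. \<tau> (Y n * Y n)) \<longlonglongrightarrow>
      (\<Sum>i\<le>?d. \<Sum>j\<le>?d. of_real (coeff p i * coeff p j) * nc_moment zigzag_cumulant (i + j))"
    by (simp only:) (intro tendsto_intros tendsto_tr_quad_form)
  then have "(\<lambda>n. Re (\<tau> (Y n * Y n))) \<longlonglongrightarrow> moment_functional zigzag_moment (p * p)"
    unfolding moment_functional_mult zigzag_moment_def by (auto dest: tendsto_Re)
  moreover have "(\<lambda>n. (coeff p ?d)\<^sup>2 * (1 / 2) ^ ?d * (card (?W n) / real n ^ (2 * ?d))) \<longlonglongrightarrow>
      (coeff p ?d)\<^sup>2 * (1 / 2) ^ ?d * 1"
    by (intro tendsto_mult tendsto_const tendsto_card_distinct_words)
  moreover have "\<forall>\<^sub>F n in sequentially.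
      (coeff p ?d)\<^sup>2 * (1 / 2) ^ ?d * (card (?W n) / real n ^ (2 * ?d)) \<le> Re (\<tau> (Y n * Y n))"
    \<comment> \<open>Words of length \<open>2 * ?d\<close> with distinct letters exist only once
      \<open>n\<close> has reached that length.\<close>
    using eventually_ge_at_top[of "max 1 (2 * ?d)"]
  proof eventually_elim
    case (elim n)
    then have "[1..<Suc (2 * ?d)] \<in> ?W n" by (auto simp: words_def)
    then have "?W n \<noteq> {}" by blast
    then show ?case using tr_poly_quad_form_ge[of n "?W n" p] elim by (simp add: Y_def mult_ac)
  qed
  ultimately have "(coeff p ?d)\<^sup>2 * (1 / 2) ^ ?d * 1 \<le> moment_functional zigzag_moment (p * p)"
    by (intro tendsto_le[OF sequentially_bot])
  moreover have "(coeff p ?d)\<^sup>2 * (1 / 2) ^ ?d * 1 > (0::real)" using assms by simp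
  ultimately show ?thesis by linarith
qed

lemma zigzag_limit_exists:
  "\<exists>(N :: ell2 bop set) \<phi> Y. tracial_ncps N \<phi> \<and> Y \<in> N \<and> selfadjoint Y \<and>
    converges_in_distribution \<tau> (quad_form X) \<phi> Y \<and>
    (\<lambda>z. 1 / 2 * (tan z + 1 / cos z - 1)) has_fps_expansion R_transform \<phi> Y"
proof -
  \<comment> \<open>The constants 2 and 4 are those of \<open>norm_nc_moment_le\<close>; in
    \<open>moment_ncps\<close> the 4 becomes the bound on the Jacobi coefficients.\<close>
  have "\<bar>zigzag_moment k\<bar> \<le> 2 * 4 ^ k" for k
    using abs_Re_le_cmod[of "nc_moment zigzag_cumulant k"] norm_nc_moment_le[of zigzag_cumulant k] zigzag_cumulant_le
    by (simp add: zigzag_moment_def zigzag_cumulant_def order.trans)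
  then obtain N :: "ell2 bop set" and \<phi> Y where Y: "tracial_ncps N \<phi>" "Y \<in> N" "selfadjoint Y"
    "\<And>k. \<phi> (Y ^ k) = of_real (zigzag_moment k)"
    using moment_ncps[of zigzag_moment 2 4] zigzag_moment_pos by (auto simp: zigzag_moment_def)
  have nc_moment: "\<phi> (Y ^ k) = nc_moment zigzag_cumulant k" for k by (simp add: Y(4) zigzag_moment_complex)
  have "R_transform \<phi> Y = cumulant_fps \<alpha>\<^sub>0 \<beta>\<^sub>0"
    unfolding R_transform_def
    by (rule fps_ext) (simp add: free_cumulant_replicate[OF nc_moment] zigzag_cumulant_def del: replicate_Suc)
  moreover have "converges_in_distribution \<tau> (quad_form X) \<phi> Y"
    unfolding converges_in_distribution_def nc_moment by (intro allI tendsto_tr_quad_form)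
  ultimately show ?thesis using Y(1-3) zigzag_has_fps_expansion by metis
qed

end

theorem proposition4p5:
  fixes M :: "'h::chilbert_space bop set"
    and \<tau> :: "'h bop \<Rightarrow> complex"
    and X\<^sub>0 :: "'h bop"
    and X :: "nat \<Rightarrow> 'h bop"
    and Q :: "nat \<Rightarrow> 'h bop"
  assumes "tracial_ncps M \<tau>"
    and "X\<^sub>0 \<in> M" and "selfadjoint X\<^sub>0" and "\<tau> X\<^sub>0 = 0" and "variance \<tau> X\<^sub>0 = 1"
    and "\<And>k. k \<ge> 1 \<Longrightarrow> X k \<in> M"
    and "\<And>k. k \<ge> 1 \<Longrightarrow> selfadjoint (X k)"
    and "\<And>k. k \<ge> 1 \<Longrightarrow> identically_distributed \<tau> (X k) X\<^sub>0"
    and "free_variables \<tau> {1..} X"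
    and Q_def: "\<And>n. Q n = (1 / (2 * of_nat n)) *\<^sub>C
      (\<Sum>(k, l) \<in> {(k, l). 1 \<le> k \<and> k < l \<and> l \<le> n}.
         X k * X l + X l * X k + \<i> *\<^sub>C (X k * X l - X l * X k))"
  shows "\<exists>(N :: ell2 bop set) \<phi> Y.
    tracial_ncps N \<phi> \<and> Y \<in> N \<and> selfadjoint Y \<and>
    converges_in_distribution \<tau> Q \<phi> Y \<and>
    (\<lambda>z. 1 / 2 * (tan z + 1 / cos z - 1)) has_fps_expansion R_transform \<phi> Y"
proof -
  interpret free_copies M \<tau> X "\<lambda>m. \<tau> (X\<^sub>0 ^ m)"
  proof
    show "tracial_ncps M \<tau>" "\<And>k. k \<ge> 1 \<Longrightarrow> X k \<in> M" "free_variables \<tau> {1..} X" by fact+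
    show "is_adjoint (X k) (X k)" if "k \<ge> 1" for k
      using assms(7)[OF that] by (simp add: selfadjoint_def)
    show "\<tau> (X k ^ m) = \<tau> (X\<^sub>0 ^ m)" if "k \<ge> 1" for k m
      using assms(8)[OF that] by (simp add: identically_distributed_def)
    show "\<tau> (X\<^sub>0 ^ 1) = 0" "\<tau> (X\<^sub>0 ^ 2) = 1" using assms(4,5) by (simp_all add: variance_def)
  qed
  \<comment> \<open>This includes n = 0, where both prefactors are 0 by the convention for division
    by zero.\<close>
  have "Q = quad_form X" using Q_def by (intro ext) (simp only: quad_form_eq)
  then show ?thesis using zigzag_limit_exists by simp
qed

end
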